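(* Let $K$ be a field, $S=K[x_1,\ldots,x_n]$, and let $I=\bigcap_{i=1}^4 P_i$ be a reduced (i.e. irredundant) intersection of four monomial prime ideals of $S$. Then Stanley's Conjecture holds for $I$, that is, $$\operatorname{sdepth}_S I\geq \operatorname{depth}_S I.$$
   Context: A monomial prime ideal of $S=K[x_1,\ldots,x_n]$ is an ideal generated by a subset of the variables. The intersection $\bigcap_{i} P_i$ is reduced (irredundant) if no $P_i$ can be omitted without changing the intersection, i.e. $P_i\not\subset P_j$ for $i\ne j$. For a nonzero monomial ideal $I\subset S$, a monomial $u\in I$ and a subset $Z\subset\{x_1,\ldots,x_n\}$, $uK[Z]$ denotes the $K$-linear subspace generated by all $uf$ with $f\in K[Z]$. A Stanley decomposition of $I$ is a presentation $\mathcal D:\ I=\bigoplus_{i=1}^r u_iK[Z_i]$ of $I$ as a finite direct sum of $K$-subspaces, with $u_i\in I$ monomials, $Z_i\subset\{x_1,\ldots,x_n\}$ and $u_iK[Z_i]\subset I$. Set $\operatorname{sdepth}(\mathcal D)=\min\{|Z_i|: i=1,\ldots,r\}$ and $\operatorname{sdepth}_S I=\max\{\operatorname{sdepth}(\mathcal D):\ \mathcal D \text{ a Stanley decomposition of } I\}$. Here $\operatorname{depth}_S$ of a finitely generated graded $S$-module is the depth with respect to the maximal ideal $(x_1,\ldots,x_n)$, and $\operatorname{depth}_S I$ is the depth of $I$ as an $S$-module. *)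

theory Defs
  imports "HOL-Library.Poly_Mapping" "HOL-Library.Extended_Nat"
begin

text \<open>
  The ring \<open>S = K[x\<^sub>1, \<dots>, x\<^sub>n]\<close> is the type \<open>('v, 'k) mpoly\<close>: the variables are indexed by a
  finite type \<open>'v\<close> with \<open>n\<close> elements, and a polynomial is a finitely supported map from exponent
  vectors \<open>'v \<Rightarrow>\<^sub>0 nat\<close> to coefficients. Multiplication is convolution.
\<close>

type_synonym ('v, 'k) mpoly = "('v \<Rightarrow>\<^sub>0 nat) \<Rightarrow>\<^sub>0 'k"

definition monomial :: "('v \<Rightarrow>\<^sub>0 nat) \<Rightarrow> ('v, 'k::field) mpoly" where
  "monomial t = Poly_Mapping.single t 1"

definition var :: "'v \<Rightarrow> ('v, 'k::field) mpoly" where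
  "var x = monomial (Poly_Mapping.single x 1)"

definition kscale :: "'k::field \<Rightarrow> ('v, 'k) mpoly \<Rightarrow> ('v, 'k) mpoly" where
  "kscale c f = Poly_Mapping.single 0 c * f"

text \<open>
  The ring as a module over itself: its submodules are the ideals, and \<open>ideal.span A\<close> is the
  ideal generated by \<open>A\<close>.
\<close>

interpretation ideal: module "(*) :: 'a::comm_ring_1 \<Rightarrow> 'a \<Rightarrow> 'a"
  by unfold_locales (simp_all add: algebra_simps)

interpretation kspace: vector_space "kscale :: 'k::field \<Rightarrow> ('v, 'k) mpoly \<Rightarrow> ('v, 'k) mpoly"
proof
  fix a b :: 'k and f g :: "('v, 'k) mpoly"
  show "kscale a (f + g) = kscale a f + kscale a g"
    by (simp add: kscale_def distrib_left)
  show "kscale (a + b) f = kscale a f + kscale b f"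
    by (simp add: kscale_def single_add distrib_right)
  show "kscale a (kscale b f) = kscale (a * b) f"
    by (simp add: kscale_def mult_single flip: mult.assoc)
  show "kscale 1 f = f"
    by (simp add: kscale_def)
qed

text \<open>The product \<open>J M\<close> of an ideal with an ideal \<open>M\<close> regarded as a module.\<close>

definition ideal_mult :: "'a::comm_ring_1 set \<Rightarrow> 'a set \<Rightarrow> 'a set" where
  "ideal_mult J M = ideal.span {a * x |a x. a \<in> J \<and> x \<in> M}"

text \<open>
  An \<open>M\<close>-regular sequence \<open>a\<^sub>1, \<dots>, a\<^sub>r\<close> for an ideal \<open>M\<close> regarded as a module: each \<open>a\<^sub>i\<close> is a
  nonzerodivisor on \<open>M / (a\<^sub>1, \<dots>, a\<^bsub>i-1\<^esub>) M\<close>, and \<open>M \<noteq> (a\<^sub>1, \<dots>, a\<^sub>r) M\<close>.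
\<close>

definition regular_sequence :: "'a::comm_ring_1 set \<Rightarrow> 'a list \<Rightarrow> bool" where
  "regular_sequence M as \<longleftrightarrow>
     (\<forall>i < length as. \<forall>x \<in> M.
        as ! i * x \<in> ideal_mult (ideal.span (set (take i as))) M \<longrightarrow>
        x \<in> ideal_mult (ideal.span (set (take i as))) M) \<and>
     ideal_mult (ideal.span (set as)) M \<noteq> M"

definition irrelevant_ideal :: "('v, 'k::field) mpoly set" where
  "irrelevant_ideal = ideal.span (range var)"

text \<open>
  The depth of the \<open>S\<close>-module \<open>I\<close> with respect to \<open>(x\<^sub>1, \<dots>, x\<^sub>n)\<close>, for a nonzero ideal \<open>I\<close>.
  (The convention that the zero module has infinite depth is not built in.)
\<close>

definition depth :: "('v, 'k::field) mpoly set \<Rightarrow> enat" where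
  "depth I = (SUP as \<in> {as. set as \<subseteq> irrelevant_ideal \<and> regular_sequence I as}. enat (length as))"

definition monomial_prime_ideal :: "('v, 'k::field) mpoly set \<Rightarrow> bool" where
  "monomial_prime_ideal P \<longleftrightarrow> (\<exists>Z. P = ideal.span (var ` Z))"

definition reduced_intersection :: "'i set \<Rightarrow> ('i \<Rightarrow> 'a set) \<Rightarrow> bool" where
  "reduced_intersection A P \<longleftrightarrow> (\<forall>i \<in> A. (\<Inter>j \<in> A - {i}. P j) \<noteq> (\<Inter>j \<in> A. P j))"

text \<open>The polynomials in the variables of \<open>Z\<close>, \<open>K[Z]\<close>.\<close>

definition polys_in :: "'v set \<Rightarrow> ('v, 'k::field) mpoly set" where
  "polys_in Z = {f. \<forall>t \<in> Poly_Mapping.keys f. Poly_Mapping.keys t \<subseteq> Z}"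

text \<open>\<open>u K[Z]\<close>, where the monomial \<open>u\<close> is given by its exponent vector \<open>t\<close>.\<close>

definition stanley_space :: "('v \<Rightarrow>\<^sub>0 nat) \<Rightarrow> 'v set \<Rightarrow> ('v, 'k::field) mpoly set" where
  "stanley_space t Z = kspace.span {monomial t * f |f. f \<in> polys_in Z}"

definition is_direct_sum :: "'i set \<Rightarrow> ('i \<Rightarrow> 'a::ab_group_add set) \<Rightarrow> 'a set \<Rightarrow> bool" where
  "is_direct_sum A V W \<longleftrightarrow>
     W = {\<Sum>i\<in>A. v i |v. \<forall>i\<in>A. v i \<in> V i} \<and>
     (\<forall>v. (\<forall>i\<in>A. v i \<in> V i) \<and> (\<Sum>i\<in>A. v i) = 0 \<longrightarrow> (\<forall>i\<in>A. v i = 0))"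

text \<open>The list of pairs \<open>(t\<^sub>i, Z\<^sub>i)\<close> encodes \<open>I = \<Oplus>\<^sub>i u\<^sub>i K[Z\<^sub>i]\<close>, \<open>u\<^sub>i\<close> having exponent \<open>t\<^sub>i\<close>.\<close>

definition stanley_decomposition ::
  "('v, 'k::field) mpoly set \<Rightarrow> (('v \<Rightarrow>\<^sub>0 nat) \<times> 'v set) list \<Rightarrow> bool" where
  "stanley_decomposition I D \<longleftrightarrow>
     (\<forall>(t, Z) \<in> set D. monomial t \<in> I \<and> stanley_space t Z \<subseteq> I) \<and>
     is_direct_sum {..<length D} (\<lambda>i. stanley_space (fst (D ! i)) (snd (D ! i))) I"

definition sdepth_decomposition :: "(('v \<Rightarrow>\<^sub>0 nat) \<times> 'v set) list \<Rightarrow> nat" where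
  "sdepth_decomposition D = Min ((\<lambda>(t, Z). card Z) ` set D)"

text \<open>
  For a nonzero monomial ideal and finite \<open>'v\<close> this is the maximum of a nonempty set of numbers
  bounded by \<open>n\<close>.
\<close>

definition sdepth :: "('v, 'k::field) mpoly set \<Rightarrow> nat" where
  "sdepth I = Max {sdepth_decomposition D |D. stanley_decomposition I D}"

end

theory Submission
  imports Defs
begin

text \<open>
  For a prime generated by the variables in \<open>Z i\<close> let the facet \<open>F i\<close> be the complement of \<open>Z i\<close>,
  and let \<open>\<Delta>\<close> be the simplicial complex of all subsets of these facets. A monomial lies in the
  intersection \<open>I\<close> of the primes iff its support is a nonface of \<open>\<Delta>\<close>. Depth and Stanley depth are
  compared through a condition on \<open>\<Delta>\<close>: \<open>link_acyclic K \<Delta> d\<close> says that the reduced cohomology of the link of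
  a face \<open>\<sigma>\<close> vanishes in every dimension below \<open>d - card \<sigma> - 2\<close>.

  A regular sequence of length \<open>d\<close> on \<open>I\<close> makes the Koszul complex of the squares of the variables, with
  coefficients in \<open>I\<close>, exact in degrees below \<open>d\<close>. Suitable multidegrees of this complex are the cochain
  complexes of the full simplices relative to the links of \<open>\<Delta>\<close>, so the links are acyclic in the stated range
  (\<open>regular_sequence_link_acyclic\<close>).

  Conversely, a partition of the nonfaces into intervals \<open>{A..B}\<close> with \<open>card B \<ge> d\<close> is a Stanley decomposition
  of \<open>I\<close> with summands of dimension at least \<open>d\<close> (\<open>le_sdepth_of_partitionable\<close>). Such a partition is built
  by recursion on a vertex \<open>x\<close>: the nonfaces that contain \<open>x\<close> correspond to those of the link of \<open>x\<close>, where
  \<open>d - 1\<close> suffices and is inherited, and the others are the nonfaces of the deletion, which must satisfy the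
  condition with the same \<open>d\<close>. For arbitrary complexes there may be no such \<open>x\<close>. With at most four facets,
  none contained in another and without a common vertex, a vertex that lies in the fewest facets works unless
  every vertex misses just one facet (\<open>link_acyclic_delete_rarest_vertex\<close>); in that case each nonface already has as
  many elements as there are facets, and \<open>d\<close> is no larger than that.

  By the long exact sequence of a deletion, removing \<open>x\<close> can only do harm at a face \<open>\<sigma>\<close> for which the link of
  \<open>\<sigma> \<union> {x}\<close> is not a cone, that is, for which \<open>\<sigma> \<union> {x}\<close> is an intersection of facets, and only when \<open>d\<close> has
  the largest value that this link permits. A vertex in the fewest facets lies in at most two, so there are
  few such faces. In the critical cases either the deletion is seen to be harmless, or some other link carries
  a nonzero class of low dimension, contrary to the hypothesis. These classes are pulled back from the boundary of a simplex or
  from a cycle along a colouring of the vertices (\<open>rainbow_simplex_bound\<close>, \<open>rainbow_cycle_bound\<close>).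
\<close>

section \<open>Alternating coboundaries and acyclicity\<close>

definition alt_sign :: "('v \<Rightarrow> nat) \<Rightarrow> 'v \<Rightarrow> 'v set \<Rightarrow> 'a::comm_ring_1" where
  "alt_sign ord x T = (-1) ^ card {y \<in> T. ord y < ord x}"

text \<open>
  With weights \<open>w\<close> this is the differential of the Koszul cochain complex of the family \<open>w\<close>, with all weights 1
  the simplicial coboundary. A cochain of degree \<open>i\<close> is a function on all finite sets of which only the
  values on sets with \<open>i\<close> elements matter; in the simplicial case these are the faces of dimension \<open>i - 1\<close>.
\<close>

definition cobd :: "('v \<Rightarrow> nat) \<Rightarrow> ('v \<Rightarrow> 'a::comm_ring_1) \<Rightarrow> ('v set \<Rightarrow> 'a) \<Rightarrow> 'v set \<Rightarrow> 'a" where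
  "cobd ord w c T = (\<Sum>x\<in>T. alt_sign ord x T * (w x * c (T - {x})))"

text \<open>
  Interior multiplication by the linear form with coefficients \<open>g\<close>, the usual null homotopy on Koszul complexes.
\<close>

definition contraction :: "('v::finite \<Rightarrow> nat) \<Rightarrow> ('v \<Rightarrow> 'a::comm_ring_1) \<Rightarrow> ('v set \<Rightarrow> 'a) \<Rightarrow> 'v set \<Rightarrow> 'a" where
  "contraction ord g c T = (\<Sum>x\<in>-T. alt_sign ord x (insert x T) * (g x * c (insert x T)))"

lemma alt_sign_square [simp]: "alt_sign ord x T * alt_sign ord x T = (1::'a::comm_ring_1)"
  by (simp add: alt_sign_def flip: power_add mult_2)

lemma alt_sign_remove_below:
  assumes "finite T" "y \<in> T" "ord y < ord x"
  shows "alt_sign ord x T = - (alt_sign ord x (T - {y}) :: 'a::comm_ring_1)"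
proof -
  have "{z \<in> T. ord z < ord x} = insert y {z \<in> T - {y}. ord z < ord x}"
    using assms by auto
  then have "card {z \<in> T. ord z < ord x} = Suc (card {z \<in> T - {y}. ord z < ord x})"
    using assms by (simp add: card_insert_if)
  then show ?thesis by (simp add: alt_sign_def)
qed

lemma alt_sign_remove_above:
  assumes "\<not> ord y < ord x"
  shows "alt_sign ord x (T - {y}) = (alt_sign ord x T :: 'a::comm_ring_1)"
proof -
  have "{z \<in> T - {y}. ord z < ord x} = {z \<in> T. ord z < ord x}"
    using assms by auto
  then show ?thesis by (simp add: alt_sign_def)
qed

text \<open>
  The sign rule behind both identities below: striking out two elements in the two possible orders
  gives opposite signs.
\<close>

lemma alt_sign_swap:
  assumes "inj ord" "finite T" "y \<in> T" "z \<in> T" "y \<noteq> z"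
  shows "alt_sign ord y T * alt_sign ord z (T - {y})
         = - (alt_sign ord z T * alt_sign ord y (T - {z}) :: 'a::comm_ring_1)"
proof -
  have "ord y \<noteq> ord z" using assms by (auto dest: injD)
  then consider "ord y < ord z" | "ord z < ord y" by linarith
  then show ?thesis
  proof cases
    case 1
    then show ?thesis
      using alt_sign_remove_below[of T y ord z, where 'a = 'a] alt_sign_remove_above[of ord z y T, where 'a = 'a] assms
      by (simp add: mult.commute)
  next
    case 2
    then show ?thesis
      using alt_sign_remove_below[of T z ord y, where 'a = 'a] alt_sign_remove_above[of ord y z T, where 'a = 'a] assms
      by (simp add: mult.commute)
  qed
qed

text \<open>
  The terms that strike out \<open>x\<close> and then \<open>y\<close> cancel those that strike out \<open>y\<close> and then \<open>x\<close>. The double sum is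
  split at the order, because in characteristic 2 antisymmetry alone would not make it vanish.
\<close>

lemma cobd_cobd:
  fixes c :: "'v set \<Rightarrow> 'a::comm_ring_1"
  assumes "inj ord" "finite T"
  shows "cobd ord w (cobd ord w c) T = 0"
proof -
  define g where "g x y = alt_sign ord x T * alt_sign ord y (T - {x}) * (w x * w y * c (T - {x,y}))" for x y
  have "cobd ord w (cobd ord w c) T = (\<Sum>x\<in>T. \<Sum>y\<in>T - {x}. g x y)"
    unfolding cobd_def[of _ _ _ T]
  proof (rule sum.cong[OF refl])
    fix x
    have "alt_sign ord x T * (w x * (\<Sum>y\<in>T - {x}. h y)) = (\<Sum>y\<in>T - {x}. alt_sign ord x T * (w x * h y))" for h
      by (simp only: sum_distrib_left)
    moreover have "T - {x} - {y} = T - {x,y}" for y by blast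
    ultimately show "alt_sign ord x T * (w x * cobd ord w c (T - {x})) = (\<Sum>y\<in>T - {x}. g x y)"
      unfolding cobd_def g_def by (simp only: mult_ac)
  qed
  also have "\<dots> = (\<Sum>x\<in>T. (\<Sum>y\<in>{y\<in>T. ord x < ord y}. g x y) + (\<Sum>y\<in>{y\<in>T. ord y < ord x}. g x y))"
  proof (rule sum.cong[OF refl])
    fix x assume "x \<in> T"
    have "T - {x} = {y\<in>T. ord x < ord y} \<union> {y\<in>T. ord y < ord x}"
    proof (intro set_eqI)
      fix y
      have "x \<noteq> y \<Longrightarrow> ord x < ord y \<or> ord y < ord x"
        using assms(1) by (metis injD linorder_neqE_nat)
      then show "y \<in> T - {x} \<longleftrightarrow> y \<in> {y\<in>T. ord x < ord y} \<union> {y\<in>T. ord y < ord x}"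
        by auto
    qed
    moreover have disj: "{y\<in>T. ord x < ord y} \<inter> {y\<in>T. ord y < ord x} = {}" by auto
    ultimately show "(\<Sum>y\<in>T - {x}. g x y) =
        (\<Sum>y\<in>{y\<in>T. ord x < ord y}. g x y) + (\<Sum>y\<in>{y\<in>T. ord y < ord x}. g x y)"
      using assms(2) by (simp add: sum.union_disjoint del: Diff_insert0)
  qed
  also have "\<dots> = (\<Sum>x\<in>T. \<Sum>y\<in>{y\<in>T. ord x < ord y}. g x y) + (\<Sum>x\<in>T. \<Sum>y\<in>{y\<in>T. ord y < ord x}. g x y)"
    by (rule sum.distrib)
  also have "(\<Sum>x\<in>T. \<Sum>y\<in>{y\<in>T. ord y < ord x}. g x y) = (\<Sum>y\<in>T. \<Sum>x\<in>{x\<in>T. ord y < ord x}. g x y)"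
    using assms(2) by (rule sum.swap_restrict) (rule assms(2))
  also have "\<dots> = (\<Sum>y\<in>T. \<Sum>x\<in>{x\<in>T. ord y < ord x}. - g y x)"
  proof (intro sum.cong refl)
    fix x y assume *: "y \<in> T" "x \<in> {x \<in> T. ord y < ord x}"
    then have "x \<noteq> y" by auto
    then have "alt_sign ord x T * alt_sign ord y (T - {x})
         = - (alt_sign ord y T * alt_sign ord x (T - {y}) :: 'a)"
      using alt_sign_swap[of ord T x y, where 'a = 'a] assms * by auto
    moreover have "w x * w y * c (T - {x,y}) = w y * w x * c (T - {y,x})"
      by (simp only: insert_commute mult.commute)
    ultimately show "g x y = - g y x" unfolding g_def by (simp only: mult_minus_left)
  qed
  finally show ?thesis by (simp add: sum_negf)
qed

lemma sign_transpose:
  fixes a b c d :: "'a::comm_ring_1"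
  assumes "a * b = - (c * d)" "a * a = 1" "d * d = 1"
  shows "b * d = - (a * c)"
proof -
  have "b * d = (a * a) * (b * d)" unfolding assms(2) by simp
  also have "\<dots> = (a * b) * (a * d)" by (simp only: mult_ac)
  also have "\<dots> = - (c * d * (a * d))" unfolding assms(1) by (simp only: mult_minus_left)
  also have "c * d * (a * d) = a * c * (d * d)" by (simp only: mult_ac)
  finally show ?thesis unfolding assms(3) by simp
qed

lemma sign_regroup:
  fixes a b c d :: "'a::comm_ring_1"
  assumes "a * b = - (c * d)"
  shows "a * (w * (b * (g * k))) = - (c * d * (g * w * k))"
proof -
  have "a * (w * (b * (g * k))) = (a * b) * (g * w * k)" by (simp only: mult_ac)
  then show ?thesis using assms by simp
qed

text \<open>
  The terms of the two composites in which an element \<open>z\<close> of \<open>T\<close> is exchanged for an \<open>x\<close> outside \<open>T\<close> cancel by the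
  sign rule. Those that return to \<open>T\<close> add up to the right-hand side: the elements of \<open>T\<close> come from the first
  composite, the others from the second.
\<close>

lemma contraction_homotopy:
  fixes c :: "'v::finite set \<Rightarrow> 'a::comm_ring_1"
  assumes "inj ord"
  shows "cobd ord w (contraction ord g c) T + contraction ord g (cobd ord w c) T
         = (\<Sum>x\<in>UNIV. g x * w x) * c T"
proof -
  define p where "p x z = alt_sign ord x (insert x T) * alt_sign ord z (insert x T)
      * (g x * w z * c (insert x T - {z}))" for x z
  have "alt_sign ord x (insert x T) * (g x * cobd ord w c (insert x T))
      = g x * w x * c T + (\<Sum>z\<in>T. p x z)" if "x \<in> - T" for x
  proof -
    have x: "insert x T - {x} = T" "x \<notin> T" using that by auto
    have "alt_sign ord x (insert x T) * (g x * cobd ord w c (insert x T))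
      = alt_sign ord x (insert x T) * (g x * (alt_sign ord x (insert x T) * (w x * c T)))
        + (\<Sum>z\<in>T. alt_sign ord x (insert x T) * (g x * (alt_sign ord z (insert x T) * (w z * c (insert x T - {z})))))"
      using x by (simp only: cobd_def finite sum.insert distrib_left sum_distrib_left not_False_eq_True)
    moreover have "alt_sign ord x (insert x T) * (g x * (alt_sign ord x (insert x T) * (w x * c T)))
      = (alt_sign ord x (insert x T) * alt_sign ord x (insert x T)) * (g x * w x * c T)"
      by (simp only: mult_ac)
    ultimately show ?thesis
      unfolding p_def by (simp only: alt_sign_square mult_1_left mult_ac)
  qed
  then have 1: "contraction ord g (cobd ord w c) T
      = (\<Sum>x\<in>-T. g x * w x * c T) + (\<Sum>x\<in>-T. \<Sum>z\<in>T. p x z)"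
    by (simp add: contraction_def sum.distrib)
  have "alt_sign ord z T * (w z * contraction ord g c (T - {z})) = g z * w z * c T + (\<Sum>x\<in>-T. - p x z)"
    if z: "z \<in> T" for z
  proof -
    have c1: "- (T - {z}) = insert z (- T)" "z \<notin> - T" "insert z (T - {z}) = T" using z by auto
    have "alt_sign ord z T * (w z * contraction ord g c (T - {z}))
       = alt_sign ord z T * (w z * (alt_sign ord z T * (g z * c T))) + (\<Sum>x\<in>-T. alt_sign ord z T * (w z * (alt_sign ord x (insert x (T - {z})) * (g x * c (insert x (T - {z}))))))"
      using c1 by (simp only: contraction_def finite sum.insert distrib_left sum_distrib_left not_False_eq_True)
    also have "alt_sign ord z T * (w z * (alt_sign ord z T * (g z * c T)))
      = (alt_sign ord z T * alt_sign ord z T) * (g z * w z * c T)"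
      by (simp only: mult_ac)
    also have "\<dots> = g z * w z * c T" by simp
    also have "(\<Sum>x\<in>-T. alt_sign ord z T * (w z * (alt_sign ord x (insert x (T - {z})) * (g x * c (insert x (T - {z})))))) = (\<Sum>x\<in>-T. - p x z)"
    proof (rule sum.cong[OF refl])
      fix x assume x: "x \<in> - T"
      then have xz: "x \<noteq> z" "insert x (T - {z}) = insert x T - {z}" "insert x T - {x} = T" using z by auto
      have "alt_sign ord x (insert x T) * alt_sign ord z T
         = - (alt_sign ord z (insert x T) * alt_sign ord x (insert x T - {z}) :: 'a)"
        using alt_sign_swap[of ord "insert x T" x z, where 'a = 'a] assms z xz by simp
      then have "alt_sign ord z T * alt_sign ord x (insert x T - {z})
         = - (alt_sign ord x (insert x T) * alt_sign ord z (insert x T) :: 'a)"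
        by (rule sign_transpose) (rule alt_sign_square)+
      then show "alt_sign ord z T * (w z * (alt_sign ord x (insert x (T - {z})) * (g x * c (insert x (T - {z}))))) = - p x z"
        unfolding p_def xz(2) by (rule sign_regroup)
    qed
    finally show ?thesis .
  qed
  then have 2: "cobd ord w (contraction ord g c) T
      = (\<Sum>z\<in>T. g z * w z * c T) + (\<Sum>z\<in>T. \<Sum>x\<in>-T. - p x z)"
    by (simp add: cobd_def[of _ _ _ T] sum.distrib)
  have 3: "(\<Sum>z\<in>T. \<Sum>x\<in>-T. - p x z) = - (\<Sum>x\<in>-T. \<Sum>z\<in>T. p x z)"
    by (subst sum.swap) (simp add: sum_negf)
  have "sum h UNIV = sum h T + sum h (- T)" for h :: "'v \<Rightarrow> 'a"
    using sum.union_disjoint[of T "- T" h] by simp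
  then have "(\<Sum>x\<in>UNIV. g x * w x * c T) = (\<Sum>z\<in>T. g z * w z * c T) + (\<Sum>x\<in>-T. g x * w x * c T)"
    by blast
  moreover have "(a + - e) + (b + e) = a + b" for a b e :: 'a by simp
  ultimately show ?thesis unfolding 1 2 3 sum_distrib_right by (simp only:)
qed

lemma cobd_diff: "cobd ord w (\<lambda>T. a T - b T) T = cobd ord w a T - cobd ord w b T"
  by (simp only: cobd_def right_diff_distrib sum_subtractf)

lemma cobd_cong: "(\<And>x. x \<in> T \<Longrightarrow> a (T - {x}) = b (T - {x})) \<Longrightarrow> cobd ord w a T = cobd ord w b T"
  by (simp add: cobd_def)

text \<open>
  Vanishing of the reduced cohomology of the complex \<open>L\<close> in dimension \<open>s - 1\<close>. Indexing by the number of elements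
  covers the empty face by \<open>s = 0\<close>. The values of a cochain outside \<open>L\<close> are unconstrained, which for
  simplicial \<open>L\<close> has no influence on coboundaries on \<open>L\<close>.
\<close>

definition cohomology_vanishes :: "'k::field itself \<Rightarrow> ('v \<Rightarrow> nat) \<Rightarrow> 'v set set \<Rightarrow> nat \<Rightarrow> bool" where
  "cohomology_vanishes _ ord L s \<longleftrightarrow> (\<forall>\<mu> :: 'v set \<Rightarrow> 'k.
     (\<forall>T\<in>L. card T = Suc s \<longrightarrow> cobd ord (\<lambda>_. 1) \<mu> T = 0) \<longrightarrow>
     (\<exists>\<nu>. \<forall>T\<in>L. card T = s \<longrightarrow> \<mu> T = cobd ord (\<lambda>_. 1) \<nu> T))"

text \<open>
  Contraction towards the apex is a null homotopy.
\<close>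

lemma cohomology_vanishes_cone:
  fixes y :: "'v::finite"
  assumes "inj ord" and apex: "\<And>T. T \<in> L \<Longrightarrow> insert y T \<in> L"
  shows "cohomology_vanishes TYPE('k::field) ord L s"
  unfolding cohomology_vanishes_def
proof (intro allI impI exI ballI)
  fix \<mu> :: "'v set \<Rightarrow> 'k" and T
  assume cocycle: "\<forall>T\<in>L. card T = Suc s \<longrightarrow> cobd ord (\<lambda>_. 1) \<mu> T = 0"
    and T: "T \<in> L" "card T = s"
  let ?g = "\<lambda>x. if x = y then 1 else 0 :: 'k"
  \<comment> \<open>a nonzero term could only come from \<open>insert y T\<close>, but this is a face of \<open>L\<close>\<close>
  have "contraction ord ?g (cobd ord (\<lambda>_. 1) \<mu>) T = 0"
    unfolding contraction_def
  proof (rule sum.neutral, rule ballI)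
    fix x assume "x \<in> - T"
    then show "alt_sign ord x (insert x T) * (?g x * cobd ord (\<lambda>_. 1) \<mu> (insert x T)) = 0"
      using cocycle apex[OF T(1)] T(2) by auto
  qed
  then show "\<mu> T = cobd ord (\<lambda>_. 1) (contraction ord ?g \<mu>) T"
    using contraction_homotopy[OF assms(1), of "\<lambda>_. 1" ?g \<mu> T] by simp
qed

definition link :: "'v set set \<Rightarrow> 'v set \<Rightarrow> 'v set set" where
  "link \<Delta> \<sigma> = {T. T \<inter> \<sigma> = {} \<and> T \<union> \<sigma> \<in> \<Delta>}"

definition deletion :: "'v set set \<Rightarrow> 'v \<Rightarrow> 'v set set" where
  "deletion \<Delta> x = {T \<in> \<Delta>. x \<notin> T}"

definition simplicial :: "'v set set \<Rightarrow> bool" where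
  "simplicial \<Delta> \<longleftrightarrow> (\<forall>T\<in>\<Delta>. \<forall>S\<subseteq>T. S \<in> \<Delta>)"

text \<open>
  A piece of the long exact sequence of the deletion in \<open>L\<close>: the obstruction to extending a cocycle from the
  deletion to \<open>L\<close> lies in the cohomology of the link of \<open>x\<close>. If the cocycle is the coboundary of \<open>\<rho>\<close> on the link,
  the coboundary of \<open>\<rho>\<close> extends it to the faces through \<open>x\<close>.
\<close>

lemma cohomology_vanishes_deletion:
  fixes x :: "'v::finite"
  assumes "inj ord" and "simplicial L"
    and L: "cohomology_vanishes TYPE('k::field) ord L s" and M: "cohomology_vanishes TYPE('k) ord (link L {x}) s"
  shows "cohomology_vanishes TYPE('k) ord (deletion L x) s"
  unfolding cohomology_vanishes_def
proof (intro allI impI)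
  let ?d = "cobd ord (\<lambda>_. 1 :: 'k)"
  fix \<mu> :: "'v set \<Rightarrow> 'k"
  assume cocycle: "\<forall>T\<in>deletion L x. card T = Suc s \<longrightarrow> ?d \<mu> T = 0"
  have sub: "link L {x} \<subseteq> deletion L x"
    using assms(2) by (fastforce simp: link_def deletion_def simplicial_def)
  then have "\<exists>\<rho>. \<forall>T\<in>link L {x}. card T = s \<longrightarrow> \<mu> T = ?d \<rho> T"
    using M cocycle unfolding cohomology_vanishes_def by blast
  then obtain \<rho> where \<rho>: "\<And>T. T \<in> link L {x} \<Longrightarrow> card T = s \<Longrightarrow> \<mu> T = ?d \<rho> T" by blast
  define \<mu>' where "\<mu>' T = (if x \<in> T then ?d \<rho> T else \<mu> T)" for T
  have "?d \<mu>' T = 0" if T: "T \<in> L" "card T = Suc s" for T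
  proof (cases "x \<in> T")
    case False
    then have "?d \<mu>' T = ?d \<mu> T" by (intro cobd_cong) (simp add: \<mu>'_def)
    with cocycle T False show ?thesis by (simp add: deletion_def)
  next
    case True
    have "?d \<mu>' T = ?d (?d \<rho>) T"
    proof (rule cobd_cong)
      fix y assume y: "y \<in> T"
      have "T - {x} \<in> link L {x}" "card (T - {x}) = s"
        using True T by (auto simp: link_def insert_absorb)
      then show "\<mu>' (T - {y}) = ?d \<rho> (T - {y})"
        using \<rho> by (cases "y = x") (auto simp: \<mu>'_def True)
    qed
    then show ?thesis using cobd_cobd[OF assms(1)] by simp
  qed
  then have "\<exists>\<nu>. \<forall>T\<in>L. card T = s \<longrightarrow> \<mu>' T = ?d \<nu> T"
    using L unfolding cohomology_vanishes_def by blast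
  then obtain \<nu> where \<nu>: "\<And>T. T \<in> L \<Longrightarrow> card T = s \<Longrightarrow> \<mu>' T = ?d \<nu> T" by blast
  then have "\<mu> T = ?d \<nu> T" if "T \<in> deletion L x" "card T = s" for T
    using that \<nu>[of T] by (simp add: deletion_def \<mu>'_def)
  then show "\<exists>\<nu>. \<forall>T\<in>deletion L x. card T = s \<longrightarrow> \<mu> T = ?d \<nu> T" by blast
qed

section \<open>Regular sequences make the Koszul complex exact\<close>

text \<open>
  Exactness in degree \<open>i\<close> of the Koszul cochain complex of \<open>w\<close> with coefficients in the quotient of \<open>M\<close> by \<open>N\<close>.
  Classes are represented by cochains with values in \<open>M\<close>, so that no quotient modules have to be formed.
\<close>

definition koszul_exact ::
  "('v::finite \<Rightarrow> nat) \<Rightarrow> ('v \<Rightarrow> 'a::comm_ring_1) \<Rightarrow> 'a set \<Rightarrow> 'a set \<Rightarrow> nat \<Rightarrow> bool" where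
  "koszul_exact ord w M N i \<longleftrightarrow> (\<forall>c. (\<forall>T. c T \<in> M) \<and> (\<forall>T. card T = Suc i \<longrightarrow> cobd ord w c T \<in> N) \<longrightarrow>
     (\<exists>b. (\<forall>T. b T \<in> M) \<and> (\<forall>T. card T = i \<longrightarrow> c T - cobd ord w b T \<in> N)))"

lemma cobd_scale: "cobd ord w (\<lambda>T. r * b T) T = r * cobd ord w b T"
  unfolding cobd_def sum_distrib_left by (intro sum.cong refl) (simp only: mult_ac)

lemma cobd_in_ideal:
  "ideal.subspace N \<Longrightarrow> (\<And>x. x \<in> T \<Longrightarrow> b (T - {x}) \<in> N) \<Longrightarrow> cobd ord w b T \<in> N"
  unfolding cobd_def by (intro ideal.subspace_sum ideal.subspace_scale) auto

lemma contraction_in_ideal: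
  "ideal.subspace N \<Longrightarrow> (\<And>x. x \<notin> T \<Longrightarrow> b (insert x T) \<in> N) \<Longrightarrow> contraction ord g b T \<in> N"
  unfolding contraction_def by (intro ideal.subspace_sum ideal.subspace_scale) auto

text \<open>
  Multiplication by \<open>a\<close> is injective on the cohomology of \<open>M/N\<close> in degree \<open>i\<close>, because the kernel comes from the
  cohomology of \<open>M/(N + a M)\<close> in degree \<open>i - 1\<close>. The proof is the diagram chase for the short exact sequence
  given by multiplication with \<open>a\<close>, carried out on representatives.
\<close>

lemma coboundary_cancel_nonzerodivisor:
  fixes M N :: "'a::comm_ring_1 set" and ord :: "'v::finite \<Rightarrow> nat"
  assumes "inj ord" and M: "ideal.subspace M" and N: "ideal.subspace N"
    and nzd: "\<And>x. x \<in> M \<Longrightarrow> a * x \<in> N \<Longrightarrow> x \<in> N"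
    and exact: "\<And>j. i = Suc j \<Longrightarrow> koszul_exact ord w M {n + a * g |n g. n \<in> N \<and> g \<in> M} j"
    and c: "\<And>T. c T \<in> M" and b: "\<And>T. b T \<in> M"
    and eq: "\<And>T. card T = i \<Longrightarrow> a * c T - cobd ord w b T \<in> N"
  shows "\<exists>b. (\<forall>T. b T \<in> M) \<and> (\<forall>T. card T = i \<longrightarrow> c T - cobd ord w b T \<in> N)"
proof (cases i)
  case 0
  have "c {} \<in> N" using nzd[OF c] eq[of "{}"] 0 by (simp add: cobd_def)
  then have "\<forall>T::'v set. card T = i \<longrightarrow> c T - cobd ord w (\<lambda>_. 0) T \<in> N"
    using 0 by (simp add: cobd_def)
  then show ?thesis using ideal.subspace_0[OF M] by (intro exI[of _ "\<lambda>_. 0"]) auto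
next
  case (Suc j)
  let ?d = "cobd ord w" and ?N' = "{n + a * g |n g. n \<in> N \<and> g \<in> M}"
  \<comment> \<open>\<open>b\<close> is a cocycle modulo \<open>N + a M\<close>, hence a coboundary of some \<open>e\<close> up to \<open>a g\<close>; then \<open>c\<close> is the coboundary of \<open>g\<close>\<close>
  have "?d b T \<in> ?N'" if "card T = Suc j" for T
  proof -
    have "- (a * c T - ?d b T) \<in> N" using eq that Suc ideal.subspace_neg[OF N] by blast
    moreover have "?d b T = - (a * c T - ?d b T) + a * c T" by simp
    ultimately show ?thesis using c by blast
  qed
  then obtain e where e: "\<And>T. e T \<in> M" "\<And>T. card T = j \<Longrightarrow> b T - ?d e T \<in> ?N'"
    using exact[OF Suc] b unfolding koszul_exact_def by blast
  then have "\<forall>T. \<exists>g. g \<in> M \<and> (card T = j \<longrightarrow> b T - ?d e T - a * g \<in> N)"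
    using ideal.subspace_0[OF M] by fastforce
  then obtain g where g: "\<And>T. g T \<in> M" "\<And>T. card T = j \<Longrightarrow> b T - ?d e T - a * g T \<in> N"
    by metis
  have "c T - ?d g T \<in> N" if T: "card T = i" for T
  proof (rule nzd)
    show "c T - ?d g T \<in> M"
      using ideal.subspace_diff[OF M c cobd_in_ideal[OF M g(1)]] .
    have "card (T - {x}) = j" if "x \<in> T" for x using T Suc that by simp
    then have "?d (\<lambda>T. b T - ?d e T - a * g T) T \<in> N"
      by (intro cobd_in_ideal N g(2))
    then have "?d b T - a * ?d g T \<in> N"
      using cobd_cobd[OF assms(1), of T w e] by (simp only: cobd_diff cobd_scale) simp
    from ideal.subspace_add[OF N eq[OF T] this]
    show "a * (c T - ?d g T) \<in> N" by (simp add: right_diff_distrib)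
  qed
  with g(1) show ?thesis by blast
qed

lemma coboundary_cancel_power:
  fixes M N :: "'a::comm_ring_1 set" and ord :: "'v::finite \<Rightarrow> nat"
  assumes "inj ord" and M: "ideal.subspace M" and N: "ideal.subspace N"
    and nzd: "\<And>x. x \<in> M \<Longrightarrow> a * x \<in> N \<Longrightarrow> x \<in> N"
    and exact: "\<And>j. i = Suc j \<Longrightarrow> koszul_exact ord w M {n + a * g |n g. n \<in> N \<and> g \<in> M} j"
    and c: "\<And>T. c T \<in> M"
    and "\<exists>b. (\<forall>T. b T \<in> M) \<and> (\<forall>T. card T = i \<longrightarrow> a ^ m * c T - cobd ord w b T \<in> N)"
  shows "\<exists>b. (\<forall>T. b T \<in> M) \<and> (\<forall>T. card T = i \<longrightarrow> c T - cobd ord w b T \<in> N)"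
  using assms(7)
proof (induction m)
  case 0
  then show ?case unfolding power_0 mult_1_left .
next
  case (Suc m)
  from Suc.prems obtain b where b: "\<And>T. b T \<in> M"
      "\<And>T. card T = i \<Longrightarrow> a * (a ^ m * c T) - cobd ord w b T \<in> N"
    unfolding power_Suc mult.assoc by blast
  have "\<And>T. a ^ m * c T \<in> M" using c ideal.subspace_scale[OF M] by blast
  from coboundary_cancel_nonzerodivisor[OF assms(1) M N nzd exact this b]
  show ?case using Suc.IH by blast
qed

text \<open>
  By the homotopy formula the ideal generated by the weights annihilates the cohomology, and some power of \<open>a\<close> lies
  in it. But multiplication by \<open>a\<close> is injective on the cohomology, which is therefore zero.
\<close>

lemma koszul_exact_of_nonzerodivisor:
  fixes M N :: "'a::comm_ring_1 set" and ord :: "'v::finite \<Rightarrow> nat"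
  assumes "inj ord" and M: "ideal.subspace M" and N: "ideal.subspace N"
    and nzd: "\<And>x. x \<in> M \<Longrightarrow> a * x \<in> N \<Longrightarrow> x \<in> N"
    and exact: "\<And>j. i = Suc j \<Longrightarrow> koszul_exact ord w M {n + a * g |n g. n \<in> N \<and> g \<in> M} j"
    and power: "a ^ m = (\<Sum>x\<in>UNIV. g x * w x)"
  shows "koszul_exact ord w M N i"
  unfolding koszul_exact_def
proof (intro allI impI)
  fix c assume c: "(\<forall>T. c T \<in> M) \<and> (\<forall>T. card T = Suc i \<longrightarrow> cobd ord w c T \<in> N)"
  have "a ^ m * c T - cobd ord w (contraction ord g c) T \<in> N" if "card T = i" for T
  proof -
    have "a ^ m * c T - cobd ord w (contraction ord g c) T = contraction ord g (cobd ord w c) T"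
      unfolding power using contraction_homotopy[OF assms(1), of w g c T] by (simp add: algebra_simps)
    also have "\<dots> \<in> N"
      using c that by (intro contraction_in_ideal[OF N]) simp
    finally show ?thesis .
  qed
  moreover have "contraction ord g c T \<in> M" for T
    using c by (intro contraction_in_ideal[OF M]) simp
  ultimately have "\<exists>b. (\<forall>T. b T \<in> M) \<and> (\<forall>T. card T = i \<longrightarrow> a ^ m * c T - cobd ord w b T \<in> N)"
    by blast
  then show "\<exists>b. (\<forall>T. b T \<in> M) \<and> (\<forall>T. card T = i \<longrightarrow> c T - cobd ord w b T \<in> N)"
    using c by (intro coboundary_cancel_power[OF assms(1) M N nzd exact]) auto
qed

lemma ideal_mult_span_insert:
  fixes M :: "'a::comm_ring_1 set"
  assumes M: "ideal.subspace M"
  shows "ideal_mult (ideal.span (insert a S)) M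
    = {n + a * g |n g. n \<in> ideal_mult (ideal.span S) M \<and> g \<in> M}" (is "?L = ?R")
proof
  let ?N = "ideal_mult (ideal.span S) M"
  have N: "ideal.subspace ?N" unfolding ideal_mult_def by (rule ideal.subspace_span)
  have R: "ideal.subspace ?R"
  proof (rule ideal.subspaceI)
    show "0 \<in> ?R" using ideal.subspace_0[OF N] ideal.subspace_0[OF M]
      by (intro CollectI exI[of _ 0] conjI) simp_all
  next
    fix x y assume "x \<in> ?R" "y \<in> ?R"
    then obtain n g n' g' where xy: "x = n + a * g" "y = n' + a * g'"
      and mem: "n \<in> ?N" "n' \<in> ?N" "g \<in> M" "g' \<in> M"
      by blast
    have "x + y = (n + n') + a * (g + g')" unfolding xy by (simp only: distrib_left ac_simps)
    with mem show "x + y \<in> ?R"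
      by (intro CollectI exI[of _ "n + n'"] exI[of _ "g + g'"] conjI
          ideal.subspace_add[OF N] ideal.subspace_add[OF M])
  next
    fix c x assume "x \<in> ?R"
    then obtain n g where x: "x = n + a * g" and mem: "n \<in> ?N" "g \<in> M" by blast
    have "c * x = c * n + a * (c * g)" unfolding x by (simp only: distrib_left mult_ac)
    with mem show "c * x \<in> ?R"
      by (intro CollectI exI[of _ "c * n"] exI[of _ "c * g"] conjI
          ideal.subspace_scale[OF N] ideal.subspace_scale[OF M])
  qed
  show "?L \<subseteq> ?R"
    unfolding ideal_mult_def[of "ideal.span (insert a S)"]
  proof (rule ideal.span_minimal[OF _ R], rule subsetI)
    fix z assume "z \<in> {\<alpha> * x |\<alpha> x. \<alpha> \<in> ideal.span (insert a S) \<and> x \<in> M}"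
    then obtain \<alpha> x where z: "z = \<alpha> * x" "\<alpha> \<in> ideal.span (insert a S)" "x \<in> M" by blast
    then obtain k where k: "\<alpha> - k * a \<in> ideal.span S" using ideal.span_breakdown_eq by blast
    then have "(\<alpha> - k * a) * x \<in> ?N" unfolding ideal_mult_def using z(3) by (blast intro: ideal.span_base)
    moreover have "k * x \<in> M" using z(3) ideal.subspace_scale[OF M] by blast
    moreover have "z = (\<alpha> - k * a) * x + a * (k * x)"
      unfolding z(1) left_diff_distrib by (simp only: mult_ac) simp
    ultimately show "z \<in> ?R" by (intro CollectI exI conjI)
  qed
  have "?N \<subseteq> ?L"
    unfolding ideal_mult_def using ideal.span_mono[of S "insert a S"]
    by (intro ideal.span_mono) blast
  moreover have "a * g \<in> ?L" if "g \<in> M" for g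
    unfolding ideal_mult_def using that ideal.span_base[of a "insert a S"]
    by (blast intro: ideal.span_base)
  moreover have "ideal.subspace ?L" unfolding ideal_mult_def by (rule ideal.subspace_span)
  ultimately show "?R \<subseteq> ?L" by (auto intro: ideal.subspace_add)
qed

lemma span_range_finite:
  fixes w :: "'v::finite \<Rightarrow> 'a::comm_ring_1"
  assumes "z \<in> ideal.span (range w)"
  shows "\<exists>g. z = (\<Sum>x\<in>UNIV. g x * w x)"
  using assms
proof (induction rule: ideal.span_induct_alt)
  case base
  show ?case by (intro exI[of _ "\<lambda>_. 0"]) simp
next
  case (step c y z)
  then obtain g x where z: "z = (\<Sum>x\<in>UNIV. g x * w x)" and y: "y = w x" by blast
  have "(\<Sum>u\<in>UNIV. ((if u = x then c else 0) + g u) * w u) = c * w x + (\<Sum>x\<in>UNIV. g x * w x)"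
    unfolding distrib_right sum.distrib by (simp add: if_distrib[of "\<lambda>c. c * _"] cong: if_cong)
  then show ?case using y z by metis
qed

text \<open>
  Passing from the first \<open>k\<close> elements of the sequence to the first \<open>k + 1\<close> costs one degree of exactness.
\<close>

lemma regular_sequence_koszul_exact_mod:
  fixes M :: "'a::comm_ring_1 set" and ord :: "'v::finite \<Rightarrow> nat"
  assumes "inj ord" and M: "ideal.subspace M" and reg: "regular_sequence M as"
    and power: "\<And>a. a \<in> set as \<Longrightarrow> \<exists>m. a ^ m \<in> ideal.span (range w)"
    and "i + k < length as"
  shows "koszul_exact ord w M (ideal_mult (ideal.span (set (take k as))) M) i"
  using assms(5)
proof (induction i arbitrary: k rule: less_induct)
  case (less i k)
  let ?N = "\<lambda>k. ideal_mult (ideal.span (set (take k as))) M"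
  define a where "a = as ! k"
  have k: "k < length as" "a \<in> set as" using less.prems by (auto simp: a_def)
  obtain m where "a ^ m \<in> ideal.span (range w)" using power k(2) by blast
  then obtain g where g: "a ^ m = (\<Sum>x\<in>UNIV. g x * w x)"
    using span_range_finite by blast
  have "set (take (Suc k) as) = insert a (set (take k as))"
    using k by (simp add: take_Suc_conv_app_nth a_def)
  then have N': "?N (Suc k) = {n + a * g |n g. n \<in> ?N k \<and> g \<in> M}"
    by (simp only: ideal_mult_span_insert[OF M])
  show ?case
  proof (rule koszul_exact_of_nonzerodivisor[OF assms(1) M _ _ _ g])
    show "ideal.subspace (?N k)" unfolding ideal_mult_def by (rule ideal.subspace_span)
    show "x \<in> ?N k" if "x \<in> M" "a * x \<in> ?N k" for x
      using reg k(1) that unfolding regular_sequence_def a_def by blast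
    show "koszul_exact ord w M {n + a * g |n g. n \<in> ?N k \<and> g \<in> M} j" if "i = Suc j" for j
      unfolding N'[symmetric] using less.prems that by (intro less.IH) auto
  qed
qed

lemma regular_sequence_koszul_exact:
  fixes M :: "'a::comm_ring_1 set" and ord :: "'v::finite \<Rightarrow> nat"
  assumes "inj ord" and "ideal.subspace M" and "regular_sequence M as"
    and "\<And>a. a \<in> set as \<Longrightarrow> \<exists>m. a ^ m \<in> ideal.span (range w)"
    and "i < length as"
  shows "koszul_exact ord w M {0} i"
proof -
  have "ideal_mult (ideal.span {}) M = {0}"
    unfolding ideal_mult_def ideal.span_empty by (rule antisym[OF ideal.span_minimal]) (auto simp: ideal.span_zero)
  then show ?thesis
    using regular_sequence_koszul_exact_mod[OF assms(1-4), of i 0] assms(5) by simp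
qed

text \<open>
  Every term of the binomial expansion contains \<open>a ^ m\<close> or \<open>b ^ k\<close>.
\<close>

lemma power_add_in_ideal:
  fixes a b :: "'a::comm_ring_1"
  assumes J: "ideal.subspace J" and a: "a ^ m \<in> J" and b: "b ^ k \<in> J"
  shows "(a + b) ^ (m + k) \<in> J"
  unfolding binomial_ring
proof (rule ideal.subspace_sum[OF J])
  fix j assume "j \<in> {..m + k}"
  show "of_nat ((m + k) choose j) * a ^ j * b ^ (m + k - j) \<in> J"
  proof (cases "m \<le> j")
    case True
    then have "a ^ j = a ^ (j - m) * a ^ m" by (simp flip: power_add)
    then have "of_nat ((m + k) choose j) * a ^ j * b ^ (m + k - j)
       = (of_nat ((m + k) choose j) * a ^ (j - m) * b ^ (m + k - j)) * a ^ m"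
      by (simp only: mult_ac)
    then show ?thesis using ideal.subspace_scale[OF J a] by simp
  next
    case False
    then have "b ^ (m + k - j) = b ^ (m - j) * b ^ k" by (simp flip: power_add)
    then have "of_nat ((m + k) choose j) * a ^ j * b ^ (m + k - j)
       = (of_nat ((m + k) choose j) * a ^ j * b ^ (m - j)) * b ^ k"
      by (simp only: mult_ac)
    then show ?thesis using ideal.subspace_scale[OF J b] by simp
  qed
qed

lemma span_in_radical:
  fixes J :: "'a::comm_ring_1 set"
  assumes J: "ideal.subspace J" and S: "\<And>s. s \<in> S \<Longrightarrow> \<exists>m. s ^ m \<in> J" and "a \<in> ideal.span S"
  shows "\<exists>m. a ^ m \<in> J"
proof -
  have "ideal.subspace {a. \<exists>m. a ^ m \<in> J}"
  proof (rule ideal.subspaceI)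
    have "0 ^ 1 \<in> J" using ideal.subspace_0[OF J] by simp
    then show "0 \<in> {a. \<exists>m. a ^ m \<in> J}" by blast
    show "x + y \<in> {a. \<exists>m. a ^ m \<in> J}" if "x \<in> {a. \<exists>m. a ^ m \<in> J}" "y \<in> {a. \<exists>m. a ^ m \<in> J}" for x y
    proof -
      from that obtain m k where "x ^ m \<in> J" "y ^ k \<in> J" by blast
      then have "(x + y) ^ (m + k) \<in> J" by (rule power_add_in_ideal[OF J])
      then show ?thesis by blast
    qed
    show "c * x \<in> {a. \<exists>m. a ^ m \<in> J}" if "x \<in> {a. \<exists>m. a ^ m \<in> J}" for c x
    proof -
      from that obtain m where "x ^ m \<in> J" by blast
      then have "(c * x) ^ m \<in> J" unfolding power_mult_distrib by (rule ideal.subspace_scale[OF J])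
      then show ?thesis by blast
    qed
  qed
  from ideal.span_minimal[OF _ this, of S] S assms(3) show ?thesis by blast
qed

section \<open>Acyclic links and colourings that obstruct them\<close>

text \<open>
  For the Stanley-Reisner ideal of \<open>\<Delta>\<close>, this is what depth at least \<open>d\<close> means for the links: the reduced
  cohomology of the link of \<open>\<sigma>\<close> vanishes in every dimension \<open>j\<close> with \<open>card \<sigma> + j + 2 < d\<close>. All orders of
  the vertices are admitted, so that the orders may be adapted to colourings and to faces.
\<close>

definition link_acyclic :: "'k::field itself \<Rightarrow> 'v::finite set set \<Rightarrow> nat \<Rightarrow> bool" where
  "link_acyclic K \<Delta> d \<longleftrightarrow> (\<forall>ord. inj ord \<longrightarrow>
     (\<forall>\<sigma>\<in>\<Delta>. \<forall>s. card \<sigma> + s + 1 < d \<longrightarrow> cohomology_vanishes K ord (link \<Delta> \<sigma>) s))"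

definition faces :: "'v set set \<Rightarrow> 'v set set" where
  "faces \<F> = {T. \<exists>F\<in>\<F>. T \<subseteq> F}"

lemma simplicial_faces [simp]: "simplicial (faces \<F>)"
  unfolding simplicial_def faces_def by blast

lemma simplicial_link: "simplicial \<Delta> \<Longrightarrow> simplicial (link \<Delta> \<sigma>)"
  unfolding simplicial_def link_def by (blast intro: Un_mono)

lemma link_link:
  "T \<in> link \<Delta> S \<Longrightarrow> link (link \<Delta> S) T = link \<Delta> (T \<union> S)"
  unfolding link_def by (auto simp: Un_assoc)

lemma link_acyclicD:
  "link_acyclic K \<Delta> d \<Longrightarrow> inj ord \<Longrightarrow> \<sigma> \<in> \<Delta> \<Longrightarrow> card \<sigma> + s + 1 < d \<Longrightarrow> cohomology_vanishes K ord (link \<Delta> \<sigma>) s"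
  unfolding link_acyclic_def by blast

lemma link_acyclic_link:
  assumes "link_acyclic K \<Delta> d"
  shows "link_acyclic K (link \<Delta> {x}) (d - 1)"
  unfolding link_acyclic_def
proof (intro allI impI ballI)
  fix ord :: "'b \<Rightarrow> nat" and \<sigma> s
  assume *: "inj ord" "\<sigma> \<in> link \<Delta> {x}" "card \<sigma> + s + 1 < d - 1"
  then have "\<sigma> \<union> {x} \<in> \<Delta>" "card (\<sigma> \<union> {x}) = Suc (card \<sigma>)" by (auto simp: link_def)
  then have "cohomology_vanishes K ord (link \<Delta> (\<sigma> \<union> {x})) s"
    using *(1,3) by (intro link_acyclicD[OF assms]) auto
  then show "cohomology_vanishes K ord (link (link \<Delta> {x}) \<sigma>) s" using link_link[OF *(2)] by simp
qed

text \<open>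
  Where the hypothesis on \<open>\<Delta>\<close> covers both \<open>\<sigma>\<close> and \<open>\<sigma> \<union> {x}\<close>, the exact sequence of the deletion applies. What remains
  are the faces for which \<open>\<sigma> \<union> {x}\<close> has just one element too many.
\<close>

lemma link_acyclic_deletion:
  fixes \<Delta> :: "'v::finite set set"
  assumes D: "link_acyclic TYPE('k::field) \<Delta> d" and simp: "simplicial \<Delta>"
    and crit: "\<And>ord \<sigma> s. inj ord \<Longrightarrow> x \<notin> \<sigma> \<Longrightarrow> insert x \<sigma> \<in> \<Delta> \<Longrightarrow> card (insert x \<sigma>) + s + 1 = d \<Longrightarrow>
        cohomology_vanishes TYPE('k) ord (link \<Delta> (insert x \<sigma>)) s \<or> cohomology_vanishes TYPE('k) ord (link (deletion \<Delta> x) \<sigma>) s"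
  shows "link_acyclic TYPE('k) (deletion \<Delta> x) d"
  unfolding link_acyclic_def
proof (intro allI impI ballI)
  fix ord :: "'v \<Rightarrow> nat" and \<sigma> s
  assume *: "inj ord" "\<sigma> \<in> deletion \<Delta> x" "card \<sigma> + s + 1 < d"
  then have \<sigma>: "\<sigma> \<in> \<Delta>" "x \<notin> \<sigma>" by (auto simp: deletion_def)
  have del: "link (deletion \<Delta> x) \<sigma> = deletion (link \<Delta> \<sigma>) x"
    using \<sigma> by (auto simp: link_def deletion_def)
  have L: "cohomology_vanishes TYPE('k) ord (link \<Delta> \<sigma>) s" using link_acyclicD[OF D *(1) \<sigma>(1) *(3)] .
  consider "insert x \<sigma> \<notin> \<Delta>" | "cohomology_vanishes TYPE('k) ord (link (deletion \<Delta> x) \<sigma>) s"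
    | "insert x \<sigma> \<in> \<Delta>" "cohomology_vanishes TYPE('k) ord (link \<Delta> (insert x \<sigma>)) s"
  proof (cases "insert x \<sigma> \<in> \<Delta>")
    case True
    show ?thesis
    proof (cases "card (insert x \<sigma>) + s + 1 = d")
      case True
      then show ?thesis using crit[OF *(1) \<sigma>(2) \<open>insert x \<sigma> \<in> \<Delta>\<close>] \<open>insert x \<sigma> \<in> \<Delta>\<close> that by blast
    next
      case False
      then have "card (insert x \<sigma>) + s + 1 < d" using *(3) \<sigma>(2) by simp
      then show ?thesis using link_acyclicD[OF D *(1) True] True that by blast
    qed
  qed (use that in blast)
  then show "cohomology_vanishes TYPE('k) ord (link (deletion \<Delta> x) \<sigma>) s"
  proof cases
    case 1
    have "x \<notin> T" if "T \<in> link \<Delta> \<sigma>" for T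
    proof
      assume "x \<in> T"
      then have "insert x \<sigma> \<subseteq> T \<union> \<sigma>" by blast
      with that 1 simp show False unfolding simplicial_def link_def by blast
    qed
    then have "link (deletion \<Delta> x) \<sigma> = link \<Delta> \<sigma>" unfolding del by (auto simp: deletion_def)
    then show ?thesis using L by simp
  next
    case 2
    then show ?thesis .
  next
    case 3
    have "{x} \<in> link \<Delta> \<sigma>" using 3 \<sigma> by (simp add: link_def)
    from link_link[OF this] have "link (link \<Delta> \<sigma>) {x} = link \<Delta> (insert x \<sigma>)" by simp
    then have "cohomology_vanishes TYPE('k) ord (link (link \<Delta> \<sigma>) {x}) s"
      using 3 by simp
    then show ?thesis unfolding del
      by (rule cohomology_vanishes_deletion[OF *(1) simplicial_link[OF simp] L])
  qed
qed

lemma cohomology_vanishes_nonempty: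
  fixes L :: "'v::finite set set"
  assumes "{v} \<in> L"
  shows "cohomology_vanishes TYPE('k::field) ord L 0"
  unfolding cohomology_vanishes_def
proof (intro allI impI exI ballI)
  fix \<mu> :: "'v set \<Rightarrow> 'k" and T :: "'v set"
  assume cocycle: "\<forall>T\<in>L. card T = Suc 0 \<longrightarrow> cobd ord (\<lambda>_. 1) \<mu> T = 0" and "card T = 0"
  with assms have "cobd ord (\<lambda>_. 1) \<mu> {v} = 0" by auto
  then have "\<mu> {} = 0" by (simp add: cobd_def alt_sign_def)
  with \<open>card T = 0\<close> show "\<mu> T = cobd ord (\<lambda>_. 1) (\<lambda>_. 0) T" by (simp add: cobd_def)
qed

lemma cobd_vertex: "cobd ord (\<lambda>_. 1) \<nu> {p} = (\<nu> {} :: 'k::field)"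
proof -
  have *: "{y \<in> {p}. ord y < ord p} = {}" by auto
  have "alt_sign ord p {p} = (1 :: 'k)" unfolding alt_sign_def * by simp
  then show ?thesis by (simp add: cobd_def)
qed

lemma cobd_edge:
  assumes "ord p < ord q"
  shows "cobd ord (\<lambda>_. 1) \<nu> {p,q} = (\<nu> {q} - \<nu> {p} :: 'k::field)"
proof -
  have *: "{y \<in> {p,q}. ord y < ord p} = {}" "{y \<in> {p,q}. ord y < ord q} = {p}" "p \<noteq> q"
    "{p,q} - {p} = {q}" "{p,q} - {q} = {p}"
    using assms by auto
  have "cobd ord (\<lambda>_. 1) \<nu> {p,q} = alt_sign ord p {p,q} * \<nu> {q} + alt_sign ord q {p,q} * \<nu> {p}"
    using *(3-5) by (simp add: cobd_def)
  then show ?thesis unfolding alt_sign_def *(1,2) by simp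
qed

lemma cobd_edge_eq_0:
  assumes "inj ord" "cobd ord (\<lambda>_. 1) \<nu> {p,q} = (0 :: 'k::field)" "p \<noteq> q"
  shows "\<nu> {p} = \<nu> {q}"
proof -
  have "ord p < ord q \<or> ord q < ord p" using assms(1,3) by (metis injD linorder_neqE_nat)
  then show ?thesis using assms(2) cobd_edge[of ord p q \<nu>] cobd_edge[of ord q p \<nu>]
    by (auto simp: insert_commute)
qed

text \<open>
  A cocycle on vertices takes equal values at the two ends of every edge, hence everywhere.
\<close>

lemma cohomology_vanishes_connected:
  fixes L :: "'v::finite set set"
  assumes "inj ord"
    and conn: "\<And>B u v. u \<in> B \<Longrightarrow> v \<notin> B \<Longrightarrow> {u} \<in> L \<Longrightarrow> {v} \<in> L \<Longrightarrow>
      \<exists>p q. p \<in> B \<and> q \<notin> B \<and> {p,q} \<in> L \<and> {p} \<in> L \<and> {q} \<in> L"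
  shows "cohomology_vanishes TYPE('k::field) ord L 1"
  unfolding cohomology_vanishes_def
proof (intro allI impI)
  fix \<mu> :: "'v set \<Rightarrow> 'k"
  assume cocycle: "\<forall>T\<in>L. card T = Suc 1 \<longrightarrow> cobd ord (\<lambda>_. 1) \<mu> T = 0"
  have const: "\<mu> {u} = \<mu> {v}" if "{u} \<in> L" "{v} \<in> L" for u v
  proof (rule ccontr)
    assume "\<mu> {u} \<noteq> \<mu> {v}"
    then obtain p q where pq: "p \<in> {p. \<mu> {p} = \<mu> {u}}" "q \<notin> {p. \<mu> {p} = \<mu> {u}}" "{p,q} \<in> L"
      using conn[of u "{p. \<mu> {p} = \<mu> {u}}" v] \<open>{u} \<in> L\<close> \<open>{v} \<in> L\<close> by auto
    then have "p \<noteq> q" by auto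
    moreover from this have "cobd ord (\<lambda>_. 1) \<mu> {p,q} = 0" using cocycle pq(3) by auto
    ultimately have "\<mu> {p} = \<mu> {q}" using cobd_edge_eq_0[OF assms(1)] by blast
    then show False using pq(1,2) by simp
  qed
  show "\<exists>\<nu>. \<forall>T\<in>L. card T = 1 \<longrightarrow> \<mu> T = cobd ord (\<lambda>_. 1) \<nu> T"
  proof (cases "\<exists>u. {u} \<in> L")
    case True
    then obtain u where u: "{u} \<in> L" by blast
    have "\<mu> T = cobd ord (\<lambda>_. 1) (\<lambda>_. \<mu> {u}) T" if "T \<in> L" "card T = 1" for T
      using that const[OF u] cobd_vertex[of ord "\<lambda>_. \<mu> {u}"] by (auto simp: card_1_singleton_iff)
    then show ?thesis by blast
  next
    case False
    then show ?thesis by (auto simp: card_1_singleton_iff)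
  qed
qed

text \<open>
  Orders in which the colour is compared first.
\<close>

lemma colour_monotone_order:
  fixes \<phi> :: "'v::finite \<Rightarrow> nat"
  obtains ord :: "'v \<Rightarrow> nat" where "inj ord" "\<And>x y. \<phi> x < \<phi> y \<Longrightarrow> ord x < ord y"
proof -
  obtain e :: "'v \<Rightarrow> nat" where e: "inj e" and below: "\<And>x. e x < card (UNIV :: 'v set)"
    using ex_bij_betw_finite_nat[of "UNIV :: 'v set"] by (force simp: bij_betw_def)
  let ?N = "card (UNIV :: 'v set)"
  let ?o = "\<lambda>x. \<phi> x * ?N + e x"
  have "inj ?o"
  proof (rule injI)
    fix x y assume "?o x = ?o y"
    then have "?o x mod ?N = ?o y mod ?N" by simp
    then have "e x = e y" using below by simp
    then show "x = y" using e by (simp add: inj_eq)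
  qed
  moreover have "?o x < ?o y" if "\<phi> x < \<phi> y" for x y
  proof -
    have "?o x < Suc (\<phi> x) * ?N" using below[of x] by simp
    also have "\<dots> \<le> \<phi> y * ?N" using that by (intro mult_right_mono) auto
    finally show ?thesis by simp
  qed
  ultimately show ?thesis using that by blast
qed

text \<open>
  When the colour is compared first, the only two elements of \<open>T\<close> of some colour are neighbours in \<open>T\<close>.
\<close>

lemma equal_colour_signs_cancel:
  fixes \<phi> :: "'v \<Rightarrow> nat"
  assumes "finite T" "a \<in> T" "b \<in> T" "ord a < ord b" "\<phi> a = \<phi> b"
    and only: "\<And>y. y \<in> T \<Longrightarrow> \<phi> y = \<phi> a \<Longrightarrow> y = a \<or> y = b"
    and mono: "\<And>x y. \<phi> x < \<phi> y \<Longrightarrow> ord x < (ord y :: nat)"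
  shows "alt_sign ord a T + alt_sign ord b T = (0 :: 'a::comm_ring_1)"
proof -
  have "{y \<in> T - {a}. ord y < ord b} = {y \<in> T. ord y < ord a}"
  proof (intro set_eqI iffI)
    fix y assume y: "y \<in> {y \<in> T - {a}. ord y < ord b}"
    then have "\<not> \<phi> b < \<phi> y" using mono[of b y] by auto
    moreover have "\<phi> y \<noteq> \<phi> a" using only[of y] y by auto
    ultimately have "\<phi> y < \<phi> a" using assms(5) by simp
    then show "y \<in> {y \<in> T. ord y < ord a}" using mono y by auto
  qed (use assms(4) in auto)
  then have "alt_sign ord b (T - {a}) = (alt_sign ord a T :: 'a)" by (simp add: alt_sign_def)
  with alt_sign_remove_below[OF assms(1,2,4), where 'a = 'a] show ?thesis by simp
qed

text \<open>
  The cochain is pulled back along \<open>\<phi>\<close> from the simplex on \<open>{1..k}\<close>, where it is the indicator of the side opposite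
  to the vertex 1. On a set \<open>T\<close> that misses a colour at most two terms of the coboundary are nonzero: they strike out
  one of two elements of equal colour, and their signs are opposite.
\<close>

lemma rainbow_cocycle:
  fixes T :: "'v::finite set" and \<phi> :: "'v \<Rightarrow> nat"
  assumes "inj ord" and mono: "\<And>x y. \<phi> x < \<phi> y \<Longrightarrow> ord x < (ord y :: nat)"
    and card: "card T = k" and col: "\<phi> ` T \<subseteq> {1..k}" and miss: "\<not> {1..k} \<subseteq> \<phi> ` T"
  shows "cobd ord (\<lambda>_. 1) (\<lambda>S. if \<phi> ` S = {2..k} then 1 else 0) T = (0 :: 'k::field)"
proof (cases "\<exists>x\<in>T. \<phi> ` (T - {x}) = {2..k}")
  case False
  then show ?thesis by (simp add: cobd_def)
next
  case True
  then obtain a where a: "a \<in> T" "\<phi> ` (T - {a}) = {2..k}" by blast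
  have im: "\<phi> ` T = insert (\<phi> a) {2..k}" using a by blast
  have "\<phi> a \<noteq> 1"
  proof
    assume "\<phi> a = 1"
    then have "{1..k} \<subseteq> \<phi> ` T" unfolding im by auto
    with miss show False ..
  qed
  moreover have "\<phi> a \<in> {1..k}" using col a(1) by blast
  ultimately have "\<phi> a \<in> \<phi> ` (T - {a})" using a(2) by auto
  then obtain b where b: "b \<in> T" "b \<noteq> a" "\<phi> b = \<phi> a" by force
  have "card (T - {a}) = k - 1" using card a(1) by simp
  then have inj: "inj_on \<phi> (T - {a})"
    using a(2) by (intro eq_card_imp_inj_on) auto
  have only: "y = a \<or> y = b" if "y \<in> T" "\<phi> y = \<phi> a" for y
    using inj_onD[OF inj, of y b] that b by auto
  have b': "\<phi> ` (T - {b}) = {2..k}"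
  proof -
    have "\<phi> ` (T - {b}) = \<phi> ` (T - {a})"
      using a(1) b by (auto simp: image_iff) (metis DiffI singletonD)+
    then show ?thesis using a(2) by simp
  qed
  have others: "\<phi> ` (T - {x}) \<noteq> {2..k}" if "x \<in> T" "x \<noteq> a" "x \<noteq> b" for x
  proof
    assume "\<phi> ` (T - {x}) = {2..k}"
    moreover have "\<phi> x \<in> {2..k}" using that a(2) by blast
    ultimately have "\<phi> x \<in> \<phi> ` (T - {x})" by simp
    then obtain z where z: "z \<in> T" "z \<noteq> x" "\<phi> z = \<phi> x" by force
    show False
    proof (cases "z = a")
      case True
      then show False using only[of x] that z by auto
    next
      case False
      then show False using inj_onD[OF inj, of z x] that z by auto
    qed
  qed
  have "cobd ord (\<lambda>_. 1) (\<lambda>S. if \<phi> ` S = {2..k} then 1 else 0) T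
     = (\<Sum>x\<in>{a,b}. alt_sign ord x T :: 'k)"
    unfolding cobd_def using a b b' others by (intro sum.mono_neutral_cong_right) auto
  also have "\<dots> = alt_sign ord a T + alt_sign ord b T" using b by simp
  also have "\<dots> = 0"
  proof -
    have "ord a < ord b \<or> ord b < ord a" using assms(1) b(2) by (metis injD linorder_neqE_nat)
    then show ?thesis
    proof
      assume "ord a < ord b"
      then show ?thesis
        using a(1) b only mono by (intro equal_colour_signs_cancel[where \<phi> = \<phi>]) auto
    next
      assume "ord b < ord a"
      then have "alt_sign ord b T + alt_sign ord a T = (0::'k)"
        using a(1) b only mono by (intro equal_colour_signs_cancel[where \<phi> = \<phi>]) auto
      then show ?thesis by (simp add: add.commute)
    qed
  qed
  finally show ?thesis .
qed

text \<open>
  If no face of the link carries all colours, \<open>\<phi>\<close> maps the link to the boundary of the simplex on \<open>{1..k}\<close>. The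
  pullback of a generator of the top cohomology of this sphere is a cocycle, and it has to be a coboundary
  when \<open>d\<close> is large.
\<close>

lemma rainbow_coboundary:
  fixes \<Delta> :: "'v::finite set set" and \<phi> :: "'v \<Rightarrow> nat"
  assumes D: "link_acyclic TYPE('k::field) \<Delta> d" and "\<sigma> \<in> \<Delta>" and "1 \<le> k" and "card \<sigma> + k < d"
    and col: "range \<phi> \<subseteq> {1..k}" and miss: "\<And>T. T \<in> link \<Delta> \<sigma> \<Longrightarrow> \<not> {1..k} \<subseteq> \<phi> ` T"
  shows "\<exists>ord (\<nu> :: 'v set \<Rightarrow> 'k). inj ord \<and> (\<forall>x y. \<phi> x < \<phi> y \<longrightarrow> ord x < (ord y :: nat)) \<and>
    (\<forall>T\<in>link \<Delta> \<sigma>. card T = k - 1 \<longrightarrow>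
       cobd ord (\<lambda>_. 1) \<nu> T = (if \<phi> ` T = {2..k} then 1 else 0))"
proof -
  obtain ord :: "'v \<Rightarrow> nat" where ord: "inj ord" "\<And>x y. \<phi> x < \<phi> y \<Longrightarrow> ord x < ord y"
    using colour_monotone_order by blast
  let ?\<mu> = "\<lambda>T. if \<phi> ` T = {2..k} then 1 else 0 :: 'k"
  have "cohomology_vanishes TYPE('k) ord (link \<Delta> \<sigma>) (k - 1)"
    using assms(3,4) by (intro link_acyclicD[OF D ord(1) assms(2)]) auto
  moreover have "\<forall>T\<in>link \<Delta> \<sigma>. card T = Suc (k - 1) \<longrightarrow> cobd ord (\<lambda>_. 1) ?\<mu> T = 0"
    using assms(3) col miss by (intro ballI impI rainbow_cocycle ord) auto
  ultimately have "\<exists>\<nu>. \<forall>T\<in>link \<Delta> \<sigma>. card T = k - 1 \<longrightarrow> ?\<mu> T = cobd ord (\<lambda>_. 1) \<nu> T"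
    unfolding cohomology_vanishes_def by blast
  then obtain \<nu> where \<nu>: "\<forall>T\<in>link \<Delta> \<sigma>. card T = k - 1 \<longrightarrow> ?\<mu> T = cobd ord (\<lambda>_. 1) \<nu> T" by blast
  then have "\<forall>T\<in>link \<Delta> \<sigma>. card T = k - 1 \<longrightarrow> cobd ord (\<lambda>_. 1) \<nu> T = ?\<mu> T" by metis
  then show ?thesis using ord by blast
qed

text \<open>
  The faces \<open>u ` ({1..k} - {i})\<close> form a sphere in the link which \<open>\<phi>\<close> maps isomorphically to the boundary of the
  simplex. Summing a coboundary over this sphere gives 0, but summing the pulled back generator gives a sign.
\<close>

lemma rainbow_simplex_bound:
  fixes \<Delta> :: "'v::finite set set" and \<phi> :: "'v \<Rightarrow> nat"
  assumes D: "link_acyclic TYPE('k::field) \<Delta> d" and "\<sigma> \<in> \<Delta>" and "1 \<le> k"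
    and col: "range \<phi> \<subseteq> {1..k}" and miss: "\<And>T. T \<in> link \<Delta> \<sigma> \<Longrightarrow> \<not> {1..k} \<subseteq> \<phi> ` T"
    and u: "\<And>i. i \<in> {1..k} \<Longrightarrow> \<phi> (u i) = i" "\<And>i. i \<in> {1..k} \<Longrightarrow> u ` ({1..k} - {i}) \<in> link \<Delta> \<sigma>"
  shows "d \<le> card \<sigma> + k"
proof (rule ccontr)
  assume "\<not> d \<le> card \<sigma> + k"
  then have "card \<sigma> + k < d" by simp
  obtain ord and \<nu> :: "'v set \<Rightarrow> 'k" where ord: "inj ord"
    and "\<And>x y. \<phi> x < \<phi> y \<Longrightarrow> ord x < (ord y :: nat)"
    and \<nu>: "\<And>T. T \<in> link \<Delta> \<sigma> \<Longrightarrow> card T = k - 1 \<Longrightarrow>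
       cobd ord (\<lambda>_. 1) \<nu> T = (if \<phi> ` T = {2..k} then 1 else 0)"
    using rainbow_coboundary[OF assms(1-3) \<open>card \<sigma> + k < d\<close> col miss] by blast
  let ?U = "u ` {1..k}"
  have inj: "inj_on u {1..k}" using u(1) by (rule inj_on_inverseI)
  have rem: "?U - {u i} = u ` ({1..k} - {i})" if "i \<in> {1..k}" for i
    using inj_on_image_set_diff[OF inj, of "{1..k}" "{i}"] that by simp
  have img: "\<phi> ` u ` A = A" if "A \<subseteq> {1..k}" for A
  proof -
    have "(\<lambda>i. \<phi> (u i)) ` A = id ` A" using u(1) that by (intro image_cong) auto
    then show ?thesis by (simp add: image_image)
  qed
  have val: "cobd ord (\<lambda>_. 1) \<nu> (?U - {u i}) = (if i = 1 then 1 else 0)" if i: "i \<in> {1..k}" for i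
  proof -
    have "card (u ` ({1..k} - {i})) = k - 1"
      using i by (subst card_image) (auto intro: inj_on_subset[OF inj])
    then have "cobd ord (\<lambda>_. 1) \<nu> (?U - {u i}) = (if {1..k} - {i} = {2..k} then 1 else 0)"
      unfolding rem[OF i] using \<nu>[OF u(2)[OF i]] img by (simp add: Diff_subset)
    moreover have "{1..k} - {i} = {2..k} \<longleftrightarrow> i = 1"
    proof
      assume eq: "{1..k} - {i} = {2..k}"
      have "1 \<in> {1..k}" "1 \<notin> {2..k}" using assms(3) by auto
      then show "i = 1" using eq by blast
    qed auto
    ultimately show ?thesis by simp
  qed
  have "0 = cobd ord (\<lambda>_. 1) (cobd ord (\<lambda>_. 1) \<nu>) ?U"
    using cobd_cobd[OF ord] by simp
  also have "\<dots> = (\<Sum>i\<in>{1..k}. alt_sign ord (u i) ?U * (if i = 1 then 1 else 0))"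
    unfolding cobd_def[of _ _ _ ?U] sum.reindex[OF inj] using val by (intro sum.cong) auto
  also have "\<dots> = (\<Sum>i\<in>{1..k}. if i = 1 then alt_sign ord (u 1) ?U else 0)"
    by (intro sum.cong) auto
  also have "\<dots> = alt_sign ord (u 1) ?U" using assms(3) by (subst sum.delta) auto
  finally have "alt_sign ord (u 1) ?U = (0::'k)" by simp
  then show False using alt_sign_square[of ord "u 1" ?U, where 'a = 'k] by simp
qed

text \<open>
  The variant in which the sphere is replaced by the closed walk \<open>a, b, c, c'\<close>, which \<open>\<phi>\<close> winds once around the triangle
  on the colours. For \<open>c = c'\<close> the walk is a triangle itself.
\<close>

lemma rainbow_cycle_bound:
  fixes \<Delta> :: "'v::finite set set" and \<phi> :: "'v \<Rightarrow> nat"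
  assumes D: "link_acyclic TYPE('k::field) \<Delta> d" and "\<sigma> \<in> \<Delta>"
    and col: "range \<phi> \<subseteq> {1..3}" and miss: "\<And>T. T \<in> link \<Delta> \<sigma> \<Longrightarrow> \<not> {1..3} \<subseteq> \<phi> ` T"
    and cols: "\<phi> a = 1" "\<phi> b = 2" "\<phi> c = 3" "\<phi> c' = 3"
    and edges: "{a,b} \<in> link \<Delta> \<sigma>" "{b,c} \<in> link \<Delta> \<sigma>" "{a,c'} \<in> link \<Delta> \<sigma>" "c = c' \<or> {c,c'} \<in> link \<Delta> \<sigma>"
  shows "d \<le> card \<sigma> + 3"
proof (rule ccontr)
  assume "\<not> d \<le> card \<sigma> + 3"
  then have "card \<sigma> + 3 < d" by simp
  obtain ord and \<nu> :: "'v set \<Rightarrow> 'k" where ord: "inj ord" "\<And>x y. \<phi> x < \<phi> y \<Longrightarrow> ord x < (ord y :: nat)"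
    and \<nu>: "\<And>T. T \<in> link \<Delta> \<sigma> \<Longrightarrow> card T = 3 - 1 \<Longrightarrow>
       cobd ord (\<lambda>_. 1) \<nu> T = (if \<phi> ` T = {2..3} then 1 else 0)"
    using rainbow_coboundary[OF assms(1,2) _ \<open>card \<sigma> + 3 < d\<close> col miss] one_le_numeral by blast
  have set: "{2..3} = {2,3::nat}" by auto
  have "ord a < ord b" "ord b < ord c" "ord a < ord c'" using ord(2) cols by auto
  moreover have "card {a,b} = 2" "card {b,c} = 2" "card {a,c'} = 2"
    using cols by (auto simp: card_insert_if)
  ultimately have e: "\<nu> {b} - \<nu> {a} = 0" "\<nu> {c} - \<nu> {b} = 1" "\<nu> {c'} - \<nu> {a} = 0"
    using \<nu>[OF edges(1)] \<nu>[OF edges(2)] \<nu>[OF edges(3)] cols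
    by (auto simp: cobd_edge set doubleton_eq_iff)
  have "\<nu> {c} = \<nu> {c'}"
  proof (cases "c = c'")
    case False
    then have "cobd ord (\<lambda>_. 1) \<nu> {c,c'} = 0" using \<nu>[of "{c,c'}"] edges(4) cols by (auto simp: set)
    then show ?thesis using cobd_edge_eq_0[OF ord(1)] False by blast
  qed simp
  with e show False by simp
qed

section \<open>Four facets with every vertex in at least two\<close>

lemma link_empty [simp]: "link \<Delta> {} = \<Delta>"
  by (simp add: link_def)

text \<open>
  The facets of a complex without cone point in which each vertex lies in at least two facets.
\<close>

definition ridge_system :: "'k::field itself \<Rightarrow> 'v::finite set set \<Rightarrow> nat \<Rightarrow> bool" where
  "ridge_system K \<F> d \<longleftrightarrow> link_acyclic K (faces \<F>) d \<and> (\<forall>A\<in>\<F>. \<forall>B\<in>\<F>. A \<subseteq> B \<longrightarrow> A = B) \<and>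
     (\<forall>A\<in>\<F>. A \<subseteq> \<Union>(\<F> - {A})) \<and> \<Inter>\<F> = {}"

text \<open>
  Naming the facets breaks the symmetry: in the sequel \<open>F1\<close> and \<open>F2\<close> contain the vertex \<open>x\<close> to be deleted, while \<open>F3\<close> and
  \<open>F4\<close> do not. The two exchanges below restore what symmetry is left.
\<close>

definition four_facets :: "'k::field itself \<Rightarrow> 'v::finite set \<Rightarrow> 'v set \<Rightarrow> 'v set \<Rightarrow> 'v set \<Rightarrow> nat \<Rightarrow> bool" where
  "four_facets K F1 F2 F3 F4 d \<longleftrightarrow> distinct [F1,F2,F3,F4] \<and> ridge_system K {F1,F2,F3,F4} d"

lemma four_facets_acyclic: "four_facets K F1 F2 F3 F4 d \<Longrightarrow> link_acyclic K (faces {F1,F2,F3,F4}) d"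
  unfolding four_facets_def ridge_system_def by (elim conjE)

lemma four_facets_swap12:
  assumes "four_facets K F1 F2 F3 F4 d"
  shows "four_facets K F2 F1 F3 F4 d"
proof -
  have "{F2,F1,F3,F4} = {F1,F2,F3,F4}" by (rule insert_commute)
  moreover have "distinct [F2,F1,F3,F4]" "ridge_system K {F1,F2,F3,F4} d"
    using assms by (auto simp: four_facets_def)
  ultimately show ?thesis unfolding four_facets_def by (simp only:)
qed

lemma four_facets_swap34:
  assumes "four_facets K F1 F2 F3 F4 d"
  shows "four_facets K F1 F2 F4 F3 d"
proof -
  have "{F1,F2,F4,F3} = {F1,F2,F3,F4}" by (simp only: insert_commute)
  moreover have "distinct [F1,F2,F4,F3]" "ridge_system K {F1,F2,F3,F4} d"
    using assms by (auto simp: four_facets_def)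
  ultimately show ?thesis unfolding four_facets_def by (simp only:)
qed

lemma ridge_system_antichain: "ridge_system K \<F> d \<Longrightarrow> A \<in> \<F> \<Longrightarrow> B \<in> \<F> \<Longrightarrow> A \<subseteq> B \<Longrightarrow> A = B"
  unfolding ridge_system_def by (elim conjE) (drule (1) bspec, drule (1) bspec, erule (1) mp)

lemma ridge_system_cover: "ridge_system K \<F> d \<Longrightarrow> A \<in> \<F> \<Longrightarrow> v \<in> A \<Longrightarrow> \<exists>B\<in>\<F>. B \<noteq> A \<and> v \<in> B"
  unfolding ridge_system_def by blast

lemma four_facets_antichain:
  assumes "four_facets K F1 F2 F3 F4 d"
  shows "\<not> F1 \<subseteq> F2" "\<not> F2 \<subseteq> F1" "\<not> F3 \<subseteq> F1" "\<not> F3 \<subseteq> F2"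
proof -
  have r: "ridge_system K {F1,F2,F3,F4} d" and "F1 \<noteq> F2" "F3 \<noteq> F1" "F3 \<noteq> F2"
    using assms by (auto simp: four_facets_def)
  then have "\<not> A \<subseteq> B" if "A \<in> {F1,F2,F3,F4}" "B \<in> {F1,F2,F3,F4}" "A \<noteq> B" for A B
    using ridge_system_antichain[OF r that(1,2)] that(3) by blast
  then show "\<not> F1 \<subseteq> F2" "\<not> F2 \<subseteq> F1" "\<not> F3 \<subseteq> F1" "\<not> F3 \<subseteq> F2"
    using \<open>F1 \<noteq> F2\<close> \<open>F3 \<noteq> F1\<close> \<open>F3 \<noteq> F2\<close> by (simp_all only: insert_iff simp_thms not_sym)
qed

lemma four_facets_cover:
  assumes "four_facets K F1 F2 F3 F4 d"
  shows "F1 \<subseteq> F2 \<union> F3 \<union> F4" "F2 \<subseteq> F1 \<union> F3 \<union> F4" "F3 \<subseteq> F1 \<union> F2 \<union> F4"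
proof -
  have r: "ridge_system K {F1,F2,F3,F4} d" using assms by (simp add: four_facets_def)
  show "F1 \<subseteq> F2 \<union> F3 \<union> F4" using ridge_system_cover[OF r, of F1] by auto
  show "F2 \<subseteq> F1 \<union> F3 \<union> F4" using ridge_system_cover[OF r, of F2] by auto
  show "F3 \<subseteq> F1 \<union> F2 \<union> F4" using ridge_system_cover[OF r, of F3] by auto
qed

lemma four_facets_no_common:
  "four_facets K F1 F2 F3 F4 d \<Longrightarrow> F1 \<inter> F2 \<inter> F3 \<inter> F4 = {}"
  unfolding four_facets_def ridge_system_def by (elim conjE) (simp only: Inter_insert Inter_empty Int_UNIV_right Int_assoc)

lemma not_all_three_colours:
  assumes "i \<in> {1..3::nat}" "\<And>v. v \<in> T \<Longrightarrow> \<phi> v \<noteq> i"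
  shows "\<not> {1..3} \<subseteq> \<phi> ` T"
proof
  assume "{1..3} \<subseteq> \<phi> ` T"
  then have "i \<in> \<phi> ` T" using assms(1) by blast
  then show False using assms(2) by blast
qed

text \<open>
  Any \<open>z\<close> in \<open>F3\<close> outside \<open>F1\<close> also lies in \<open>F4\<close>. The edges \<open>wy\<close>, \<open>yz\<close> and \<open>zw\<close> lie in \<open>F2\<close>, \<open>F4\<close> and \<open>F3\<close>, and no facet
  contains all three vertices. The colouring extends the colours 1, 2, 3 of \<open>w\<close>, \<open>y\<close>, \<open>z\<close> in such a way that \<open>F1\<close> and \<open>F3\<close> avoid
  the colour 2, \<open>F2\<close> avoids 3 and \<open>F4\<close> avoids 1.
\<close>

lemma four_facets_cycle_124:
  assumes ff: "four_facets TYPE('k::field) F1 F2 F3 F4 d"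
    and "F2 \<inter> F3 \<subseteq> F1" "F1 \<inter> F2 \<inter> F4 \<subseteq> F3" "w \<in> F1 \<inter> F2 \<inter> F3" "y \<in> F2 \<inter> F4" "y \<notin> F1"
  shows "d \<le> 3"
proof -
  define \<phi> where "\<phi> v = (if v \<in> F2 - F1 then 2 else if v \<in> F4 - F2 then 3 else 1::nat)" for v
  obtain z where z: "z \<in> F3" "z \<notin> F1" using four_facets_antichain(3)[OF ff] by blast
  have z': "z \<notin> F2" "z \<in> F4" using z assms(2) four_facets_cover(3)[OF ff] by blast+
  have none: "F1 \<inter> F2 \<inter> F4 = {}" using assms(3) four_facets_no_common[OF ff] by blast
  have "d \<le> card ({} :: 'a set) + 3"
  proof (rule rainbow_cycle_bound[where \<phi> = \<phi> and a = w and b = y and c = z and c' = z])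
    show "link_acyclic TYPE('k) (faces {F1,F2,F3,F4}) d" using ff by (rule four_facets_acyclic)
    show "range \<phi> \<subseteq> {1..3}" by (auto simp: \<phi>_def)
    show "\<phi> w = 1" "\<phi> y = 2" "\<phi> z = 3" "\<phi> z = 3" using assms z z' none by (auto simp: \<phi>_def)
    fix T assume "T \<in> link (faces {F1,F2,F3,F4}) {}"
    then consider "T \<subseteq> F1" | "T \<subseteq> F2" | "T \<subseteq> F3" | "T \<subseteq> F4" by (auto simp: faces_def)
    then show "\<not> {1..3} \<subseteq> \<phi> ` T"
    proof cases
      case 1 then show ?thesis by (intro not_all_three_colours[of 2]) (auto simp: \<phi>_def)
    next
      case 2 then show ?thesis by (intro not_all_three_colours[of 3]) (auto simp: \<phi>_def)
    next
      case 3 then show ?thesis using assms(2) by (intro not_all_three_colours[of 2]) (auto simp: \<phi>_def)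
    next
      case 4 then show ?thesis using none by (intro not_all_three_colours[of 1]) (auto simp: \<phi>_def)
    qed
  qed (use assms z z' in \<open>auto simp: faces_def\<close>)
  then show ?thesis by simp
qed

text \<open>
  The same triangle as before, but now \<open>F1\<close> and \<open>F4\<close> meet only inside \<open>F2\<close>, and vertices common to \<open>F1\<close>, \<open>F2\<close> and \<open>F4\<close> have
  to get the colour 2. Here \<open>F1\<close> and \<open>F2\<close> avoid the colour 3, \<open>F3\<close> avoids 2 and \<open>F4\<close> avoids 1.
\<close>

lemma four_facets_cycle_24:
  assumes ff: "four_facets TYPE('k::field) F1 F2 F3 F4 d"
    and "F2 \<inter> F3 \<subseteq> F1" "F1 \<inter> F4 \<subseteq> F2" "w \<in> F1 \<inter> F2 \<inter> F3" "y \<in> F2 \<inter> F4" "y \<notin> F1"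
  shows "d \<le> 3"
proof -
  define \<phi> where "\<phi> v = (if v \<notin> F1 \<union> F2 then 3 else if v \<in> F4 \<inter> F2 then 2 else 1::nat)" for v
  obtain z where z: "z \<in> F3" "z \<notin> F1" using four_facets_antichain(3)[OF ff] by blast
  have z': "z \<notin> F2" "z \<in> F4" using z assms(2) four_facets_cover(3)[OF ff] by blast+
  have none: "F2 \<inter> F3 \<inter> F4 = {}" using assms(2) four_facets_no_common[OF ff] by blast
  have "d \<le> card ({} :: 'a set) + 3"
  proof (rule rainbow_cycle_bound[where \<phi> = \<phi> and a = w and b = y and c = z and c' = z])
    show "link_acyclic TYPE('k) (faces {F1,F2,F3,F4}) d" using ff by (rule four_facets_acyclic)
    show "range \<phi> \<subseteq> {1..3}" by (auto simp: \<phi>_def)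
    show "\<phi> w = 1" "\<phi> y = 2" "\<phi> z = 3" "\<phi> z = 3" using assms z z' none by (auto simp: \<phi>_def)
    fix T assume "T \<in> link (faces {F1,F2,F3,F4}) {}"
    then consider "T \<subseteq> F1" | "T \<subseteq> F2" | "T \<subseteq> F3" | "T \<subseteq> F4" by (auto simp: faces_def)
    then show "\<not> {1..3} \<subseteq> \<phi> ` T"
    proof cases
      case 1 then show ?thesis by (intro not_all_three_colours[of 3]) (auto simp: \<phi>_def)
    next
      case 2 then show ?thesis by (intro not_all_three_colours[of 3]) (auto simp: \<phi>_def)
    next
      case 3 then show ?thesis using none by (intro not_all_three_colours[of 2]) (auto simp: \<phi>_def)
    next
      case 4 then show ?thesis using assms(3) by (intro not_all_three_colours[of 1]) (auto simp: \<phi>_def)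
    qed
  qed (use assms z z' in \<open>auto simp: faces_def\<close>)
  then show ?thesis by simp
qed

text \<open>
  The facets \<open>F1\<close> and \<open>F2\<close> are connected through \<open>x\<close>, and a second time through \<open>b\<close>, \<open>c\<close>, \<open>c'\<close>. Colour 1 marks the
  intersection of \<open>F1\<close> and \<open>F2\<close>, which \<open>F3\<close> and \<open>F4\<close> avoid.
\<close>

lemma four_facets_bipartite_cycle:
  assumes ff: "four_facets TYPE('k::field) F1 F2 F3 F4 d"
    and none: "F1 \<inter> F2 \<inter> F3 = {}" "F1 \<inter> F2 \<inter> F4 = {}" and x: "x \<in> F1 \<inter> F2"
    and b: "b \<in> F1" "b \<notin> F2" and c: "c \<notin> F1" and c': "c' \<in> F2" "c' \<notin> F1"
    and edges: "{b,c} \<in> faces {F1,F2,F3,F4}" "c = c' \<or> {c,c'} \<in> faces {F1,F2,F3,F4}"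
  shows "d \<le> 3"
proof -
  define \<phi> where "\<phi> v = (if v \<in> F1 \<inter> F2 then 1 else if v \<in> F1 then 2 else 3::nat)" for v
  have "d \<le> card ({} :: 'a set) + 3"
  proof (rule rainbow_cycle_bound[where \<phi> = \<phi> and a = x and b = b and c = c and c' = c'])
    show "link_acyclic TYPE('k) (faces {F1,F2,F3,F4}) d" using ff by (rule four_facets_acyclic)
    show "range \<phi> \<subseteq> {1..3}" by (auto simp: \<phi>_def)
    show "\<phi> x = 1" "\<phi> b = 2" "\<phi> c = 3" "\<phi> c' = 3" using x b c c' by (auto simp: \<phi>_def)
    fix T assume "T \<in> link (faces {F1,F2,F3,F4}) {}"
    then consider "T \<subseteq> F1" | "T \<subseteq> F2" | "T \<subseteq> F3" | "T \<subseteq> F4" by (auto simp: faces_def)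
    then show "\<not> {1..3} \<subseteq> \<phi> ` T"
    proof cases
      case 1 then show ?thesis by (intro not_all_three_colours[of 3]) (auto simp: \<phi>_def)
    next
      case 2 then show ?thesis by (intro not_all_three_colours[of 2]) (auto simp: \<phi>_def)
    next
      case 3 then show ?thesis using none by (intro not_all_three_colours[of 1]) (auto simp: \<phi>_def)
    next
      case 4 then show ?thesis using none by (intro not_all_three_colours[of 1]) (auto simp: \<phi>_def)
    qed
  qed (use x b c' edges in \<open>auto simp: faces_def\<close>)
  then show ?thesis by simp
qed

lemma four_facets_bipartite_aux:
  assumes ff: "four_facets TYPE('k::field) F1 F2 F3 F4 d"
    and none: "F1 \<inter> F2 \<inter> F3 = {}" "F1 \<inter> F2 \<inter> F4 = {}" and x: "x \<in> F1 \<inter> F2"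
    and b: "b \<in> F1 \<inter> F3" "b \<notin> F2"
  shows "d \<le> 3"
proof (cases "\<exists>z. z \<in> F2 \<inter> F3 \<and> z \<notin> F1")
  case True
  then obtain z where z: "z \<in> F2 \<inter> F3" "z \<notin> F1" by blast
  have "{b,z} \<in> faces {F1,F2,F3,F4}" using b z by (auto simp: faces_def)
  then show ?thesis
    using four_facets_bipartite_cycle[OF ff none x, of b z z] b z by blast
next
  case False
  obtain z where z: "z \<in> F2" "z \<notin> F1" using four_facets_antichain(2)[OF ff] by blast
  then have z4: "z \<in> F4" using False four_facets_cover(2)[OF ff] by blast
  obtain v where v: "v \<in> F3" "v \<notin> F1" using four_facets_antichain(3)[OF ff] by blast
  then have v4: "v \<in> F4" using False four_facets_cover(3)[OF ff] by blast
  have "{b,v} \<in> faces {F1,F2,F3,F4}" "{v,z} \<in> faces {F1,F2,F3,F4}"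
    using b z v z4 v4 by (auto simp: faces_def)
  then show ?thesis
    using four_facets_bipartite_cycle[OF ff none x, of b v z] b z v by blast
qed

text \<open>
  A second connection between \<open>F1\<close> and \<open>F2\<close> always exists: through \<open>F3\<close> or \<open>F4\<close> alone, or else through a vertex
  common to \<open>F3\<close> and \<open>F4\<close>, since \<open>F3\<close> is not contained in \<open>F1\<close>.
\<close>

lemma four_facets_bipartite:
  assumes ff: "four_facets TYPE('k::field) F1 F2 F3 F4 d"
    and none: "F1 \<inter> F2 \<inter> F3 = {}" "F1 \<inter> F2 \<inter> F4 = {}" and x: "x \<in> F1 \<inter> F2"
  shows "d \<le> 3"
proof -
  obtain b where b: "b \<in> F1" "b \<notin> F2" using four_facets_antichain(1)[OF ff] by blast
  then have "b \<in> F3 \<or> b \<in> F4" using four_facets_cover(1)[OF ff] by blast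
  then show ?thesis
    using four_facets_bipartite_aux[OF ff none x, of b]
      four_facets_bipartite_aux[OF four_facets_swap34[OF ff] none(2,1) x, of b] b by blast
qed

text \<open>
  \<open>F4\<close> does not take part in the link of \<open>F1 \<inter> F2 \<inter> F3\<close>, in which the other three facets intersect pairwise but have
  no common vertex.
\<close>

lemma four_facets_triangle:
  assumes ff: "four_facets TYPE('k::field) F1 F2 F3 F4 d"
    and "x \<in> F1 \<inter> F2" "x \<notin> F3" and p: "\<not> F1 \<inter> F2 \<inter> F3 \<subseteq> F4"
    and "\<not> F1 \<inter> F3 \<subseteq> F2" "\<not> F2 \<inter> F3 \<subseteq> F1"
  shows "d \<le> card (F1 \<inter> F2 \<inter> F3) + 3"
proof -
  define \<phi> where "\<phi> v = (if v \<notin> F3 then 1 else if v \<notin> F2 then 2 else 3::nat)" for v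
  obtain b c where bc: "b \<in> F1 \<inter> F3" "b \<notin> F2" "c \<in> F2 \<inter> F3" "c \<notin> F1" using assms by blast
  show ?thesis
  proof (rule rainbow_cycle_bound[where \<phi> = \<phi> and a = x and b = b and c = c and c' = c])
    show "link_acyclic TYPE('k) (faces {F1,F2,F3,F4}) d" using ff by (rule four_facets_acyclic)
    show "range \<phi> \<subseteq> {1..3}" by (auto simp: \<phi>_def)
    show "\<phi> x = 1" "\<phi> b = 2" "\<phi> c = 3" "\<phi> c = 3" using assms bc by (auto simp: \<phi>_def)
    fix T assume T: "T \<in> link (faces {F1,F2,F3,F4}) (F1 \<inter> F2 \<inter> F3)"
    then have disj: "T \<inter> (F1 \<inter> F2 \<inter> F3) = {}" by (simp add: link_def)
    from T p consider "T \<subseteq> F1" | "T \<subseteq> F2" | "T \<subseteq> F3" by (auto simp: faces_def link_def)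
    then show "\<not> {1..3} \<subseteq> \<phi> ` T"
    proof cases
      case 1 then show ?thesis using disj by (intro not_all_three_colours[of 3]) (auto simp: \<phi>_def)
    next
      case 2 then show ?thesis by (intro not_all_three_colours[of 2]) (auto simp: \<phi>_def)
    next
      case 3 then show ?thesis by (intro not_all_three_colours[of 1]) (auto simp: \<phi>_def)
    qed
  qed (use assms bc in \<open>auto simp: faces_def link_def\<close>)
qed

text \<open>
  A disconnected link, as the case of two colours.
\<close>

lemma two_colour_bound:
  assumes D: "link_acyclic TYPE('k::field) \<Delta> d" and "\<sigma> \<in> \<Delta>"
    and no: "\<And>T p q. T \<in> link \<Delta> \<sigma> \<Longrightarrow> p \<in> T \<Longrightarrow> q \<in> T \<Longrightarrow> p \<in> B \<Longrightarrow> q \<in> B"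
    and u: "{u} \<in> link \<Delta> \<sigma>" "u \<in> B" "{v} \<in> link \<Delta> \<sigma>" "v \<notin> B"
  shows "d \<le> card \<sigma> + 2"
proof -
  let ?\<phi> = "\<lambda>v. if v \<in> B then 1 else 2::nat" and ?u = "\<lambda>i::nat. if i = 1 then u else v"
  have two: "i \<in> {1..2} \<longleftrightarrow> i = 1 \<or> i = (2::nat)" for i by auto
  have rem: "{1..2} - {1} = {2::nat}" "{1..2} - {2} = {1::nat}" by auto
  show ?thesis
  proof (rule rainbow_simplex_bound[OF D assms(2), where \<phi> = ?\<phi> and u = ?u])
    show "\<not> {1..2} \<subseteq> ?\<phi> ` T" if T: "T \<in> link \<Delta> \<sigma>" for T
    proof
      assume "{1..2} \<subseteq> ?\<phi> ` T"
      then have "1 \<in> ?\<phi> ` T" "2 \<in> ?\<phi> ` T" using two by blast+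
      then obtain p q where "p \<in> T" "p \<in> B" "q \<in> T" "q \<notin> B" by (auto split: if_splits)
      then show False using no[OF T] by blast
    qed
    show "?u ` ({1..2} - {i}) \<in> link \<Delta> \<sigma>" if "i \<in> {1..2::nat}" for i
    proof -
      have "?u ` ({1..2} - {1}) = {v}" "?u ` ({1..2} - {2}) = {u}" unfolding rem by simp_all
      then show ?thesis using that u(1,3) unfolding two by (elim disjE) (simp_all only:)
    qed
  qed (use u in \<open>auto simp: two\<close>)
qed

text \<open>
  The complementary case: in the link of \<open>F1 \<inter> F2 \<inter> F3\<close> the facet \<open>F3\<close> is a component of its own.
\<close>

lemma four_facets_disconnected:
  assumes ff: "four_facets TYPE('k::field) F1 F2 F3 F4 d"
    and "x \<in> F1 \<inter> F2" "x \<notin> F3" and p: "\<not> F1 \<inter> F2 \<inter> F3 \<subseteq> F4"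
    and "F1 \<inter> F3 \<subseteq> F2" "F2 \<inter> F3 \<subseteq> F1"
  shows "d \<le> card (F1 \<inter> F2 \<inter> F3) + 2"
proof -
  obtain z where z: "z \<in> F3" "z \<notin> F1" using four_facets_antichain(3)[OF ff] by blast
  show ?thesis
  proof (rule two_colour_bound[where B = "- F3" and u = x and v = z])
    show "link_acyclic TYPE('k) (faces {F1,F2,F3,F4}) d" using ff by (rule four_facets_acyclic)
    fix T p q assume T: "T \<in> link (faces {F1,F2,F3,F4}) (F1 \<inter> F2 \<inter> F3)" and "p \<in> T" "q \<in> T" "p \<in> - F3"
    moreover from this have "T \<inter> (F1 \<inter> F2 \<inter> F3) = {}" by (simp add: link_def)
    moreover from T p have "T \<subseteq> F1 \<or> T \<subseteq> F2 \<or> T \<subseteq> F3" by (auto simp: faces_def link_def)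
    ultimately show "q \<in> - F3" using assms(5,6) by blast
  qed (use assms z in \<open>auto simp: faces_def link_def\<close>)
qed

text \<open>
  Suppose that \<open>d\<close> is larger. Since \<open>F1 \<inter> F2\<close> has an element besides \<open>x\<close> outside \<open>F3\<close>, and one outside \<open>F4\<close>, its
  intersections with \<open>F3\<close> and \<open>F4\<close> are smaller by at least two, so the links of these cannot carry a triangle or be
  disconnected. Hence, if \<open>F1 \<inter> F2 \<inter> F3\<close> is not contained in \<open>F4\<close>, exactly one of \<open>F1\<close> and \<open>F2\<close> meets \<open>F3\<close> outside the other,
  and likewise with \<open>F3\<close> and \<open>F4\<close> exchanged. In each of the resulting configurations one of the cycles above
  shows \<open>d \<le> 3\<close>, which is too small.
\<close>

lemma four_facets_critical_ridge:
  assumes ff: "four_facets TYPE('k::field) F1 F2 F3 F4 d"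
    and x: "x \<in> F1 \<inter> F2" "x \<notin> F3" "x \<notin> F4"
    and not3: "\<not> F1 \<inter> F2 - {x} \<subseteq> F3" and not4: "\<not> F1 \<inter> F2 - {x} \<subseteq> F4"
  shows "d \<le> card (F1 \<inter> F2) + 1"
proof (rule ccontr)
  assume "\<not> d \<le> card (F1 \<inter> F2) + 1"
  then have d: "card (F1 \<inter> F2) + 1 < d" by simp
  have small: "card (F1 \<inter> F2 \<inter> F) + 2 \<le> card (F1 \<inter> F2)" if "x \<notin> F" "\<not> F1 \<inter> F2 - {x} \<subseteq> F" for F
  proof -
    from that(2) obtain w where "w \<in> F1 \<inter> F2" "w \<noteq> x" "w \<notin> F" by blast
    then have "card (insert x (insert w (F1 \<inter> F2 \<inter> F))) = card (F1 \<inter> F2 \<inter> F) + 2" using that by simp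
    moreover have "card (insert x (insert w (F1 \<inter> F2 \<inter> F))) \<le> card (F1 \<inter> F2)"
      using x \<open>w \<in> F1 \<inter> F2\<close> by (intro card_mono) auto
    ultimately show ?thesis by simp
  qed
  note s3 = small[OF x(2) not3] and s4 = small[OF x(3) not4]
  have d3: "\<not> d \<le> 3" using s3 d by simp
  note ff' = four_facets_swap12[OF ff] and fg = four_facets_swap34[OF ff]
  note fg' = four_facets_swap12[OF fg]
  let ?a = "\<not> F1 \<inter> F3 \<subseteq> F2" and ?b = "\<not> F2 \<inter> F3 \<subseteq> F1"
    and ?c = "\<not> F1 \<inter> F4 \<subseteq> F2" and ?d = "\<not> F2 \<inter> F4 \<subseteq> F1"
    and ?p = "\<not> F1 \<inter> F2 \<inter> F3 \<subseteq> F4" and ?q = "\<not> F1 \<inter> F2 \<inter> F4 \<subseteq> F3"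
  \<comment> \<open>a vertex of \<open>F1\<close> outside \<open>F2\<close> lies in \<open>F3\<close> or \<open>F4\<close>, and symmetrically\<close>
  have ac: "?a \<or> ?c" using four_facets_antichain(1)[OF ff] four_facets_cover(1)[OF ff] by blast
  have bd: "?b \<or> ?d" using four_facets_antichain(2)[OF ff] four_facets_cover(2)[OF ff] by blast
  have p: "?a \<noteq> ?b" if ?p
    using four_facets_triangle[OF ff x(1,2) that] four_facets_disconnected[OF ff x(1,2) that] s3 d by linarith
  have q: "?c \<noteq> ?d" if ?q
    using four_facets_triangle[OF fg x(1,3) that] four_facets_disconnected[OF fg x(1,3) that] s4 d by linarith
  consider "?p" "?q" | "?p" "\<not> ?q" | "\<not> ?p" "?q" | "\<not> ?p" "\<not> ?q" by blast
  then show False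
  proof cases
    case 1
    obtain w where w: "w \<in> F1 \<inter> F2 \<inter> F3" using 1 by blast
    show False
    proof (cases "?a")
      case True
      then have "\<not> ?b" "?d" "\<not> ?c" using p q bd 1 by blast+
      then show False using four_facets_cycle_24[OF ff, of w] w d3 by blast
    next
      case False
      then have "?b" "?c" "\<not> ?d" using p q ac 1 by blast+
      then show False using four_facets_cycle_24[OF ff', of w] w False d3 by blast
    qed
  next
    case 2
    obtain w where w: "w \<in> F1 \<inter> F2 \<inter> F3" using 2 by blast
    show False
    proof (cases "?a")
      case True
      then have "\<not> ?b" "?d" using p bd 2 by blast+
      then show False using four_facets_cycle_124[OF ff, of w] w 2 d3 by blast
    next
      case False
      then have "?c" using ac by blast
      then show False using four_facets_cycle_124[OF ff', of w] w False 2 d3 by blast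
    qed
  next
    case 3
    obtain w where w: "w \<in> F1 \<inter> F2 \<inter> F4" using 3 by blast
    show False
    proof (cases "?c")
      case True
      then have "\<not> ?d" "?b" using q bd 3 by blast+
      then show False using four_facets_cycle_124[OF fg, of w] w 3 d3 by blast
    next
      case False
      then have "?a" using ac by blast
      then show False using four_facets_cycle_124[OF fg', of w] w False 3 d3 by blast
    qed
  next
    case 4
    then have "F1 \<inter> F2 \<inter> F3 = {}" "F1 \<inter> F2 \<inter> F4 = {}" using four_facets_no_common[OF ff] by blast+
    then show False using four_facets_bipartite[OF ff _ _ x(1)] d3 by blast
  qed
qed

text \<open>
  If \<open>F3\<close> contains the ridge up to \<open>x\<close> and meets \<open>F2\<close> only inside \<open>F1\<close>, the vertices of \<open>F2\<close> outside \<open>F1\<close> lie in \<open>F4\<close>, and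
  the triangle through \<open>F2\<close>, \<open>F4\<close>, \<open>F3\<close> appears.
\<close>

lemma ridge_in_third_facet:
  assumes ff: "four_facets TYPE('k::field) F1 F2 F3 F4 d"
    and x: "x \<in> F1 \<inter> F2" "x \<notin> F3" "x \<notin> F4"
    and in3: "F1 \<inter> F2 - {x} \<subseteq> F3" and not4: "\<not> F1 \<inter> F2 - {x} \<subseteq> F4"
    and sep: "F2 \<inter> F3 \<subseteq> F1"
  shows "d \<le> 3"
proof -
  obtain w where w: "w \<in> F1 \<inter> F2 \<inter> F3" using in3 not4 by blast
  obtain y where y: "y \<in> F2" "y \<notin> F1" using four_facets_antichain(2)[OF ff] by blast
  then have "y \<in> F4" using sep four_facets_cover(2)[OF ff] by blast
  moreover have "F1 \<inter> F2 \<inter> F4 \<subseteq> F3" using in3 x by blast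
  ultimately show ?thesis using four_facets_cycle_124[OF ff sep _ w] y by blast
qed

text \<open>
  Once \<open>x\<close> is deleted, the facets \<open>F1\<close> and \<open>F2\<close> no longer touch in the link of the rest of the ridge. Here \<open>B\<close> is the vertex
  set of a union of components of that link which contains the rest of \<open>F1\<close> but not that of \<open>F2\<close>; the last two
  assumptions say that \<open>F3\<close> and \<open>F4\<close>, when present in the link, lie on one side.
\<close>

lemma ridge_not_separating:
  assumes ff: "four_facets TYPE('k::field) F1 F2 F3 F4 d"
    and x: "x \<in> F1 \<inter> F2" "x \<notin> F3" "x \<notin> F4" and d: "card (F1 \<inter> F2) + 2 = d"
    and B: "F1 - F2 \<subseteq> B" "(F2 - F1) \<inter> B = {}"
    and B3: "F1 \<inter> F2 - {x} \<subseteq> F3 \<Longrightarrow> F3 - F1 \<inter> F2 \<subseteq> B \<or> (F3 - F1 \<inter> F2) \<inter> B = {}"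
    and B4: "F1 \<inter> F2 - {x} \<subseteq> F4 \<Longrightarrow> F4 - F1 \<inter> F2 \<subseteq> B \<or> (F4 - F1 \<inter> F2) \<inter> B = {}"
  shows False
proof -
  note ff' = four_facets_swap12[OF ff] and fg = four_facets_swap34[OF ff]
  note fg' = four_facets_swap12[OF fg]
  have comm: "F2 \<inter> F1 = F1 \<inter> F2" by blast
  have x': "x \<in> F2 \<inter> F1" using x by blast
  let ?i3 = "F1 \<inter> F2 - {x} \<subseteq> F3" and ?i4 = "F1 \<inter> F2 - {x} \<subseteq> F4"
  \<comment> \<open>unless the ridge is \<open>{x}\<close>, it has two elements\<close>
  have large: "\<not> d \<le> 3" if "\<not> ?i3 \<or> \<not> ?i4"
  proof -
    from that obtain w where "w \<in> F1 \<inter> F2" "w \<noteq> x" by blast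
    then have "card {x,w} \<le> card (F1 \<inter> F2)" using x by (intro card_mono) auto
    then show ?thesis using d \<open>w \<noteq> x\<close> by simp
  qed
  consider "?i3" "?i4" | "?i3" "\<not> ?i4" | "\<not> ?i3" "?i4" | "\<not> ?i3" "\<not> ?i4" by blast
  then show False
  proof cases
    case 1
    have F3: "F1 \<inter> F2 - {x} \<subseteq> F3" "F1 \<inter> F2 - {x} \<subseteq> F4" using 1 by auto
    have cover: "F1 \<subseteq> F2 \<union> F3 \<union> F4" "F2 \<subseteq> F1 \<union> F3 \<union> F4" "F3 \<subseteq> F1 \<union> F2 \<union> F4"
      and anti: "\<not> F3 \<subseteq> F1" "\<not> F3 \<subseteq> F2" "\<not> F1 \<subseteq> F2" "\<not> F2 \<subseteq> F1"
      using four_facets_cover[OF ff] four_facets_antichain[OF ff] by simp_all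
    obtain a1 where a1: "a1 \<in> F1" "a1 \<notin> F2" using anti by blast
    obtain a2 where a2: "a2 \<in> F2" "a2 \<notin> F1" using anti by blast
    have a1': "a1 \<in> F3 \<or> a1 \<in> F4" "a1 \<in> B" and a2': "a2 \<in> F3 \<or> a2 \<in> F4" "a2 \<notin> B"
      using a1 a2 cover B by auto
    obtain v1 where v1: "v1 \<in> F3" "v1 \<notin> F1" using anti by blast
    obtain v2 where v2: "v2 \<in> F3" "v2 \<notin> F2" using anti by blast
    show False
      using B3[OF F3(1)] B4[OF F3(2)]
    proof (elim disjE)
      assume h: "F3 - F1 \<inter> F2 \<subseteq> B" "F4 - F1 \<inter> F2 \<subseteq> B"
      then show False using a2 a2' by blast
    next
      assume h: "F3 - F1 \<inter> F2 \<subseteq> B" "(F4 - F1 \<inter> F2) \<inter> B = {}"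
      then have "v1 \<in> B" "v1 \<notin> F4" using v1 by blast+
      then show False using v1 cover B by blast
    next
      assume h: "(F3 - F1 \<inter> F2) \<inter> B = {}" "F4 - F1 \<inter> F2 \<subseteq> B"
      then have "v2 \<notin> B" "v2 \<notin> F4" using v2 by blast+
      then show False using v2 cover B by blast
    next
      assume h: "(F3 - F1 \<inter> F2) \<inter> B = {}" "(F4 - F1 \<inter> F2) \<inter> B = {}"
      then show False using a1 a1' by blast
    qed
  next
    case 2
    then have "F2 \<inter> F3 \<subseteq> F1 \<or> F1 \<inter> F3 \<subseteq> F2" using B3 B by blast
    then show False
      using ridge_in_third_facet[OF ff x] ridge_in_third_facet[OF ff' x' x(2,3)] 2 large
      unfolding comm by blast
  next
    case 3
    then have "F2 \<inter> F4 \<subseteq> F1 \<or> F1 \<inter> F4 \<subseteq> F2" using B4 B by blast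
    then show False
      using ridge_in_third_facet[OF fg x(1,3,2)] ridge_in_third_facet[OF fg' x' x(3,2)] 3 large
      unfolding comm by blast
  next
    case 4
    then show False using four_facets_critical_ridge[OF ff x] d by simp
  qed
qed

section \<open>Interval partitions of the nonfaces\<close>

text \<open>
  An interval with upper end \<open>B\<close> corresponds to a Stanley space of dimension \<open>card B\<close>.
\<close>

inductive partitionable :: "nat \<Rightarrow> 'v::finite set set \<Rightarrow> bool" for d where
  empty: "partitionable d {}"
| interval: "partitionable d \<P> \<Longrightarrow> A \<subseteq> B \<Longrightarrow> d \<le> card B \<Longrightarrow> {A..B} \<inter> \<P> = {} \<Longrightarrow> partitionable d ({A..B} \<union> \<P>)"

lemma partitionable_Un:
  assumes "partitionable d \<P>" "partitionable d \<Q>" "\<P> \<inter> \<Q> = {}"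
  shows "partitionable d (\<P> \<union> \<Q>)"
  using assms(1,3)
proof induction
  case empty
  then show ?case using assms(2) by simp
next
  case (interval \<P> A B)
  then have "partitionable d (\<P> \<union> \<Q>)" by blast
  moreover have "{A..B} \<inter> (\<P> \<union> \<Q>) = {}" using interval by blast
  ultimately show ?case using interval(2,3) by (simp only: Un_assoc partitionable.interval)
qed

lemma partitionable_interval: "A \<subseteq> B \<Longrightarrow> d \<le> card B \<Longrightarrow> partitionable d {A..B}"
  using partitionable.interval[OF partitionable.empty, of A B d] by simp

lemma partitionable_large_sets:
  fixes \<P> :: "'v::finite set set"
  shows "(\<And>T. T \<in> \<P> \<Longrightarrow> d \<le> card T) \<Longrightarrow> partitionable d \<P>"
proof (induction rule: finite_induct[OF finite[of \<P>]])
  case 1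
  then show ?case by (simp add: partitionable.empty)
next
  case (2 T \<P>)
  then have "partitionable d \<P>" by blast
  then have "partitionable d ({T..T} \<union> \<P>)" using 2 by (intro partitionable.interval) auto
  then show ?case by simp
qed

lemma partitionable_mono: "partitionable d \<P> \<Longrightarrow> d' \<le> d \<Longrightarrow> partitionable d' \<P>"
  by (induction rule: partitionable.induct) (auto intro: partitionable.intros)

lemma interval_insert_both:
  assumes "x \<notin> B" "A \<subseteq> B"
  shows "insert x ` {A..B} = {insert x A..insert x B}"
proof (intro set_eqI iffI)
  fix T assume T: "T \<in> {insert x A..insert x B}"
  then have "T - {x} \<in> {A..B}" "insert x (T - {x}) = T" using assms by auto
  then show "T \<in> insert x ` {A..B}" by (metis image_eqI)
qed auto

lemma interval_insert_top:
  assumes "x \<notin> B" "A \<subseteq> B"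
  shows "{A..B} \<union> insert x ` {A..B} = {A..insert x B}"
proof (intro set_eqI iffI)
  fix T assume T: "T \<in> {A..insert x B}"
  show "T \<in> {A..B} \<union> insert x ` {A..B}"
  proof (cases "x \<in> T")
    case True
    then have "T - {x} \<in> {A..B}" "insert x (T - {x}) = T" using T assms by auto
    then show ?thesis by (metis UnI2 image_eqI)
  next
    case False
    then show ?thesis using T by auto
  qed
qed auto

lemma partitionable_insert:
  assumes "partitionable d \<P>" "\<And>T. T \<in> \<P> \<Longrightarrow> x \<notin> T"
  shows "partitionable (Suc d) (insert x ` \<P>)"
  using assms
proof induction
  case empty
  then show ?case by (simp add: partitionable.empty)
next
  case (interval \<P> A B)
  have x: "x \<notin> B" using interval.prems[of B] interval.hyps by simp
  have IH: "partitionable (Suc d) (insert x ` \<P>)" using interval by blast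
  have inj: "S = T" if "insert x S = insert x T" "S \<in> {A..B}" "T \<in> \<P>" for S T
    using that interval.prems[of S] interval.prems[of T] by (metis UnI1 UnI2 insert_ident)
  have "{insert x A..insert x B} \<inter> insert x ` \<P> = {}"
    unfolding interval_insert_both[OF x interval.hyps(2), symmetric] using inj interval.hyps(4) by blast
  then have "partitionable (Suc d) ({insert x A..insert x B} \<union> insert x ` \<P>)"
    using IH interval.hyps x by (intro partitionable.interval) auto
  then show ?case unfolding image_Un interval_insert_both[OF x interval.hyps(2)] .
qed

lemma partitionable_cone:
  assumes "partitionable d \<P>" "\<And>T. T \<in> \<P> \<Longrightarrow> x \<notin> T"
  shows "partitionable (Suc d) (\<P> \<union> insert x ` \<P>)"
  using assms
proof induction
  case empty
  then show ?case by (simp add: partitionable.empty)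
next
  case (interval \<P> A B)
  have x: "x \<notin> B" using interval.prems[of B] interval.hyps by simp
  have IH: "partitionable (Suc d) (\<P> \<union> insert x ` \<P>)" using interval by blast
  have inj: "S = T" if "insert x S = insert x T" "S \<in> {A..B}" "T \<in> \<P>" for S T
    using that interval.prems[of S] interval.prems[of T] by (metis UnI1 UnI2 insert_ident)
  have fresh: "x \<notin> T" if "T \<in> {A..B} \<union> \<P>" for T using interval.prems that by blast
  have "{A..B} \<inter> insert x ` \<P> = {}" "insert x ` {A..B} \<inter> \<P> = {}"
    using fresh[OF UnI1] fresh[OF UnI2] by blast+
  moreover have "insert x ` {A..B} \<inter> insert x ` \<P> = {}"
  proof (rule ccontr)
    assume "insert x ` {A..B} \<inter> insert x ` \<P> \<noteq> {}"
    then obtain S T where "S \<in> {A..B}" "T \<in> \<P>" "insert x S = insert x T" by blast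
    with inj[of S T] interval.hyps(4) show False by blast
  qed
  ultimately have "({A..B} \<union> insert x ` {A..B}) \<inter> (\<P> \<union> insert x ` \<P>) = {}"
    using interval.hyps(4) by (simp only: Int_Un_distrib Int_Un_distrib2 Un_empty)
  then have "partitionable (Suc d) ({A..insert x B} \<union> (\<P> \<union> insert x ` \<P>))"
    unfolding interval_insert_top[OF x interval.hyps(2)]
    using IH interval.hyps x by (intro partitionable.interval) auto
  moreover have "{A..B} \<union> \<P> \<union> insert x ` ({A..B} \<union> \<P>) = ({A..B} \<union> insert x ` {A..B}) \<union> (\<P> \<union> insert x ` \<P>)"
    by blast
  ultimately show ?case unfolding interval_insert_top[OF x interval.hyps(2)] by simp
qed

definition nonfaces :: "'v set \<Rightarrow> 'v set set \<Rightarrow> 'v set set" where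
  "nonfaces V \<Delta> = {T. T \<subseteq> V \<and> T \<notin> \<Delta>}"

text \<open>
  Adding \<open>x\<close> to both ends of the intervals for the link makes up for the smaller bound there.
\<close>

lemma partitionable_nonfaces_branch:
  assumes x: "x \<in> V" and del: "partitionable d (nonfaces (V - {x}) (deletion \<Delta> x))"
    and lk: "partitionable (d - 1) (nonfaces (V - {x}) (link \<Delta> {x}))"
  shows "partitionable d (nonfaces V \<Delta>)"
proof -
  have "partitionable (Suc (d - 1)) (insert x ` nonfaces (V - {x}) (link \<Delta> {x}))"
    using lk by (rule partitionable_insert) (auto simp: nonfaces_def)
  then have "partitionable d (insert x ` nonfaces (V - {x}) (link \<Delta> {x}))"
    by (rule partitionable_mono) simp
  then have "partitionable d (nonfaces (V - {x}) (deletion \<Delta> x) \<union> insert x ` nonfaces (V - {x}) (link \<Delta> {x}))"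
    by (intro partitionable_Un del) (auto simp: nonfaces_def)
  also have "nonfaces (V - {x}) (deletion \<Delta> x) \<union> insert x ` nonfaces (V - {x}) (link \<Delta> {x}) = nonfaces V \<Delta>"
  proof (intro set_eqI iffI)
    fix T assume T: "T \<in> nonfaces V \<Delta>"
    show "T \<in> nonfaces (V - {x}) (deletion \<Delta> x) \<union> insert x ` nonfaces (V - {x}) (link \<Delta> {x})"
    proof (cases "x \<in> T")
      case True
      then have "T - {x} \<in> nonfaces (V - {x}) (link \<Delta> {x})" "insert x (T - {x}) = T"
        using T by (auto simp: nonfaces_def link_def insert_absorb)
      then show ?thesis by (metis UnI2 image_eqI)
    qed (use T in \<open>auto simp: nonfaces_def deletion_def\<close>)
  qed (use x in \<open>auto simp: nonfaces_def deletion_def link_def\<close>)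
  finally show ?thesis .
qed

text \<open>
  A cone point belongs to no minimal nonface, so it is added to the upper ends only.
\<close>

lemma partitionable_nonfaces_cone:
  assumes x: "x \<in> V" and cone: "\<And>T. insert x T \<in> \<Delta> \<longleftrightarrow> T \<in> \<Delta>"
    and lk: "partitionable (d - 1) (nonfaces (V - {x}) (link \<Delta> {x}))"
  shows "partitionable d (nonfaces V \<Delta>)"
proof -
  let ?P = "nonfaces (V - {x}) (link \<Delta> {x})"
  have "partitionable (Suc (d - 1)) (?P \<union> insert x ` ?P)"
    using lk by (rule partitionable_cone) (auto simp: nonfaces_def)
  then have "partitionable d (?P \<union> insert x ` ?P)" by (rule partitionable_mono) simp
  also have "?P \<union> insert x ` ?P = nonfaces V \<Delta>"
  proof (intro set_eqI iffI)
    fix T assume T: "T \<in> nonfaces V \<Delta>"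
    have "T - {x} \<in> ?P" using T cone[of "T - {x}"] cone[of T] by (auto simp: nonfaces_def link_def)
    moreover have "T = T - {x} \<or> T = insert x (T - {x})" by blast
    ultimately show "T \<in> ?P \<union> insert x ` ?P" by (metis UnI1 UnI2 image_eqI)
  qed (use x cone in \<open>auto simp: nonfaces_def link_def\<close>)
  finally show ?thesis .
qed

lemma link_faces: "link (faces \<F>) {x} = faces ((\<lambda>F. F - {x}) ` {F \<in> \<F>. x \<in> F})"
proof (intro set_eqI iffI)
  fix T assume "T \<in> link (faces \<F>) {x}"
  then obtain F where "F \<in> \<F>" "T \<inter> {x} = {}" "T \<union> {x} \<subseteq> F" by (auto simp: link_def faces_def)
  then have "F - {x} \<in> (\<lambda>F. F - {x}) ` {F \<in> \<F>. x \<in> F}" "T \<subseteq> F - {x}" by blast+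
  then show "T \<in> faces ((\<lambda>F. F - {x}) ` {F \<in> \<F>. x \<in> F})" unfolding faces_def by blast
qed (auto simp: link_def faces_def)

lemma deletion_faces: "deletion (faces \<F>) x = faces ((\<lambda>F. F - {x}) ` \<F>)"
proof (intro set_eqI iffI)
  fix T assume "T \<in> deletion (faces \<F>) x"
  then obtain F where "F \<in> \<F>" "x \<notin> T" "T \<subseteq> F" by (auto simp: deletion_def faces_def)
  then have "F - {x} \<in> (\<lambda>F. F - {x}) ` \<F>" "T \<subseteq> F - {x}" by blast+
  then show "T \<in> faces ((\<lambda>F. F - {x}) ` \<F>)" unfolding faces_def by blast
qed (auto simp: deletion_def faces_def)

lemma in_link_faces: "F \<in> \<F> \<Longrightarrow> S \<union> T \<subseteq> F \<Longrightarrow> S \<inter> T = {} \<Longrightarrow> S \<in> link (faces \<F>) T"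
  unfolding link_def faces_def by blast

lemma link_facesE:
  assumes "S \<in> link (faces \<F>) T"
  obtains F where "F \<in> \<F>" "S \<union> T \<subseteq> F" "S \<inter> T = {}"
  using assms unfolding link_def faces_def by blast

lemma in_link_deletion_faces_iff:
  "S \<in> link (deletion (faces \<F>) x) T \<longleftrightarrow> x \<notin> S \<and> x \<notin> T \<and> S \<in> link (faces \<F>) T"
  unfolding link_def deletion_def by blast

lemma diff_singleton_subset: "A - B = {x} \<Longrightarrow> A - {x} \<subseteq> B"
proof
  fix z assume "A - B = {x}" "z \<in> A - {x}"
  then have "z \<notin> A - B" by simp
  with \<open>z \<in> A - {x}\<close> show "z \<in> B" by simp
qed

text \<open>
  The link of a facet is \<open>{{}}\<close>, the sphere of dimension -1; this is the case of a single colour.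
\<close>

lemma facet_bound:
  fixes \<F> :: "'v::finite set set"
  assumes D: "link_acyclic TYPE('k::field) (faces \<F>) d" and F: "F \<in> \<F>"
    and anti: "\<And>F'. F' \<in> \<F> \<Longrightarrow> F \<subseteq> F' \<Longrightarrow> F = F'"
  shows "d \<le> card F + 1"
proof -
  have "F \<in> faces \<F>" using F by (auto simp: faces_def)
  have link: "T \<in> link (faces \<F>) F \<longleftrightarrow> T = {}" for T
  proof
    assume "T \<in> link (faces \<F>) F"
    then obtain F' where "T \<inter> F = {}" "F' \<in> \<F>" "T \<union> F \<subseteq> F'" by (auto simp: link_def faces_def)
    then show "T = {}" using anti[of F'] by blast
  qed (use \<open>F \<in> faces \<F>\<close> in \<open>simp add: link_def\<close>)
  show ?thesis
  proof (rule rainbow_simplex_bound[OF D \<open>F \<in> faces \<F>\<close>, where k = 1 and \<phi> = "\<lambda>_. 1" and u = "\<lambda>_. undefined"])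
    show "\<not> {1..1::nat} \<subseteq> (\<lambda>_. 1) ` T" if "T \<in> link (faces \<F>) F" for T :: "'v set"
      using that unfolding link by simp
    show "(\<lambda>_. undefined) ` ({1..1} - {i}) \<in> link (faces \<F>) F" if "i \<in> {1..1}" for i :: nat
      using that unfolding link by simp
  qed auto
qed

text \<open>
  Choose \<open>F'\<close> such that its intersection with \<open>F\<close> is largest. In the link of \<open>F \<inter> F'\<close> what is left of \<open>F\<close> is then
  a component of its own, which bounds \<open>d\<close> by \<open>card (F \<inter> F') + 2\<close>.
\<close>

lemma critical_facet_neighbour:
  fixes \<F> :: "'v::finite set set"
  assumes D: "link_acyclic TYPE('k::field) (faces \<F>) d" and F: "F \<in> \<F>"
    and anti: "\<And>A B. A \<in> \<F> \<Longrightarrow> B \<in> \<F> \<Longrightarrow> A \<subseteq> B \<Longrightarrow> A = B"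
    and other: "\<F> \<noteq> {F}" and d: "card F + 1 \<le> d"
  shows "\<exists>F' y. F' \<in> \<F> \<and> F' \<noteq> F \<and> F - F' = {y}"
proof -
  let ?c = "\<lambda>G. card (F \<inter> G)"
  have "finite (?c ` (\<F> - {F}))" "?c ` (\<F> - {F}) \<noteq> {}" using F other by auto
  then obtain F' where F': "F' \<in> \<F>" "F' \<noteq> F" and "?c F' = Max (?c ` (\<F> - {F}))"
    using Max_in[of "?c ` (\<F> - {F})"] by (metis (no_types, lifting) DiffE imageE insertI1)
  then have max: "?c G \<le> ?c F'" if "G \<in> \<F>" "G \<noteq> F" for G
    using that by simp
  obtain u where u: "u \<in> F" "u \<notin> F'" using anti[OF F F'(1)] F'(2) by blast
  obtain v where v: "v \<in> F'" "v \<notin> F" using anti[OF F'(1) F] F'(2) by blast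
  have "d \<le> card (F \<inter> F') + 2"
  proof (rule two_colour_bound[OF D, where B = F and u = u and v = v])
    show "F \<inter> F' \<in> faces \<F>" using F by (auto simp: faces_def)
    show "{u} \<in> link (faces \<F>) (F \<inter> F')" "u \<in> F" using F u by (auto simp: link_def faces_def)
    show "{v} \<in> link (faces \<F>) (F \<inter> F')" "v \<notin> F" using F' v by (auto simp: link_def faces_def)
    fix T p q assume T: "T \<in> link (faces \<F>) (F \<inter> F')" and p: "p \<in> T" "p \<in> F" and q: "q \<in> T"
    from T obtain G where G: "G \<in> \<F>" "T \<union> (F \<inter> F') \<subseteq> G" and disj: "T \<inter> (F \<inter> F') = {}"
      by (auto simp: link_def faces_def)
    show "q \<in> F"
    proof (rule ccontr)
      assume "q \<notin> F"
      then have "?c G \<le> ?c F'" using G q by (intro max) auto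
      moreover have "card (insert p (F \<inter> F')) \<le> ?c G" using G p by (intro card_mono) auto
      moreover have "p \<notin> F \<inter> F'" using disj p by blast
      ultimately show False by simp
    qed
  qed
  moreover have "card F = card (F \<inter> F') + card (F - F')"
    by (subst card_Un_disjoint[symmetric]) (auto intro: arg_cong[where f = card])
  ultimately have "card (F - F') \<le> 1" using d by simp
  moreover have "0 < card (F - F')" using u by (auto simp: card_gt_0_iff)
  ultimately have "card (F - F') = 1" by simp
  then show ?thesis using F' by (metis card_1_singletonE)
qed

text \<open>
  The link of a face that contains \<open>x\<close> is a simplex, hence a cone except at \<open>F\<close> itself. If the bound of \<open>F\<close> is
  attained, \<open>critical_facet_neighbour\<close> provides a facet that contains \<open>F\<close> up to a single vertex. This vertex must be \<open>x\<close>, so that the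
  remainder of \<open>F\<close> is not a facet after the deletion.
\<close>

lemma link_acyclic_delete_free_vertex:
  fixes \<F> :: "'v::finite set set"
  assumes D: "link_acyclic TYPE('k::field) (faces \<F>) d" and F: "F \<in> \<F>"
    and anti: "\<And>A B. A \<in> \<F> \<Longrightarrow> B \<in> \<F> \<Longrightarrow> A \<subseteq> B \<Longrightarrow> A = B"
    and other: "\<F> \<noteq> {F}" and x: "x \<in> F" and free: "\<And>G. G \<in> \<F> \<Longrightarrow> x \<in> G \<Longrightarrow> G = F"
  shows "link_acyclic TYPE('k) (deletion (faces \<F>) x) d"
proof (rule link_acyclic_deletion[OF D simplicial_faces])
  let ?\<Delta> = "faces \<F>"
  fix ord :: "'v \<Rightarrow> nat" and \<sigma> s
  assume ord: "inj ord" and "x \<notin> \<sigma>" and face: "insert x \<sigma> \<in> ?\<Delta>" and d: "card (insert x \<sigma>) + s + 1 = d"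
  have "insert x \<sigma> \<subseteq> F" using face free by (auto simp: faces_def)
  show "cohomology_vanishes TYPE('k) ord (link ?\<Delta> (insert x \<sigma>)) s \<or> cohomology_vanishes TYPE('k) ord (link (deletion ?\<Delta> x) \<sigma>) s"
  proof (cases "insert x \<sigma> = F")
    case False
    then obtain y where y: "y \<in> F" "y \<notin> insert x \<sigma>" using \<open>insert x \<sigma> \<subseteq> F\<close> by blast
    have "cohomology_vanishes TYPE('k) ord (link ?\<Delta> (insert x \<sigma>)) s"
    proof (rule cohomology_vanishes_cone[OF ord, of _ y])
      fix T assume T: "T \<in> link ?\<Delta> (insert x \<sigma>)"
      then obtain G where G: "G \<in> \<F>" "T \<union> insert x \<sigma> \<subseteq> G" "T \<inter> insert x \<sigma> = {}"
        by (rule link_facesE)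
      then have "G = F" using free by blast
      then show "insert y T \<in> link ?\<Delta> (insert x \<sigma>)"
        using G y by (intro in_link_faces[OF F]) auto
    qed
    then show ?thesis ..
  next
    case True
    have "d \<le> card F + 1" using facet_bound[OF D F] anti[OF F] by blast
    then have s: "s = 0" and dF: "card F + 1 \<le> d" using d True by auto
    obtain F' y where F': "F' \<in> \<F>" "F' \<noteq> F" "F - F' = {y}"
      using critical_facet_neighbour[OF D F anti other dF] by blast
    have "x \<notin> F'" using free F' by blast
    then have "x \<in> F - F'" using x by blast
    then have "y = x" unfolding F'(3) by simp
    obtain v where v: "v \<in> F'" "v \<notin> F" using anti[OF F'(1) F] F'(2) by blast
    have \<sigma>: "\<sigma> = F - {x}" using True \<open>x \<notin> \<sigma>\<close> by (metis Diff_insert_absorb)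
    have "{v} \<union> (F - {x}) \<subseteq> F'" using v(1) diff_singleton_subset[OF F'(3)] \<open>y = x\<close> by simp
    then have "{v} \<in> link (deletion ?\<Delta> x) \<sigma>"
      using v \<open>x \<notin> F'\<close> unfolding \<sigma> in_link_deletion_faces_iff
      by (intro conjI in_link_faces[OF F'(1)]) auto
    then show ?thesis using cohomology_vanishes_nonempty unfolding s by blast
  qed
qed

text \<open>
  A separation either leaves \<open>F1\<close> and \<open>F2\<close> on the same side, and then it separates the link before the deletion as well,
  or it has them on different sides, which \<open>ridge_not_separating\<close> excludes.
\<close>

lemma ridge_deletion_connected:
  fixes F1 F2 F3 F4 :: "'v::finite set"
  assumes ff: "four_facets TYPE('k::field) F1 F2 F3 F4 d"
    and x: "x \<in> F1 \<inter> F2" "x \<notin> F3" "x \<notin> F4" and d: "card (F1 \<inter> F2) + 2 = d"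
    and L: "L = link (deletion (faces {F1,F2,F3,F4}) x) (F1 \<inter> F2 - {x})"
    and uv: "{u} \<in> L" "{v} \<in> L" "u \<in> B" "v \<notin> B"
  shows "\<exists>p q. p \<in> B \<and> q \<notin> B \<and> {p,q} \<in> L"
proof (rule ccontr)
  assume no: "\<not> ?thesis"
  let ?\<sigma> = "F1 \<inter> F2 - {x}" and ?\<Delta> = "faces {F1,F2,F3,F4}"
  note D = four_facets_acyclic[OF ff]
  have edge: "{p,q} \<in> L" if "F \<in> {F1,F2,F3,F4}" "?\<sigma> \<subseteq> F" "p \<in> F - F1 \<inter> F2" "q \<in> F - F1 \<inter> F2" for F p q
    using that(2-4) x unfolding L in_link_deletion_faces_iff
    by (intro conjI in_link_faces[OF that(1)]) auto
  have side: "F - F1 \<inter> F2 \<subseteq> C \<or> (F - F1 \<inter> F2) \<inter> C = {}"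
    if "F \<in> {F1,F2,F3,F4}" "?\<sigma> \<subseteq> F" "C = B \<or> C = - B" for F C
    using edge[OF that(1,2)] no that(3) by blast
  obtain a1 where a1: "a1 \<in> F1" "a1 \<notin> F2" using four_facets_antichain(1)[OF ff] by blast
  obtain a2 where a2: "a2 \<in> F2" "a2 \<notin> F1" using four_facets_antichain(2)[OF ff] by blast
  \<comment> \<open>\<open>x\<close> is joined to \<open>F1\<close> and \<open>F2\<close> only, so it can be added to their common side\<close>
  have same: False if C: "C = B \<or> C = - B" and in_C: "a1 \<in> C" "a2 \<in> C" and w: "{w} \<in> L" "w \<notin> C" for C w
  proof -
    have C1: "F1 - F1 \<inter> F2 \<subseteq> C" using side[of F1 C] a1 in_C C by blast
    have C2: "F2 - F1 \<inter> F2 \<subseteq> C" using side[of F2 C] a2 in_C C by blast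
    have "d \<le> card ?\<sigma> + 2"
    proof (rule two_colour_bound[OF D, where B = "insert x C" and u = a1 and v = w])
      show "?\<sigma> \<in> ?\<Delta>" by (auto simp: faces_def)
      show "{a1} \<in> link ?\<Delta> ?\<sigma>" "a1 \<in> insert x C" using a1 in_C by (auto simp: link_def faces_def)
      show "{w} \<in> link ?\<Delta> ?\<sigma>" "w \<notin> insert x C"
        using w unfolding L in_link_deletion_faces_iff by blast+
      fix T p q assume T: "T \<in> link ?\<Delta> ?\<sigma>" and p: "p \<in> T" "p \<in> insert x C" and q: "q \<in> T"
      from T obtain F where F: "F \<in> {F1,F2,F3,F4}" "T \<union> ?\<sigma> \<subseteq> F" and disj: "T \<inter> ?\<sigma> = {}"
        by (rule link_facesE)
      show "q \<in> insert x C"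
      proof (rule ccontr)
        assume q': "q \<notin> insert x C"
        then have q'': "q \<in> F - F1 \<inter> F2" using q F(2) disj by blast
        show False
        proof (cases "p = x")
          case True
          then have "x \<in> F" using p F(2) by blast
          then have "F = F1 \<or> F = F2" using F(1) x by blast
          then show False using q'' q' C1 C2 by blast
        next
          case False
          then have "p \<in> F - F1 \<inter> F2" "p \<in> C" using p F(2) disj by blast+
          then have "{p,q} \<in> L" "{q,p} \<in> L" using edge[OF F(1)] F(2) q'' by blast+
          then show False using no C \<open>p \<in> C\<close> q' by blast
        qed
      qed
    qed
    moreover have "card ?\<sigma> + 1 = card (F1 \<inter> F2)" using card_Suc_Diff1[OF finite x(1)] by simp
    ultimately show False using d by simp
  qed
  have sep: False if C: "C = B \<or> C = - B" and "a1 \<in> C" "a2 \<notin> C" for C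
  proof (rule ridge_not_separating[OF ff x d, of C])
    show "F1 - F2 \<subseteq> C" using side[of F1 C] that a1 by blast
    show "(F2 - F1) \<inter> C = {}" using side[of F2 C] that a2 by blast
    show "F3 - F1 \<inter> F2 \<subseteq> C \<or> (F3 - F1 \<inter> F2) \<inter> C = {}" if "?\<sigma> \<subseteq> F3"
      using side[of F3 C] that C by blast
    show "F4 - F1 \<inter> F2 \<subseteq> C \<or> (F4 - F1 \<inter> F2) \<inter> C = {}" if "?\<sigma> \<subseteq> F4"
      using side[of F4 C] that C by blast
  qed
  show False
    using same[of B v] same[of "- B" u] sep[of B] sep[of "- B"] uv by blast
qed

text \<open>
  When the bound of \<open>F1\<close> is attained, some facet contains \<open>F1\<close> up to a single vertex \<open>y\<close>. Either \<open>y = x\<close>, and this facet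
  extends the remainder of \<open>F1\<close>. Or the facet is \<open>F2\<close>; then the bound of the ridge is attained too, and an edge at \<open>y\<close> in
  the connected link of the ridge leads out of \<open>F1\<close>.
\<close>

lemma facet_minus_vertex_not_maximal:
  fixes F1 F2 F3 F4 :: "'v::finite set"
  assumes ff: "four_facets TYPE('k::field) F1 F2 F3 F4 d"
    and x: "x \<in> F1 \<inter> F2" "x \<notin> F3" "x \<notin> F4" and d: "card F1 + 1 = d"
  shows "\<exists>v. {v} \<in> link (deletion (faces {F1,F2,F3,F4}) x) (F1 - {x})"
proof -
  let ?\<F> = "{F1,F2,F3,F4}"
  have r: "ridge_system TYPE('k) ?\<F> d" and ne: "?\<F> \<noteq> {F1}"
    using ff by (auto simp: four_facets_def)
  note anti = ridge_system_antichain[OF r]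
  obtain F' y where F': "F' \<in> ?\<F>" "F' \<noteq> F1" "F1 - F' = {y}"
    using critical_facet_neighbour[OF four_facets_acyclic[OF ff] _ anti ne] d by blast
  show ?thesis
  proof (cases "x \<in> F'")
    case False
    obtain v where v: "v \<in> F'" "v \<notin> F1" using anti[OF F'(1), of F1] F'(2) by blast
    have "x \<in> F1 - F'" using False x by blast
    then have "y = x" unfolding F'(3) by simp
    then have "{v} \<union> (F1 - {x}) \<subseteq> F'" using v(1) diff_singleton_subset[OF F'(3)] by simp
    then have "{v} \<in> link (deletion (faces ?\<F>) x) (F1 - {x})"
      using v False unfolding in_link_deletion_faces_iff by (intro conjI in_link_faces[OF F'(1)]) auto
    then show ?thesis ..
  next
    case True
    then have "F' = F2" using F' x by blast
    then have "F1 - F2 = {y}" using F'(3) by simp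
    then have y: "F1 = insert y (F1 \<inter> F2)" "y \<notin> F2" "y \<in> F1" by auto
    have card: "card F1 = Suc (card (F1 \<inter> F2))" using y(2) by (subst y(1)) simp
    let ?L = "link (deletion (faces ?\<F>) x) (F1 \<inter> F2 - {x})"
    obtain z where z: "z \<in> F2" "z \<notin> F1" using four_facets_antichain(2)[OF ff] by blast
    have "{y} \<in> ?L" using y x unfolding in_link_deletion_faces_iff
      by (intro conjI in_link_faces[of F1]) auto
    moreover have "{z} \<in> ?L" using z x unfolding in_link_deletion_faces_iff
      by (intro conjI in_link_faces[of F2]) auto
    ultimately obtain p q where pq: "p \<in> {y}" "q \<notin> {y}" "{p,q} \<in> ?L"
      using ridge_deletion_connected[OF ff x _ refl, of y z "{y}"] d card z y by auto
    then have q: "x \<noteq> q" "{y,q} \<in> link (faces ?\<F>) (F1 \<inter> F2 - {x})"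
      unfolding in_link_deletion_faces_iff by auto
    from q(2) obtain G where G: "G \<in> ?\<F>" "{y,q} \<union> (F1 \<inter> F2 - {x}) \<subseteq> G" "{y,q} \<inter> (F1 \<inter> F2 - {x}) = {}"
      by (rule link_facesE)
    have "{q} \<union> (F1 - {x}) \<subseteq> G" "{q} \<inter> (F1 - {x}) = {}"
      using G(2,3) y(1) pq(2) q(1) by auto
    then have "{q} \<in> link (deletion (faces ?\<F>) x) (F1 - {x})"
      using q(1) unfolding in_link_deletion_faces_iff by (intro conjI in_link_faces[OF G(1)]) auto
    then show ?thesis ..
  qed
qed

section \<open>Deleting a vertex that lies in few facets\<close>

lemma simplicialD: "simplicial L \<Longrightarrow> T \<in> L \<Longrightarrow> S \<subseteq> T \<Longrightarrow> S \<in> L"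
  unfolding simplicial_def by blast

text \<open>
  The link of the ridge consists of two disjoint simplices.
\<close>

lemma ridge_bound:
  assumes ff: "four_facets TYPE('k::field) F1 F2 F3 F4 d"
    and x: "x \<in> F1 \<inter> F2" "x \<notin> F3" "x \<notin> F4"
  shows "d \<le> card (F1 \<inter> F2) + 2"
proof -
  obtain u where u: "u \<in> F1" "u \<notin> F2" using four_facets_antichain(1)[OF ff] by blast
  obtain v where v: "v \<in> F2" "v \<notin> F1" using four_facets_antichain(2)[OF ff] by blast
  show ?thesis
  proof (rule two_colour_bound[OF four_facets_acyclic[OF ff], where B = F1 and u = u and v = v])
    show "F1 \<inter> F2 \<in> faces {F1,F2,F3,F4}" by (auto simp: faces_def)
    show "{u} \<in> link (faces {F1,F2,F3,F4}) (F1 \<inter> F2)" using u by (intro in_link_faces[of F1]) auto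
    show "{v} \<in> link (faces {F1,F2,F3,F4}) (F1 \<inter> F2)" using v by (intro in_link_faces[of F2]) auto
    fix T p q assume T: "T \<in> link (faces {F1,F2,F3,F4}) (F1 \<inter> F2)" and pq: "p \<in> T" "q \<in> T" "p \<in> F1"
    from T obtain G where G: "G \<in> {F1,F2,F3,F4}" "T \<union> F1 \<inter> F2 \<subseteq> G" "T \<inter> (F1 \<inter> F2) = {}"
      by (rule link_facesE)
    have "G = F1 \<or> G = F2" using G(1,2) x by blast
    moreover have "G \<noteq> F2" using G(2,3) pq by blast
    ultimately show "q \<in> F1" using G(2) pq by blast
  qed (use u v in auto)
qed

text \<open>
  The link of a face through \<open>x\<close> is a cone unless the face is \<open>F1\<close>, \<open>F2\<close> or \<open>F1 \<inter> F2\<close>. At these three faces the bounds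
  for facets and for the ridge leave only the cohomology in dimension -1, and for the ridge also in dimension 0.
\<close>

lemma link_acyclic_delete_ridge_vertex:
  fixes F1 F2 F3 F4 :: "'v::finite set"
  assumes ff: "four_facets TYPE('k::field) F1 F2 F3 F4 d"
    and x: "x \<in> F1 \<inter> F2" "x \<notin> F3" "x \<notin> F4"
  shows "link_acyclic TYPE('k) (deletion (faces {F1,F2,F3,F4}) x) d"
proof (rule link_acyclic_deletion[OF four_facets_acyclic[OF ff] simplicial_faces])
  let ?\<F> = "{F1,F2,F3,F4}" let ?\<Delta> = "faces ?\<F>"
  note ff' = four_facets_swap12[OF ff]
  have swap: "{F2,F1,F3,F4} = ?\<F>" by (rule insert_commute)
  have r: "ridge_system TYPE('k) ?\<F> d" using ff by (simp add: four_facets_def)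
  note anti = ridge_system_antichain[OF r]
  fix ord :: "'v \<Rightarrow> nat" and \<sigma> s
  assume ord: "inj ord" and x\<sigma>: "x \<notin> \<sigma>" and face: "insert x \<sigma> \<in> ?\<Delta>" and d: "card (insert x \<sigma>) + s + 1 = d"
  let ?\<tau> = "insert x \<sigma>"
  have in12: "G = F1 \<or> G = F2" if "G \<in> ?\<F>" "?\<tau> \<subseteq> G" for G
    using that x by blast
  have cone: "cohomology_vanishes TYPE('k) ord (link ?\<Delta> ?\<tau>) s"
    if y: "y \<notin> ?\<tau>" and all: "\<And>G. G \<in> ?\<F> \<Longrightarrow> ?\<tau> \<subseteq> G \<Longrightarrow> y \<in> G" for y
  proof (rule cohomology_vanishes_cone[OF ord, of _ y])
    fix T assume "T \<in> link ?\<Delta> ?\<tau>"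
    then obtain G where G: "G \<in> ?\<F>" "T \<union> ?\<tau> \<subseteq> G" "T \<inter> ?\<tau> = {}" by (rule link_facesE)
    then have "y \<in> G" using all by blast
    with G y show "insert y T \<in> link ?\<Delta> ?\<tau>" by (intro in_link_faces[OF G(1)]) auto
  qed
  have \<sigma>: "\<sigma> = ?\<tau> - {x}" using x\<sigma> by auto
  obtain G0 where "G0 \<in> ?\<F>" "?\<tau> \<subseteq> G0" using face by (auto simp: faces_def)
  then consider (ridge) "?\<tau> = F1 \<inter> F2" | (f1) "?\<tau> = F1" | (f2) "?\<tau> = F2"
    | (inner) "cohomology_vanishes TYPE('k) ord (link ?\<Delta> ?\<tau>) s"
  proof -
    have "?\<tau> \<subseteq> F1 \<or> ?\<tau> \<subseteq> F2" using in12[OF \<open>G0 \<in> ?\<F>\<close> \<open>?\<tau> \<subseteq> G0\<close>] \<open>?\<tau> \<subseteq> G0\<close> by blast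
    then consider "?\<tau> \<subseteq> F1 \<inter> F2" | "?\<tau> \<subseteq> F1" "\<not> ?\<tau> \<subseteq> F2" | "?\<tau> \<subseteq> F2" "\<not> ?\<tau> \<subseteq> F1" by blast
    then show thesis
    proof cases
      case 1
      show thesis
      proof (cases "?\<tau> = F1 \<inter> F2")
        case False
        then obtain y where "y \<in> F1 \<inter> F2" "y \<notin> ?\<tau>" using 1 by blast
        then show thesis using cone[of y] in12 that(4) by blast
      qed (use that(1) in blast)
    next
      case 2
      show thesis
      proof (cases "?\<tau> = F1")
        case False
        then obtain y where "y \<in> F1" "y \<notin> ?\<tau>" using 2 by blast
        then show thesis using cone[of y] in12 2 that(4) by blast
      qed (use that(2) in blast)
    next
      case 3
      show thesis
      proof (cases "?\<tau> = F2")
        case False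
        then obtain y where "y \<in> F2" "y \<notin> ?\<tau>" using 3 by blast
        then show thesis using cone[of y] in12 3 that(4) by blast
      qed (use that(3) in blast)
    qed
  qed
  then show "cohomology_vanishes TYPE('k) ord (link ?\<Delta> ?\<tau>) s \<or> cohomology_vanishes TYPE('k) ord (link (deletion ?\<Delta> x) \<sigma>) s"
  proof cases
    case inner
    then show ?thesis ..
  next
    case ridge
    let ?L = "link (deletion ?\<Delta> x) \<sigma>"
    have \<sigma>': "\<sigma> = F1 \<inter> F2 - {x}" using \<sigma> ridge by simp
    have "s = 0 \<or> s = 1" using ridge_bound[OF ff x] d ridge by auto
    then show ?thesis
    proof
      assume s: "s = 0"
      obtain u where u: "u \<in> F1" "u \<notin> F2" using four_facets_antichain(1)[OF ff] by blast
      have "{u} \<in> ?L" using u x unfolding \<sigma>' in_link_deletion_faces_iff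
        by (intro conjI in_link_faces[of F1]) auto
      then show ?thesis using cohomology_vanishes_nonempty unfolding s by blast
    next
      assume s: "s = 1"
      have d2: "card (F1 \<inter> F2) + 2 = d" using d s ridge by simp
      have "cohomology_vanishes TYPE('k) ord ?L 1"
      proof (rule cohomology_vanishes_connected[OF ord])
        fix B u v assume "u \<in> B" "v \<notin> B" "{u} \<in> ?L" "{v} \<in> ?L"
        then obtain p q where pq: "p \<in> B" "q \<notin> B" "{p,q} \<in> ?L"
          using ridge_deletion_connected[OF ff x d2 refl, of u v B] unfolding \<sigma>' by blast
        have "simplicial ?L"
          unfolding deletion_faces by (intro simplicial_link simplicial_faces)
        then have "{p} \<in> ?L" "{q} \<in> ?L" by (rule simplicialD[OF _ pq(3)]; simp)+
        with pq show "\<exists>p q. p \<in> B \<and> q \<notin> B \<and> {p,q} \<in> ?L \<and> {p} \<in> ?L \<and> {q} \<in> ?L"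
          by (intro exI conjI)
      qed
      then show ?thesis unfolding s ..
    qed
  next
    case f1
    have "d \<le> card F1 + 1"
      using facet_bound[OF four_facets_acyclic[OF ff], of F1] anti[of F1] by blast
    then have s: "s = 0" and "card F1 + 1 = d" using d f1 by auto
    then obtain v where "{v} \<in> link (deletion ?\<Delta> x) (F1 - {x})"
      using facet_minus_vertex_not_maximal[OF ff x] by blast
    then show ?thesis using cohomology_vanishes_nonempty \<sigma> f1 unfolding s by metis
  next
    case f2
    have x': "x \<in> F2 \<inter> F1" using x by blast
    have "d \<le> card F2 + 1"
      using facet_bound[OF four_facets_acyclic[OF ff], of F2] anti[of F2] by blast
    then have s: "s = 0" and "card F2 + 1 = d" using d f2 by auto
    then obtain v where "{v} \<in> link (deletion ?\<Delta> x) (F2 - {x})"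
      using facet_minus_vertex_not_maximal[OF ff' x' x(2,3)] unfolding swap by blast
    then show ?thesis using cohomology_vanishes_nonempty \<sigma> f2 unfolding s by metis
  qed
qed

text \<open>
  Colour each vertex by the one facet that avoids it. A nonface meets the complement of each facet, so it carries all
  colours and has at least \<open>card \<F>\<close> elements, whereas faces do not carry all colours. A choice of one vertex per colour spans
  a sphere in \<open>faces \<F>\<close>, so that \<open>d \<le> card \<F>\<close>, and the nonfaces may be taken as intervals with one element.
\<close>

lemma partitionable_disjoint_cofacets:
  fixes \<F> :: "'v::finite set set"
  assumes D: "link_acyclic TYPE('k::field) (faces \<F>) d" and ne: "\<F> \<noteq> {}" and sub: "\<And>F. F \<in> \<F> \<Longrightarrow> F \<subseteq> V"
    and proper: "V \<notin> \<F>" and miss: "\<And>v. v \<in> V \<Longrightarrow> \<exists>F\<in>\<F>. v \<notin> F"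
    and unique: "\<And>v A B. v \<in> V \<Longrightarrow> A \<in> \<F> \<Longrightarrow> B \<in> \<F> \<Longrightarrow> v \<notin> A \<Longrightarrow> v \<notin> B \<Longrightarrow> A = B"
  shows "partitionable d (nonfaces V (faces \<F>))"
proof (rule partitionable_large_sets)
  let ?m = "card \<F>"
  obtain f where f: "bij_betw f {1..?m} \<F>"
    using ex_bij_betw_nat_finite_1[OF finite[of \<F>]] by blast
  have f_in: "f i \<in> \<F>" if "i \<in> {1..?m}" for i using bij_betwE[OF f] that by blast
  have f_inj: "i = j" if "i \<in> {1..?m}" "j \<in> {1..?m}" "f i = f j" for i j
    using inj_onD[OF bij_betw_imp_inj_on[OF f] that(3,1,2)] .
  have f_surj: "\<exists>i\<in>{1..?m}. f i = F" if "F \<in> \<F>" for F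
  proof -
    have "F \<in> f ` {1..?m}" using bij_betw_imp_surj_on[OF f] that by simp
    then show ?thesis by blast
  qed
  have m: "1 \<le> ?m" using ne by (simp add: Suc_le_eq card_gt_0_iff)
  define \<phi> where "\<phi> v = (if v \<in> V then THE i. i \<in> {1..?m} \<and> v \<notin> f i else 1)" for v
  have \<phi>_unique: "\<phi> v = i" if v: "v \<in> V" "i \<in> {1..?m}" "v \<notin> f i" for v i
  proof -
    have "(THE i. i \<in> {1..?m} \<and> v \<notin> f i) = i"
    proof (rule the_equality)
      show "i \<in> {1..?m} \<and> v \<notin> f i" using v by blast
      show "j = i" if "j \<in> {1..?m} \<and> v \<notin> f j" for j
        using f_inj[of j i] unique[OF v(1), of "f j" "f i"] f_in that v(2,3) by blast
    qed
    then show ?thesis unfolding \<phi>_def using v(1) by simp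
  qed
  have \<phi>_miss: "\<phi> v \<in> {1..?m} \<and> v \<notin> f (\<phi> v)" if v: "v \<in> V" for v
  proof -
    obtain i where "i \<in> {1..?m}" "v \<notin> f i" using miss[OF v] f_surj by blast
    then show ?thesis using \<phi>_unique[OF v] by simp
  qed
  have "\<exists>v. v \<in> V \<and> v \<notin> f i" if "i \<in> {1..?m}" for i
  proof -
    have "f i \<noteq> V" using f_in[OF that] proper by metis
    then show ?thesis using sub[OF f_in[OF that]] by blast
  qed
  then obtain u where u: "\<And>i. i \<in> {1..?m} \<Longrightarrow> u i \<in> V \<and> u i \<notin> f i" by metis
  have "d \<le> card ({} :: 'v set) + ?m"
  proof (rule rainbow_simplex_bound[OF D _ m, where \<phi> = \<phi> and u = u])
    show "{} \<in> faces \<F>" using ne by (auto simp: faces_def)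
    show "range \<phi> \<subseteq> {1..?m}"
    proof (rule image_subsetI)
      show "\<phi> v \<in> {1..?m}" for v using \<phi>_miss[of v] m by (cases "v \<in> V") (auto simp: \<phi>_def)
    qed
    show "\<not> {1..?m} \<subseteq> \<phi> ` T" if T: "T \<in> link (faces \<F>) {}" for T
    proof
      assume all: "{1..?m} \<subseteq> \<phi> ` T"
      obtain F where "F \<in> \<F>" "T \<subseteq> F" using T by (auto simp: faces_def)
      then obtain i where i: "i \<in> {1..?m}" "T \<subseteq> f i" "f i \<in> \<F>" using f_surj by blast
      then obtain v where "v \<in> T" "\<phi> v = i" using all by blast
      then have "v \<in> f i" "v \<in> V" using i(2) sub[OF i(3)] by blast+
      then show False using \<phi>_miss[of v] \<open>\<phi> v = i\<close> by simp
    qed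
    show "\<phi> (u i) = i" if "i \<in> {1..?m}" for i using \<phi>_unique u that by blast
    show "u ` ({1..?m} - {i}) \<in> link (faces \<F>) {}" if i: "i \<in> {1..?m}" for i
    proof -
      have "u j \<in> f i" if j: "j \<in> {1..?m} - {i}" for j
      proof (rule ccontr)
        assume "u j \<notin> f i"
        then have "\<phi> (u j) = i" "\<phi> (u j) = j" using \<phi>_unique u i j by blast+
        then have "i = j" by simp
        then show False using j by simp
      qed
      then have "u ` ({1..?m} - {i}) \<subseteq> f i" by blast
      then show ?thesis using f_in[OF i] by (intro in_link_faces[of "f i"]) auto
    qed
  qed
  then have d: "d \<le> ?m" by simp
  fix T assume "T \<in> nonfaces V (faces \<F>)"
  then have T: "T \<subseteq> V" "\<And>F. F \<in> \<F> \<Longrightarrow> \<not> T \<subseteq> F" by (auto simp: nonfaces_def faces_def)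
  have "{1..?m} \<subseteq> \<phi> ` T"
  proof
    fix i assume i: "i \<in> {1..?m}"
    then obtain v where "v \<in> T" "v \<notin> f i" using T(2)[OF f_in] by blast
    then have "\<phi> v = i" using \<phi>_unique T(1) i by blast
    then show "i \<in> \<phi> ` T" using \<open>v \<in> T\<close> by blast
  qed
  then have "?m \<le> card (\<phi> ` T)" using card_mono[of "\<phi> ` T" "{1..?m}"] by simp
  also have "\<dots> \<le> card T" by (rule card_image_le) simp
  finally show "d \<le> card T" using d by simp
qed

text \<open>
  With at most four facets, \<open>x\<close> lies in none, one or two of them. In the last case there are exactly four, and by
  the choice of \<open>x\<close> every vertex lies in at least two of them.
\<close>

lemma link_acyclic_delete_rarest_vertex:
  fixes \<F> :: "'v::finite set set"
  assumes D: "link_acyclic TYPE('k::field) (faces \<F>) d" and four: "card \<F> \<le> 4"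
    and anti: "\<And>A B. A \<in> \<F> \<Longrightarrow> B \<in> \<F> \<Longrightarrow> A \<subseteq> B \<Longrightarrow> A = B"
    and no_common: "\<Inter>\<F> = {}"
    and two: "2 \<le> card {F \<in> \<F>. x \<notin> F}"
    and rarest: "\<And>v. v \<in> \<Union>\<F> \<Longrightarrow> card {F \<in> \<F>. v \<notin> F} \<le> card {F \<in> \<F>. x \<notin> F}"
  shows "link_acyclic TYPE('k) (deletion (faces \<F>) x) d"
proof -
  let ?in = "\<lambda>v. {F \<in> \<F>. v \<in> F}" and ?out = "\<lambda>v. {F \<in> \<F>. v \<notin> F}"
  have split: "card (?in v) + card (?out v) = card \<F>" for v
    by (subst card_Un_disjoint[symmetric]) (auto intro: arg_cong[where f = card])
  then have "card (?in x) \<le> 2" using two four split[of x] by linarith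
  then consider "card (?in x) = 0" | "card (?in x) = 1" | "card (?in x) = 2" by linarith
  then show ?thesis
  proof cases
    case 1
    then have "?in x = {}" by simp
    then have "deletion (faces \<F>) x = faces \<F>" by (auto simp: deletion_def faces_def)
    then show ?thesis using D by simp
  next
    case 2
    then obtain F where "?in x = {F}" by (auto simp: card_1_singleton_iff)
    then have F: "F \<in> \<F>" "x \<in> F" "\<And>G. G \<in> \<F> \<Longrightarrow> x \<in> G \<Longrightarrow> G = F" by blast+
    have "\<F> \<noteq> {F}"
    proof
      assume "\<F> = {F}"
      then have "?out x = {}" using F by blast
      then have "card (?out x) = 0" by (simp only: card.empty)
      then show False using two by linarith
    qed
    then show ?thesis using link_acyclic_delete_free_vertex[OF D F(1) anti _ F(2,3)] by blast
  next
    case 3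
    then have "card (?out x) = 2" using two four split[of x] by linarith
    then obtain F3 F4 where out: "?out x = {F3,F4}" "F3 \<noteq> F4" by (auto simp: card_2_iff)
    obtain F1 F2 where inn: "?in x = {F1,F2}" "F1 \<noteq> F2" using 3 by (auto simp: card_2_iff)
    have eq: "\<F> = {F1,F2,F3,F4}"
    proof -
      have "\<F> = ?in x \<union> ?out x" by blast
      then show ?thesis unfolding inn out by auto
    qed
    have mem: "x \<in> F1 \<inter> F2" "x \<notin> F3" "x \<notin> F4" using inn(1) out(1) by blast+
    have "\<exists>B\<in>\<F>. B \<noteq> A \<and> v \<in> B" if A: "A \<in> \<F>" "v \<in> A" for A v
    proof (rule ccontr)
      assume "\<not> ?thesis"
      then have "?in v = {A}" using A by blast
      then have "card (?in v) = 1" by simp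
      moreover have "card (?out v) \<le> card (?out x)" using A by (intro rarest) blast
      ultimately show False using split[of v] split[of x] 3 by linarith
    qed
    then have "A \<subseteq> \<Union>(\<F> - {A})" if "A \<in> \<F>" for A using that by blast
    then have "ridge_system TYPE('k) \<F> d"
      unfolding ridge_system_def using D anti no_common by blast
    moreover have "distinct [F1,F2,F3,F4]" using inn(2) out(2) mem by auto
    ultimately have "four_facets TYPE('k) F1 F2 F3 F4 d" unfolding four_facets_def eq by simp
    then show ?thesis unfolding eq by (rule link_acyclic_delete_ridge_vertex[OF _ mem])
  qed
qed

text \<open>
  The induction covers families with superfluous members, since deletion may turn a facet into a subset of another
  one. Dropping such a member does not affect the vertex set, which is why the number of facets is part of the measure.
\<close>

theorem partitionable_nonfaces:
  fixes \<F> :: "'v::finite set set"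
  assumes "link_acyclic TYPE('k::field) (faces \<F>) d" "card \<F> \<le> 4"
    "\<And>F. F \<in> \<F> \<Longrightarrow> F \<subseteq> V" "\<F> = {} \<Longrightarrow> d \<le> card V"
  shows "partitionable d (nonfaces V (faces \<F>))"
  using assms
proof (induction "card V + card \<F>" arbitrary: V \<F> d rule: less_induct)
  case less
  note D = less.prems(1) and four = less.prems(2) and sub = less.prems(3)
  consider "\<F> = {}" | A B where "A \<in> \<F>" "B \<in> \<F>" "A \<subseteq> B" "A \<noteq> B" | "V \<in> \<F>"
    | "\<F> \<noteq> {}" "V \<notin> \<F>" "\<And>A B. A \<in> \<F> \<Longrightarrow> B \<in> \<F> \<Longrightarrow> A \<subseteq> B \<Longrightarrow> A = B"
    by blast
  then show ?case
  proof cases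
    case 1
    then have "nonfaces V (faces \<F>) = {{}..V}" by (auto simp: nonfaces_def faces_def)
    then show ?thesis using less.prems(4)[OF 1] by (simp only: partitionable_interval empty_subsetI)
  next
    case 2
    have eq: "faces (\<F> - {A}) = faces \<F>"
      using 2 unfolding faces_def by (intro Collect_cong) (metis Diff_iff order_trans singletonD)
    have "card (\<F> - {A}) < card \<F>" using 2(1) by (intro psubset_card_mono) auto
    then have "partitionable d (nonfaces V (faces (\<F> - {A})))"
      using D four sub 2 by (intro less.hyps) (auto simp: eq)
    then show ?thesis unfolding eq .
  next
    case 3
    then have "nonfaces V (faces \<F>) = {}" by (auto simp: nonfaces_def faces_def)
    then show ?thesis by (simp add: partitionable.empty)
  next
    case 4
    note anti = 4(3)
    have bound: "d \<le> card F + 1" "card F + 1 \<le> card V" if "F \<in> \<F>" for F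
    proof -
      show "d \<le> card F + 1" using facet_bound[OF D that] anti[OF that] by blast
      have "F \<subset> V" using sub[OF that] that 4(2) by blast
      then show "card F + 1 \<le> card V" using psubset_card_mono[of V F] by simp
    qed
    have "d \<le> card V" using 4(1) bound by (meson all_not_in_conv order_trans)
    have link_part: "partitionable (d - 1) (nonfaces (V - {x}) (link (faces \<F>) {x}))" if x: "x \<in> V" for x
      unfolding link_faces
    proof (rule less.hyps)
      let ?\<L> = "(\<lambda>F. F - {x}) ` {F \<in> \<F>. x \<in> F}"
      have "card ?\<L> \<le> card {F \<in> \<F>. x \<in> F}" by (rule card_image_le) simp
      also have "\<dots> \<le> card \<F>" by (rule card_mono) auto
      finally have c: "card ?\<L> \<le> card \<F>" .
      have V: "card (V - {x}) < card V" using x by (rule card_Diff1_less[OF finite])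
      show "card (V - {x}) + card ?\<L> < card V + card \<F>" using c V by linarith
      show "card ?\<L> \<le> 4" using c four by linarith
      show "link_acyclic TYPE('k) (faces ?\<L>) (d - 1)"
        unfolding link_faces[symmetric] by (rule link_acyclic_link[OF D])
      show "F \<subseteq> V - {x}" if "F \<in> ?\<L>" for F using that sub by blast
      show "d - 1 \<le> card (V - {x})" using \<open>d \<le> card V\<close> x by simp
    qed
    have deletion_part: "partitionable d (nonfaces (V - {x}) (deletion (faces \<F>) x))"
      if x: "x \<in> V" and Dx: "link_acyclic TYPE('k) (deletion (faces \<F>) x) d" for x
      unfolding deletion_faces
    proof (rule less.hyps)
      let ?\<D> = "(\<lambda>F. F - {x}) ` \<F>"
      have c: "card ?\<D> \<le> card \<F>" by (rule card_image_le) simp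
      have V: "card (V - {x}) < card V" using x by (rule card_Diff1_less[OF finite])
      show "card (V - {x}) + card ?\<D> < card V + card \<F>" using c V by linarith
      show "card ?\<D> \<le> 4" using c four by linarith
      show "link_acyclic TYPE('k) (faces ?\<D>) d" using Dx unfolding deletion_faces .
      show "F \<subseteq> V - {x}" if "F \<in> ?\<D>" for F using that sub by blast
      show "d \<le> card (V - {x})" if "?\<D> = {}" using that 4(1) by simp
    qed
    show ?thesis
    proof (cases "\<Inter>\<F> = {}")
      case False
      then obtain x where x: "\<And>F. F \<in> \<F> \<Longrightarrow> x \<in> F" by blast
      then have "x \<in> V" using 4(1) sub by blast
      then show ?thesis
        using x by (intro partitionable_nonfaces_cone[OF _ _ link_part[OF \<open>x \<in> V\<close>]]) (auto simp: faces_def)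
    next
      case True
      let ?out = "\<lambda>v. card {F \<in> \<F>. v \<notin> F}"
      show ?thesis
      proof (cases "\<forall>v\<in>V. ?out v \<le> 1")
        case small: True
        show ?thesis
        proof (rule partitionable_disjoint_cofacets[OF D 4(1) sub 4(2)])
          show "\<exists>F\<in>\<F>. v \<notin> F" for v using True by blast
          show "A = B" if "v \<in> V" "A \<in> \<F>" "B \<in> \<F>" "v \<notin> A" "v \<notin> B" for v A B
          proof (rule ccontr)
            assume "A \<noteq> B"
            have "card {A,B} \<le> ?out v" using that by (intro card_mono) auto
            moreover have "card {A,B} = 2" using \<open>A \<noteq> B\<close> by simp
            moreover have "?out v \<le> 1" using small that(1) by blast
            ultimately show False by linarith
          qed
        qed
      next
        case False
        then obtain v0 where v0: "v0 \<in> V" "2 \<le> ?out v0" by fastforce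
        have "Max (?out ` V) \<in> ?out ` V" using v0(1) by (intro Max_in) auto
        then obtain x where x: "x \<in> V" "?out x = Max (?out ` V)" by (metis (no_types, lifting) imageE)
        then have max: "?out v \<le> ?out x" if "v \<in> V" for v using that by simp
        have "link_acyclic TYPE('k) (deletion (faces \<F>) x) d"
        proof (rule link_acyclic_delete_rarest_vertex[OF D four anti True])
          show "2 \<le> ?out x" using max[OF v0(1)] v0(2) by linarith
          show "?out v \<le> ?out x" if "v \<in> \<Union>\<F>" for v using that sub by (intro max) blast
        qed
        then show ?thesis
          by (rule partitionable_nonfaces_branch[OF x(1) deletion_part[OF x(1)] link_part[OF x(1)]])
      qed
    qed
  qed
qed

section \<open>From regular sequences to acyclic links\<close>

definition support_ideal :: "'v set set \<Rightarrow> ('v::finite, 'k::field) mpoly set" where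
  "support_ideal \<Delta> = {f. \<forall>t\<in>Poly_Mapping.keys f. Poly_Mapping.keys t \<notin> \<Delta>}"

lemma lookup_single_times:
  fixes t s :: "'v \<Rightarrow>\<^sub>0 nat" and f :: "('v, 'k::field) mpoly"
  shows "Poly_Mapping.lookup (Poly_Mapping.single t a * f) (t + s) = a * Poly_Mapping.lookup f s"
  by (simp add: lookup_mult lookup_single when_mult)

lemma lookup_single_times_eq_0:
  fixes t k :: "'v \<Rightarrow>\<^sub>0 nat" and f :: "('v, 'k::field) mpoly"
  assumes "Poly_Mapping.lookup k x < Poly_Mapping.lookup t x"
  shows "Poly_Mapping.lookup (Poly_Mapping.single t a * f) k = 0"
proof -
  have "k \<noteq> t + q" for q using assms by (auto simp: lookup_add)
  then show ?thesis by (simp add: lookup_mult lookup_single when_mult)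
qed

lemma keys_add_exponents: "Poly_Mapping.keys (s + t :: 'v \<Rightarrow>\<^sub>0 nat) = Poly_Mapping.keys s \<union> Poly_Mapping.keys t"
  by (auto simp: in_keys_iff lookup_add)

lemma poly_mapping_sum_singles:
  "f = (\<Sum>t\<in>Poly_Mapping.keys f. Poly_Mapping.single t (Poly_Mapping.lookup f t))"
proof (rule poly_mapping_eqI)
  fix k
  show "Poly_Mapping.lookup f k = Poly_Mapping.lookup (\<Sum>t\<in>Poly_Mapping.keys f. Poly_Mapping.single t (Poly_Mapping.lookup f t)) k"
    by (simp add: lookup_sum lookup_single when_def in_keys_iff)
qed

lemma ideal_subspace_exponents:
  fixes W :: "('v \<Rightarrow>\<^sub>0 nat) set"
  assumes "\<And>s t. t \<in> W \<Longrightarrow> s + t \<in> W"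
  shows "ideal.subspace {f :: ('v, 'k::field) mpoly. Poly_Mapping.keys f \<subseteq> W}"
proof (rule ideal.subspaceI)
  fix f g c :: "('v, 'k) mpoly"
  show "0 \<in> {f :: ('v, 'k) mpoly. Poly_Mapping.keys f \<subseteq> W}" by simp
  show "f + g \<in> {f. Poly_Mapping.keys f \<subseteq> W}" if "f \<in> {f. Poly_Mapping.keys f \<subseteq> W}" "g \<in> {f. Poly_Mapping.keys f \<subseteq> W}"
    using that keys_add[of f g] by blast
  show "c * f \<in> {f. Poly_Mapping.keys f \<subseteq> W}" if "f \<in> {f. Poly_Mapping.keys f \<subseteq> W}"
    using that keys_mult[of c f] assms by blast
qed

lemma ideal_subspace_support_ideal:
  fixes \<Delta> :: "'v::finite set set"
  assumes "simplicial \<Delta>"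
  shows "ideal.subspace (support_ideal \<Delta> :: ('v, 'k::field) mpoly set)"
proof -
  have "support_ideal \<Delta> = {f :: ('v, 'k) mpoly. Poly_Mapping.keys f \<subseteq> {t. Poly_Mapping.keys t \<notin> \<Delta>}}"
    by (auto simp: support_ideal_def)
  moreover have "s + t \<in> {t. Poly_Mapping.keys t \<notin> \<Delta>}" if "t \<in> {t. Poly_Mapping.keys t \<notin> \<Delta>}" for s t :: "'v \<Rightarrow>\<^sub>0 nat"
    using that simplicialD[OF assms, of "Poly_Mapping.keys (s + t)" "Poly_Mapping.keys t"]
    by (auto simp: keys_add_exponents)
  ultimately show ?thesis using ideal_subspace_exponents by metis
qed

lemma span_vars:
  fixes Z :: "'v::finite set"
  shows "ideal.span (var ` Z) = {f :: ('v, 'k::field) mpoly. Poly_Mapping.keys f \<subseteq> {t. Poly_Mapping.keys t \<inter> Z \<noteq> {}}}"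
    (is "_ = ?R")
proof
  have "ideal.subspace ?R"
    by (rule ideal_subspace_exponents) (auto simp: keys_add_exponents)
  moreover have "var ` Z \<subseteq> ?R" by (auto simp: var_def monomial_def)
  ultimately show "ideal.span (var ` Z) \<subseteq> ?R" by (rule ideal.span_minimal[rotated])
  show "?R \<subseteq> ideal.span (var ` Z)"
  proof
    fix f :: "('v, 'k) mpoly"
    assume f: "f \<in> ?R"
    have "(\<Sum>t\<in>Poly_Mapping.keys f. Poly_Mapping.single t (Poly_Mapping.lookup f t)) \<in> ideal.span (var ` Z)"
    proof (rule ideal.span_sum)
      fix t assume "t \<in> Poly_Mapping.keys f"
      then obtain x where x: "x \<in> Poly_Mapping.keys t" "x \<in> Z" using f by blast
      define s where "s = t - Poly_Mapping.single x 1"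
      have "t = s + Poly_Mapping.single x 1"
        using x(1) by (intro poly_mapping_eqI) (auto simp: s_def lookup_add lookup_minus lookup_single when_def in_keys_iff)
      then have "Poly_Mapping.single t (Poly_Mapping.lookup f t) = Poly_Mapping.single s (Poly_Mapping.lookup f t) * var x"
        by (simp add: var_def monomial_def mult_single)
      also have "\<dots> \<in> ideal.span (var ` Z)"
        using x(2) by (intro ideal.span_scale ideal.span_base) blast
      finally show "Poly_Mapping.single t (Poly_Mapping.lookup f t) \<in> ideal.span (var ` Z)" .
    qed
    then show "f \<in> ideal.span (var ` Z)" using poly_mapping_sum_singles[of f] by simp
  qed
qed

text \<open>
  The multidegrees in which the Koszul complex of the squares sees the link of \<open>\<sigma>\<close>. The exponent 1 at a variable of \<open>\<sigma>\<close>
  is not divisible by a square, so no differential can add an element of \<open>\<sigma>\<close> to the index set; the exponent 2 at a variable of \<open>U\<close>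
  records that the corresponding square has been multiplied in.
\<close>

definition face_exponent :: "'v::finite set \<Rightarrow> 'v set \<Rightarrow> ('v \<Rightarrow>\<^sub>0 nat)" where
  "face_exponent \<sigma> U = Poly_Mapping.Abs_poly_mapping (\<lambda>x. if x \<in> \<sigma> then 1 else if x \<in> U then 2 else 0)"

lemma lookup_face_exponent:
  "Poly_Mapping.lookup (face_exponent \<sigma> U) x = (if x \<in> \<sigma> then 1 else if x \<in> U then 2 else 0)"
  unfolding face_exponent_def by simp

lemma keys_face_exponent: "Poly_Mapping.keys (face_exponent \<sigma> U) = \<sigma> \<union> U"
  by (auto simp: in_keys_iff lookup_face_exponent split: if_splits)

lemma face_exponent_remove:
  assumes "x \<in> U" "x \<notin> \<sigma>"
  shows "face_exponent \<sigma> U = Poly_Mapping.single x 2 + face_exponent \<sigma> (U - {x})"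
  using assms by (intro poly_mapping_eqI) (auto simp: lookup_add lookup_single lookup_face_exponent when_def)

lemma alt_sign_mpoly:
  "(alt_sign ord x T :: ('v, 'k::field) mpoly) = Poly_Mapping.single 0 (alt_sign ord x T)"
proof -
  have "(- 1) ^ n = (Poly_Mapping.single 0 ((- 1) ^ n) :: ('v, 'k) mpoly)" for n :: nat
  proof (induction n)
    case (Suc n)
    have "Poly_Mapping.single 0 ((- 1) ^ Suc n) = (Poly_Mapping.single 0 (- 1) :: ('v, 'k) mpoly) * Poly_Mapping.single 0 ((- 1) ^ n)"
      by (simp add: mult_single single_uminus)
    also have "Poly_Mapping.single 0 (- 1) = (- 1 :: ('v, 'k) mpoly)" by (simp add: single_uminus)
    finally show ?case using Suc by simp
  qed simp
  then show ?thesis unfolding alt_sign_def .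
qed

lemma single_sum: "Poly_Mapping.single t (\<Sum>x\<in>A. a x) = (\<Sum>x\<in>A. Poly_Mapping.single t (a x))"
  by (intro poly_mapping_eqI) (simp add: lookup_sum lookup_single when_def)

lemma var_power2: "(var x)\<^sup>2 = Poly_Mapping.single (Poly_Mapping.single x 2) 1"
proof -
  have "Poly_Mapping.single x (1::nat) + Poly_Mapping.single x 1 = Poly_Mapping.single x 2"
    unfolding single_add[symmetric] by (simp add: numeral_2_eq_2)
  then show ?thesis by (simp only: var_def monomial_def power2_eq_square mult_single mult_1_left)
qed

text \<open>
  Given a cocycle \<open>\<mu>\<close> on the link of \<open>\<sigma>\<close>, extend it by zero to all sets. The coboundary of the extension vanishes on the link, so
  its values can be attached to monomials of the ideal, which gives a Koszul cocycle \<open>c\<close>. By exactness \<open>c\<close> is the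
  differential of some \<open>b\<close>, and the coefficients of \<open>b\<close> form a cochain \<open>\<nu>\<close> with the same coboundary as the extension of \<open>\<mu>\<close>. As \<open>b\<close>
  has values in the ideal, \<open>\<nu>\<close> is zero on the link. The difference of the two is a cocycle on a full simplex, hence
  a coboundary, and on the link it is \<open>\<mu>\<close>.
\<close>

lemma link_acyclic_of_koszul_exact:
  fixes \<Delta> :: "'v::finite set set"
  assumes simp: "simplicial \<Delta>" and proper: "UNIV \<notin> \<Delta>"
    and exact: "\<And>(ord :: 'v \<Rightarrow> nat) i. inj ord \<Longrightarrow> i < r \<Longrightarrow>
      koszul_exact ord (\<lambda>x. (var x)\<^sup>2) (support_ideal \<Delta> :: ('v, 'k::field) mpoly set) {0} i"
  shows "link_acyclic TYPE('k) \<Delta> r"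
  unfolding link_acyclic_def cohomology_vanishes_def
proof (intro allI impI ballI)
  fix ord :: "'v \<Rightarrow> nat" and \<sigma> s and \<mu> :: "'v set \<Rightarrow> 'k"
  assume ord: "inj ord" and \<sigma>: "\<sigma> \<in> \<Delta>" and r: "card \<sigma> + s + 1 < r"
  let ?L = "link \<Delta> \<sigma>" and ?d = "cobd ord (\<lambda>_. 1 :: 'k)"
  assume cocycle: "\<forall>T\<in>?L. card T = Suc s \<longrightarrow> ?d \<mu> T = 0"
  let ?e = "face_exponent \<sigma>" and ?w = "\<lambda>x. (var x :: ('v, 'k) mpoly)\<^sup>2"
  have L_sub: "U \<in> ?L" if "T \<in> ?L" "U \<subseteq> T" for T U
    using that simplicial_link[OF simp] unfolding simplicial_def by blast
  define \<mu>0 where "\<mu>0 T = (if T \<in> ?L then \<mu> T else 0)" for T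
  \<comment> \<open>placing \<open>\<sigma>\<close> last makes the signs in \<open>T\<close> agree with those in \<open>T - \<sigma>\<close>\<close>
  define ord' where "ord' x = (if x \<in> \<sigma> then Suc (Max (range ord)) + ord x else ord x)" for x
  have below: "ord x \<le> Max (range ord)" for x by simp
  have ord': "inj ord'"
  proof (rule injI)
    fix x y assume "ord' x = ord' y"
    moreover have "Suc (Max (range ord)) + ord y \<noteq> ord x" for x y using below[of x] by linarith
    ultimately have "ord x = ord y" unfolding ord'_def by (metis (no_types, lifting) add_left_cancel)
    then show "x = y" using ord by (simp add: inj_eq)
  qed
  have sign: "alt_sign ord' x T = (alt_sign ord x (T - \<sigma>) :: 'k)" if "x \<notin> \<sigma>" for x T
  proof -
    have "\<not> ord' y < ord' x" if "y \<in> \<sigma>" for y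
    proof -
      have "\<not> Suc (Max (range ord)) + ord y < ord x" using below[of x] by linarith
      then show ?thesis using that \<open>x \<notin> \<sigma>\<close> by (simp only: ord'_def if_True if_False simp_thms)
    qed
    then have "{y \<in> T. ord' y < ord' x} = {y \<in> T - \<sigma>. ord y < ord x}"
      using that unfolding ord'_def by auto
    then show ?thesis unfolding alt_sign_def by simp
  qed
  define c where "c T = (if \<sigma> \<subseteq> T \<and> card (T - \<sigma>) = Suc s
      then Poly_Mapping.single (?e (T - \<sigma>)) (?d \<mu>0 (T - \<sigma>)) else 0)" for T
  let ?i = "card \<sigma> + Suc s"
  have "c T \<in> support_ideal \<Delta>" for T
  proof (cases "\<sigma> \<subseteq> T \<and> card (T - \<sigma>) = Suc s")
    case True
    then have T: "\<sigma> \<union> (T - \<sigma>) = T" by blast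
    show ?thesis
    proof (cases "T \<in> \<Delta>")
      case face: True
      then have "T - \<sigma> \<in> ?L" using T by (auto simp: link_def Un_commute)
      then have "?d \<mu>0 (T - \<sigma>) = ?d \<mu> (T - \<sigma>)"
        using L_sub by (intro cobd_cong) (auto simp: \<mu>0_def)
      also have "\<dots> = 0" using cocycle \<open>T - \<sigma> \<in> ?L\<close> True by blast
      finally show ?thesis by (simp add: c_def support_ideal_def)
    next
      case False
      then show ?thesis using True T by (auto simp: c_def support_ideal_def keys_face_exponent)
    qed
  next
    case False
    then have "c T = 0" unfolding c_def by (simp only: if_False)
    then show ?thesis by (simp add: support_ideal_def)
  qed
  moreover have "cobd ord' ?w c T \<in> {0}" if T: "card T = Suc ?i" for T
  proof (cases "\<sigma> \<subseteq> T")
    case False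
    then have "c (T - {x}) = 0" for x by (auto simp: c_def)
    then show ?thesis by (simp add: cobd_def)
  next
    case True
    have card: "card (T - \<sigma>) = Suc (Suc s)" using True T by (simp add: card_Diff_subset)
    have summand: "alt_sign ord' x T * (?w x * c (T - {x}))
       = Poly_Mapping.single (?e (T - \<sigma>)) (alt_sign ord x (T - \<sigma>) * ?d \<mu>0 (T - \<sigma> - {x}))"
      if x: "x \<in> T - \<sigma>" for x
    proof -
      have "T - {x} - \<sigma> = T - \<sigma> - {x}" by blast
      moreover have "card (T - \<sigma> - {x}) = Suc s" using card x by simp
      ultimately have "c (T - {x}) = Poly_Mapping.single (?e (T - \<sigma> - {x})) (?d \<mu>0 (T - \<sigma> - {x}))"
        using True x by (auto simp: c_def)
      moreover have "?e (T - \<sigma>) = Poly_Mapping.single x 2 + ?e (T - \<sigma> - {x})"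
        using x by (intro face_exponent_remove) auto
      ultimately show ?thesis
        using x by (simp add: alt_sign_mpoly sign var_power2 mult_single)
    qed
    have "cobd ord' ?w c T = (\<Sum>x\<in>T - \<sigma>. alt_sign ord' x T * (?w x * c (T - {x})))"
      unfolding cobd_def by (rule sum.mono_neutral_right) (auto simp: c_def)
    also have "\<dots> = Poly_Mapping.single (?e (T - \<sigma>)) (?d (?d \<mu>0) (T - \<sigma>))"
      unfolding cobd_def[of ord _ _ "T - \<sigma>"] single_sum using summand by (intro sum.cong) auto
    also have "\<dots> = 0" by (simp add: cobd_cobd[OF ord])
    finally show ?thesis by simp
  qed
  ultimately have "\<exists>b. (\<forall>T. b T \<in> support_ideal \<Delta>) \<and> (\<forall>T. card T = ?i \<longrightarrow> c T - cobd ord' ?w b T \<in> {0})"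
    using exact[OF ord', of ?i] r unfolding koszul_exact_def by simp
  then obtain b where b: "\<And>T. b T \<in> support_ideal \<Delta>" and cb: "\<And>T. card T = ?i \<Longrightarrow> c T = cobd ord' ?w b T"
    by auto
  define \<nu> where "\<nu> U = Poly_Mapping.lookup (b (\<sigma> \<union> U)) (?e U)" for U
  have "?d \<mu>0 U = ?d \<nu> U" if U: "U \<inter> \<sigma> = {}" "card U = Suc s" for U
  proof -
    let ?T = "\<sigma> \<union> U"
    have T: "?T - \<sigma> = U" "card ?T = ?i" using U by (auto simp: card_Un_disjoint Int_commute)
    have "?d \<mu>0 U = Poly_Mapping.lookup (c ?T) (?e U)" using U T by (simp add: c_def)
    also have "\<dots> = (\<Sum>x\<in>?T. Poly_Mapping.lookup (alt_sign ord' x ?T * (?w x * b (?T - {x}))) (?e U))"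
      unfolding cb[OF T(2)] cobd_def lookup_sum ..
    also have "\<dots> = (\<Sum>x\<in>U. Poly_Mapping.lookup (alt_sign ord' x ?T * (?w x * b (?T - {x}))) (?e U))"
    proof (rule sum.mono_neutral_right)
      show "\<forall>x\<in>?T - U. Poly_Mapping.lookup (alt_sign ord' x ?T * (?w x * b (?T - {x}))) (?e U) = 0"
      proof
        fix x assume "x \<in> ?T - U"
        then have "Poly_Mapping.lookup (?w x * b (?T - {x})) (?e U) = 0"
          unfolding var_power2 by (intro lookup_single_times_eq_0[of _ x]) (auto simp: lookup_face_exponent lookup_single)
        then show "Poly_Mapping.lookup (alt_sign ord' x ?T * (?w x * b (?T - {x}))) (?e U) = 0"
          using lookup_single_times[of 0 "alt_sign ord' x ?T" "?w x * b (?T - {x})" "?e U"]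
          by (simp add: alt_sign_mpoly)
      qed
    qed auto
    also have "\<dots> = ?d \<nu> U"
      unfolding cobd_def
    proof (rule sum.cong[OF refl])
      fix x assume x: "x \<in> U"
      then have x\<sigma>: "x \<notin> \<sigma>" using U by blast
      have T': "?T - {x} = \<sigma> \<union> (U - {x})" using x\<sigma> by blast
      have "Poly_Mapping.lookup (?w x * b (?T - {x})) (?e U) = \<nu> (U - {x})"
        unfolding \<nu>_def T' face_exponent_remove[OF x x\<sigma>] var_power2 lookup_single_times by simp
      then show "Poly_Mapping.lookup (alt_sign ord' x ?T * (?w x * b (?T - {x}))) (?e U)
          = alt_sign ord x U * (1 * \<nu> (U - {x}))"
        using lookup_single_times[of 0 "alt_sign ord' x ?T" "?w x * b (?T - {x})" "?e U"]
        by (simp add: alt_sign_mpoly sign[OF x\<sigma>] T(1))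
    qed
    finally show ?thesis .
  qed
  then have zero: "?d (\<lambda>U. \<mu>0 U - \<nu> U) U = 0" if "U \<inter> \<sigma> = {}" "card U = Suc s" for U
    using that by (simp add: cobd_diff)
  have \<nu>0: "\<nu> U = 0" if "U \<in> ?L" for U
  proof -
    have "\<sigma> \<union> U \<in> \<Delta>" using that by (simp add: link_def Un_commute)
    then have "?e U \<notin> Poly_Mapping.keys (b (\<sigma> \<union> U))"
      using b[of "\<sigma> \<union> U"] unfolding support_ideal_def by (metis (mono_tags, lifting) keys_face_exponent mem_Collect_eq)
    then show ?thesis by (simp add: \<nu>_def in_keys_iff)
  qed
  have "\<sigma> \<noteq> UNIV" using \<sigma> proper by blast
  then obtain y where y: "y \<notin> \<sigma>" by blast
  \<comment> \<open>the full simplex outside \<open>\<sigma>\<close> is a cone with any of its vertices as apex\<close>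
  have "cohomology_vanishes TYPE('k) ord {T. T \<inter> \<sigma> = {}} s"
    using y by (intro cohomology_vanishes_cone[OF ord, of _ y]) auto
  then obtain \<rho> where \<rho>: "\<And>T. T \<inter> \<sigma> = {} \<Longrightarrow> card T = s \<Longrightarrow> \<mu>0 T - \<nu> T = ?d \<rho> T"
    using zero unfolding cohomology_vanishes_def by (metis (mono_tags, lifting) mem_Collect_eq)
  have "\<mu> T = ?d \<rho> T" if "T \<in> ?L" "card T = s" for T
    using \<rho>[of T] that \<nu>0[OF that(1)] by (simp add: link_def \<mu>0_def)
  then show "\<exists>\<nu>. \<forall>T\<in>?L. card T = s \<longrightarrow> \<mu> T = ?d \<nu> T" by blast
qed

text \<open>
  Every element of the irrelevant ideal has a power in the ideal generated by the squares of the variables.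
\<close>

lemma regular_sequence_link_acyclic:
  fixes \<Delta> :: "'v::finite set set"
  assumes simp: "simplicial \<Delta>" and proper: "UNIV \<notin> \<Delta>"
    and reg: "regular_sequence (support_ideal \<Delta> :: ('v, 'k::field) mpoly set) as" and irr: "set as \<subseteq> irrelevant_ideal"
  shows "link_acyclic TYPE('k) \<Delta> (length as)"
proof (rule link_acyclic_of_koszul_exact[OF simp proper])
  fix ord :: "'v \<Rightarrow> nat" and i assume ord: "inj ord" and i: "i < length as"
  let ?w = "\<lambda>x. (var x :: ('v, 'k) mpoly)\<^sup>2"
  show "koszul_exact ord ?w (support_ideal \<Delta>) {0} i"
  proof (rule regular_sequence_koszul_exact[OF ord ideal_subspace_support_ideal[OF simp] reg _ i])
    fix a assume "a \<in> set as"
    then have a: "a \<in> ideal.span (range var)" using irr by (auto simp: irrelevant_ideal_def)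
    show "\<exists>m. a ^ m \<in> ideal.span (range ?w)"
    proof (rule span_in_radical[OF ideal.subspace_span _ a])
      fix z :: "('v, 'k) mpoly" assume "z \<in> range var"
      then have "z ^ 2 \<in> ideal.span (range ?w)" by (auto intro: ideal.span_base)
      then show "\<exists>m. z ^ m \<in> ideal.span (range ?w)" by blast
    qed
  qed
qed

section \<open>From interval partitions to Stanley decompositions\<close>

definition supported_on :: "('v \<Rightarrow>\<^sub>0 nat) set \<Rightarrow> ('v, 'k::field) mpoly set" where
  "supported_on W = {f. Poly_Mapping.keys f \<subseteq> W}"

text \<open>
  Each monomial belongs to at most one summand, so the coefficients of a sum can be read off from the summands.
\<close>

lemma is_direct_sum_supported_on:
  fixes W :: "'i \<Rightarrow> ('v \<Rightarrow>\<^sub>0 nat) set"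
  assumes fin: "finite A" and disj: "\<And>i j. i \<in> A \<Longrightarrow> j \<in> A \<Longrightarrow> i \<noteq> j \<Longrightarrow> W i \<inter> W j = {}"
  shows "is_direct_sum A (\<lambda>i. supported_on (W i) :: ('v, 'k::field) mpoly set) (supported_on (\<Union>i\<in>A. W i))"
  unfolding is_direct_sum_def
proof (intro conjI allI impI ballI)
  have coeff: "Poly_Mapping.lookup (\<Sum>i\<in>A. v i) t = Poly_Mapping.lookup (v i) t"
    if "\<forall>i\<in>A. v i \<in> supported_on (W i)" "i \<in> A" "t \<in> W i" for v :: "'i \<Rightarrow> ('v, 'k) mpoly" and i t
  proof -
    have "Poly_Mapping.lookup (v j) t = 0" if "j \<in> A - {i}" for j
    proof -
      have "t \<notin> Poly_Mapping.keys (v j)"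
        using \<open>\<forall>i\<in>A. v i \<in> supported_on (W i)\<close> that disj[of i j] \<open>i \<in> A\<close> \<open>t \<in> W i\<close>
        unfolding supported_on_def by blast
      then show ?thesis by (simp add: in_keys_iff)
    qed
    then have "(\<Sum>j\<in>A - {i}. Poly_Mapping.lookup (v j) t) = 0" by (intro sum.neutral) blast
    then show ?thesis
      unfolding lookup_sum using fin \<open>i \<in> A\<close> by (simp add: sum.remove)
  qed
  show "supported_on (\<Union>i\<in>A. W i) = {\<Sum>i\<in>A. v i |v. \<forall>i\<in>A. v i \<in> (supported_on (W i) :: ('v, 'k) mpoly set)}" (is "?L = ?R")
  proof
    show "?L \<subseteq> ?R"
    proof
      fix f :: "('v, 'k) mpoly" assume f: "f \<in> ?L"
      define v where "v i = (\<Sum>t\<in>Poly_Mapping.keys f \<inter> W i. Poly_Mapping.single t (Poly_Mapping.lookup f t))" for i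
      have lookup_v: "Poly_Mapping.lookup (v i) k = (if k \<in> W i then Poly_Mapping.lookup f k else 0)" for i k
        unfolding v_def lookup_sum by (simp add: lookup_single when_def in_keys_iff)
      have v: "\<forall>i\<in>A. v i \<in> supported_on (W i)"
        by (auto simp: supported_on_def in_keys_iff lookup_v split: if_splits)
      have "f = (\<Sum>i\<in>A. v i)"
      proof (rule poly_mapping_eqI)
        fix k
        show "Poly_Mapping.lookup f k = Poly_Mapping.lookup (\<Sum>i\<in>A. v i) k"
        proof (cases "\<exists>i\<in>A. k \<in> W i")
          case True
          then obtain i where "i \<in> A" "k \<in> W i" by blast
          then show ?thesis using coeff[OF v] by (simp add: lookup_v)
        next
          case False
          then have "k \<notin> Poly_Mapping.keys f" using f by (auto simp: supported_on_def)
          then show ?thesis using False by (simp add: lookup_sum lookup_v in_keys_iff)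
        qed
      qed
      then show "f \<in> ?R" using v by blast
    qed
    show "?R \<subseteq> ?L"
    proof
      fix f :: "('v, 'k) mpoly" assume "f \<in> ?R"
      then obtain v where f: "f = (\<Sum>i\<in>A. v i)" and v: "\<forall>i\<in>A. v i \<in> supported_on (W i)" by blast
      have "Poly_Mapping.lookup f k = 0" if "k \<notin> (\<Union>i\<in>A. W i)" for k
        unfolding f lookup_sum
      proof (rule sum.neutral, rule ballI)
        fix i assume "i \<in> A"
        then have "k \<notin> Poly_Mapping.keys (v i)" using v that unfolding supported_on_def by blast
        then show "Poly_Mapping.lookup (v i) k = 0" by (simp add: in_keys_iff)
      qed
      then show "f \<in> ?L" unfolding supported_on_def by (metis (mono_tags, lifting) in_keys_iff mem_Collect_eq subsetI)
    qed
  qed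
  fix v :: "'i \<Rightarrow> ('v, 'k) mpoly" and i
  assume v: "(\<forall>i\<in>A. v i \<in> supported_on (W i)) \<and> (\<Sum>i\<in>A. v i) = 0" and i: "i \<in> A"
  show "v i = 0"
  proof (rule poly_mapping_eqI)
    fix t
    show "Poly_Mapping.lookup (v i) t = Poly_Mapping.lookup 0 t"
    proof (cases "t \<in> W i")
      case True
      then show ?thesis using coeff[OF conjunct1[OF v] i True] v by simp
    next
      case False
      then have "t \<notin> Poly_Mapping.keys (v i)" using v i unfolding supported_on_def by blast
      then show ?thesis by (simp add: in_keys_iff)
    qed
  qed
qed

definition squarefree_exponent :: "'v::finite set \<Rightarrow> ('v \<Rightarrow>\<^sub>0 nat)" where
  "squarefree_exponent A = Poly_Mapping.Abs_poly_mapping (\<lambda>x. if x \<in> A then 1 else 0)"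

lemma lookup_squarefree_exponent:
  "Poly_Mapping.lookup (squarefree_exponent A) x = (if x \<in> A then 1 else 0)"
  unfolding squarefree_exponent_def by simp

lemma keys_squarefree_exponent: "Poly_Mapping.keys (squarefree_exponent A) = A"
  by (auto simp: in_keys_iff lookup_squarefree_exponent split: if_splits)

lemma kspace_subspace_supported_on: "kspace.subspace (supported_on W :: ('v, 'k::field) mpoly set)"
proof (rule kspace.subspaceI)
  fix f g :: "('v, 'k) mpoly" and c :: 'k
  show "0 \<in> supported_on W" by (simp add: supported_on_def)
  show "f + g \<in> supported_on W" if "f \<in> supported_on W" "g \<in> supported_on W"
    using that keys_add[of f g] unfolding supported_on_def by blast
  show "kscale c f \<in> supported_on W" if "f \<in> supported_on W"
  proof -
    have "Poly_Mapping.keys (kscale c f) \<subseteq> Poly_Mapping.keys f"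
      unfolding kscale_def using keys_mult[of "Poly_Mapping.single 0 c" f] by (auto split: if_splits)
    then show ?thesis using that unfolding supported_on_def by blast
  qed
qed

text \<open>
  A monomial lies in the space iff \<open>A\<close> is contained in its support and its support in \<open>B\<close>: the exponents above 1 on \<open>A\<close>
  are supplied by the polynomials in the variables of \<open>B\<close>.
\<close>

lemma stanley_space_squarefree:
  fixes A B :: "'v::finite set"
  assumes "A \<subseteq> B"
  shows "(stanley_space (squarefree_exponent A) B :: ('v, 'k::field) mpoly set)
    = supported_on {t. Poly_Mapping.keys t \<in> {A..B}}" (is "?L = supported_on ?W")
proof
  show "?L \<subseteq> supported_on ?W"
    unfolding stanley_space_def
  proof (rule kspace.span_minimal[OF _ kspace_subspace_supported_on], rule subsetI)
    fix g :: "('v, 'k) mpoly"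
    assume "g \<in> {monomial (squarefree_exponent A) * f |f. f \<in> polys_in B}"
    then obtain f where g: "g = monomial (squarefree_exponent A) * f" and f: "f \<in> polys_in B" by blast
    show "g \<in> supported_on ?W"
      unfolding supported_on_def
    proof (intro CollectI subsetI)
      fix t assume "t \<in> Poly_Mapping.keys g"
      then obtain s where "t = squarefree_exponent A + s" "s \<in> Poly_Mapping.keys f"
        using keys_mult[of "monomial (squarefree_exponent A) :: ('v, 'k) mpoly" f]
        unfolding g monomial_def by auto
      then show "Poly_Mapping.keys t \<in> {A..B}"
        using f assms by (auto simp: polys_in_def keys_add_exponents keys_squarefree_exponent)
    qed
  qed
  show "supported_on ?W \<subseteq> ?L"
  proof
    fix f :: "('v, 'k) mpoly" assume f: "f \<in> supported_on ?W"
    have "(\<Sum>t\<in>Poly_Mapping.keys f. Poly_Mapping.single t (Poly_Mapping.lookup f t)) \<in> ?L"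
      unfolding stanley_space_def
    proof (rule kspace.span_sum)
      fix t assume "t \<in> Poly_Mapping.keys f"
      then have t: "Poly_Mapping.keys t \<in> {A..B}" using f by (auto simp: supported_on_def)
      define s where "s = t - squarefree_exponent A"
      have eq: "t = squarefree_exponent A + s"
        using t by (intro poly_mapping_eqI)
          (auto simp: s_def lookup_add lookup_minus lookup_squarefree_exponent in_keys_iff subset_iff)
      have "Poly_Mapping.keys s \<subseteq> B" using t unfolding eq keys_add_exponents by auto
      then have "Poly_Mapping.single s (Poly_Mapping.lookup f t) \<in> polys_in B"
        by (auto simp: polys_in_def)
      moreover have "Poly_Mapping.single t (Poly_Mapping.lookup f t)
          = monomial (squarefree_exponent A) * Poly_Mapping.single s (Poly_Mapping.lookup f t)"
        using eq by (simp add: monomial_def mult_single)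
      ultimately show "Poly_Mapping.single t (Poly_Mapping.lookup f t)
          \<in> kspace.span {monomial (squarefree_exponent A) * f |f. f \<in> polys_in B}"
        by (intro kspace.span_base) blast
    qed
    then show "f \<in> ?L" using poly_mapping_sum_singles[of f] by simp
  qed
qed

lemma partitionable_list:
  assumes "partitionable d \<P>"
  shows "\<exists>D. (\<forall>p\<in>set D. fst p \<subseteq> snd p \<and> d \<le> card (snd p)) \<and> \<P> = (\<Union>p\<in>set D. {fst p..snd p}) \<and>
    sorted_wrt (\<lambda>p q. {fst p..snd p} \<inter> {fst q..snd q} = {}) D"
  using assms
proof induction
  case empty
  show ?case by (intro exI[of _ "[]"]) simp
next
  case (interval \<P> A B)
  then obtain D where D: "\<forall>p\<in>set D. fst p \<subseteq> snd p \<and> d \<le> card (snd p)"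
    "\<P> = (\<Union>p\<in>set D. {fst p..snd p})" "sorted_wrt (\<lambda>p q. {fst p..snd p} \<inter> {fst q..snd q} = {}) D"
    by (elim exE conjE)
  have "{A..B} \<inter> {fst p..snd p} = {}" if "p \<in> set D" for p
    using interval.hyps(4) that unfolding D(2) by blast
  then show ?case
    using D(1,3) interval.hyps(2,3) by (intro exI[of _ "(A,B) # D"]) (simp add: D(2))
qed

text \<open>
  An interval of supports becomes a Stanley space generated by a squarefree monomial.
\<close>

lemma le_sdepth_of_partitionable:
  fixes \<Delta> :: "'v::finite set set"
  assumes part: "partitionable d (nonfaces UNIV \<Delta>)" and proper: "UNIV \<notin> \<Delta>"
  shows "d \<le> sdepth (support_ideal \<Delta> :: ('v, 'k::field) mpoly set)"
proof -
  let ?I = "support_ideal \<Delta> :: ('v, 'k) mpoly set"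
  obtain D where D': "\<forall>p\<in>set D. fst p \<subseteq> snd p \<and> d \<le> card (snd p)"
    and union: "nonfaces UNIV \<Delta> = (\<Union>p\<in>set D. {fst p..snd p})"
    and sorted: "sorted_wrt (\<lambda>p q. {fst p..snd p} \<inter> {fst q..snd q} = {}) D"
    using partitionable_list[OF part] by (elim exE conjE)
  have D: "fst p \<subseteq> snd p" "d \<le> card (snd p)" if "p \<in> set D" for p
    using D' that by blast+
  define E where "E = map (\<lambda>p. (squarefree_exponent (fst p), snd p)) D"
  define W where "W i = {t :: 'v \<Rightarrow>\<^sub>0 nat. Poly_Mapping.keys t \<in> {fst (D ! i)..snd (D ! i)}}" for i
  have space: "stanley_space (fst (E ! i)) (snd (E ! i)) = (supported_on (W i) :: ('v, 'k) mpoly set)"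
    if "i < length D" for i
    using stanley_space_squarefree[of "fst (D ! i)" "snd (D ! i)", where 'k = 'k] D(1)[OF nth_mem[OF that]] that
    by (simp add: E_def W_def)
  have disj_less: "W i \<inter> W j = {}" if "i < j" "j < length D" for i j
  proof -
    have "{fst (D ! i)..snd (D ! i)} \<inter> {fst (D ! j)..snd (D ! j)} = {}"
      using sorted that unfolding sorted_wrt_iff_nth_less by blast
    then show ?thesis unfolding W_def by blast
  qed
  have disj: "W i \<inter> W j = {}" if "i \<in> {..<length D}" "j \<in> {..<length D}" "i \<noteq> j" for i j
  proof (cases "i < j")
    case True
    then show ?thesis using disj_less[of i j] that by simp
  next
    case False
    then have "W j \<inter> W i = {}" using disj_less[of j i] that by simp
    then show ?thesis by (simp add: Int_commute)
  qed
  have nonface: "T \<notin> \<Delta> \<longleftrightarrow> (\<exists>i<length D. T \<in> {fst (D ! i)..snd (D ! i)})" for T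
  proof -
    have "T \<notin> \<Delta> \<longleftrightarrow> T \<in> nonfaces UNIV \<Delta>" by (simp add: nonfaces_def)
    also have "\<dots> \<longleftrightarrow> (\<exists>p\<in>set D. T \<in> {fst p..snd p})" unfolding union by blast
    also have "\<dots> \<longleftrightarrow> (\<exists>i<length D. T \<in> {fst (D ! i)..snd (D ! i)})" by (metis in_set_conv_nth)
    finally show ?thesis .
  qed
  have I: "?I = supported_on (\<Union>i\<in>{..<length D}. W i)"
  proof -
    have "(\<Union>i\<in>{..<length D}. W i) = {t. Poly_Mapping.keys t \<notin> \<Delta>}"
      unfolding nonface W_def by blast
    then show ?thesis unfolding support_ideal_def supported_on_def by (simp only:) blast
  qed
  have len: "length E = length D" by (simp add: E_def)
  have dec: "stanley_decomposition ?I E"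
    unfolding stanley_decomposition_def
  proof (intro conjI)
    show "\<forall>(t, Z)\<in>set E. monomial t \<in> ?I \<and> stanley_space t Z \<subseteq> ?I"
    proof (intro ballI, clarify)
      fix t Z assume "(t, Z) \<in> set E"
      then obtain i where i: "i < length D" "E ! i = (t, Z)" unfolding len[symmetric] by (metis in_set_conv_nth)
      then have t: "t = squarefree_exponent (fst (D ! i))" by (simp add: E_def)
      have "supported_on (W i) \<subseteq> ?I" unfolding I supported_on_def using i(1) by blast
      moreover have "monomial t \<in> (supported_on (W i) :: ('v, 'k) mpoly set)"
        using D(1)[OF nth_mem[OF i(1)]] by (simp add: t W_def supported_on_def monomial_def keys_squarefree_exponent)
      ultimately show "monomial t \<in> ?I \<and> stanley_space t Z \<subseteq> ?I"
        using space[OF i(1)] i(2) by auto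
    qed
    have "is_direct_sum {..<length D} (\<lambda>i. supported_on (W i) :: ('v, 'k) mpoly set) ?I"
      unfolding I by (rule is_direct_sum_supported_on[OF _ disj]) simp
    then show "is_direct_sum {..<length E} (\<lambda>i. stanley_space (fst (E ! i)) (snd (E ! i))) ?I"
      unfolding len is_direct_sum_def using space by simp
  qed
  have "UNIV \<in> nonfaces UNIV \<Delta>" using proper by (simp add: nonfaces_def)
  then have "E \<noteq> []" unfolding union by (auto simp: E_def)
  then have "d \<le> sdepth_decomposition E"
    unfolding sdepth_decomposition_def using D(2) by (subst Min_ge_iff) (auto simp: E_def)
  also have "\<dots> \<le> sdepth ?I"
    unfolding sdepth_def
  proof (rule Max_ge)
    have bound: "sdepth_decomposition D' \<le> card (UNIV :: 'v set)" if "D' \<noteq> []" for D' :: "(('v \<Rightarrow>\<^sub>0 nat) \<times> 'v set) list"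
    proof -
      have "sdepth_decomposition D' \<le> (\<lambda>(t, Z). card Z) (hd D')"
        unfolding sdepth_decomposition_def using that by (intro Min_le) auto
      also have "\<dots> \<le> card (UNIV :: 'v set)" by (auto simp: case_prod_beta intro: card_mono)
      finally show ?thesis .
    qed
    \<comment> \<open>the minimum over the empty list of pairs is an unspecified number\<close>
    have "{sdepth_decomposition D |D. stanley_decomposition ?I D}
        \<subseteq> insert (sdepth_decomposition ([] :: (('v \<Rightarrow>\<^sub>0 nat) \<times> 'v set) list)) {..card (UNIV :: 'v set)}"
    proof
      fix n assume "n \<in> {sdepth_decomposition D |D. stanley_decomposition ?I D}"
      then obtain D' :: "(('v \<Rightarrow>\<^sub>0 nat) \<times> 'v set) list" where n: "n = sdepth_decomposition D'" by blast
      show "n \<in> insert (sdepth_decomposition ([] :: (('v \<Rightarrow>\<^sub>0 nat) \<times> 'v set) list)) {..card (UNIV :: 'v set)}"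
        unfolding n using bound[of D'] by (cases "D' = []") simp_all
    qed
    then show "finite {sdepth_decomposition D |D. stanley_decomposition ?I D}"
      by (rule finite_subset) simp
  qed (use dec in blast)
  finally show ?thesis .
qed

theorem theorem4p2:
  fixes P :: "nat \<Rightarrow> ('v::finite, 'k::field) mpoly set"
    and I :: "('v, 'k) mpoly set"
  assumes "\<And>i. i \<in> {1..4} \<Longrightarrow> monomial_prime_ideal (P i)"
    and "reduced_intersection {1..4} P"
    and "I = (\<Inter>i\<in>{1..4}. P i)"
  shows "enat (sdepth I) \<ge> depth I"
proof -
  have "\<forall>i\<in>{1..4}. \<exists>Z. P i = ideal.span (var ` Z)"
    using assms(1) unfolding monomial_prime_ideal_def by blast
  then obtain Z where Z: "\<And>i. i \<in> {1..4} \<Longrightarrow> P i = ideal.span (var ` Z i)" by metis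
  define \<F> where "\<F> = (\<lambda>i. - Z i) ` {1..4::nat}"
  have I: "I = support_ideal (faces \<F>)"
  proof -
    have T: "T \<in> faces \<F> \<longleftrightarrow> (\<exists>i\<in>{1..4}. T \<inter> Z i = {})" for T
      unfolding faces_def \<F>_def by (auto simp: disjoint_eq_subset_Compl)
    show ?thesis
    proof (intro set_eqI)
      fix f
      have "f \<in> I \<longleftrightarrow> (\<forall>i\<in>{1..4}. f \<in> ideal.span (var ` Z i))"
        unfolding assms(3) using Z by simp
      also have "\<dots> \<longleftrightarrow> (\<forall>i\<in>{1..4}. \<forall>t\<in>Poly_Mapping.keys f. Poly_Mapping.keys t \<inter> Z i \<noteq> {})"
        unfolding span_vars by blast
      also have "\<dots> \<longleftrightarrow> f \<in> support_ideal (faces \<F>)"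
        unfolding support_ideal_def mem_Collect_eq T by blast
      finally show "f \<in> I \<longleftrightarrow> f \<in> support_ideal (faces \<F>)" .
    qed
  qed
  \<comment> \<open>a zero ideal among the primes would make all others superfluous\<close>
  have nonempty: "Z i \<noteq> {}" if i: "i \<in> {1..4}" for i
  proof
    assume "Z i = {}"
    then have zero: "P i = {0}" using Z[OF i] by (simp add: ideal.span_empty)
    obtain j where j: "j \<in> {1..4::nat}" "j \<noteq> i"
      using that[of "if i = 1 then 2 else 1"] by auto
    have "0 \<in> P k" if "k \<in> {1..4}" for k using Z[OF that] ideal.span_zero by metis
    then have "(\<Inter>k\<in>{1..4} - {j}. P k) = {0}" "(\<Inter>k\<in>{1..4}. P k) = {0}"
      using zero i j by auto
    then show False using assms(2) j(1) unfolding reduced_intersection_def by metis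
  qed
  have proper: "UNIV \<notin> faces \<F>"
  proof
    assume "UNIV \<in> faces \<F>"
    then obtain i where "i \<in> {1..4}" "UNIV \<subseteq> - Z i" unfolding faces_def \<F>_def by blast
    then show False using nonempty by blast
  qed
  have card: "card \<F> \<le> 4" using card_image_le[of "{1..4::nat}" "\<lambda>i. - Z i"] by (simp add: \<F>_def)
  have "\<F> \<noteq> {}" by (simp add: \<F>_def)
  show ?thesis
    unfolding depth_def
  proof (rule SUP_least)
    fix as :: "('v, 'k) mpoly list"
    assume "as \<in> {as. set as \<subseteq> irrelevant_ideal \<and> regular_sequence I as}"
    then have "link_acyclic TYPE('k) (faces \<F>) (length as)"
      unfolding I by (intro regular_sequence_link_acyclic[OF simplicial_faces proper]) auto
    then have "partitionable (length as) (nonfaces UNIV (faces \<F>))"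
      using card \<open>\<F> \<noteq> {}\<close> by (intro partitionable_nonfaces) auto
    then show "enat (length as) \<le> enat (sdepth I)"
      unfolding I using le_sdepth_of_partitionable[OF _ proper] by simp
  qed
qed

end
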